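(* Let $g(x)=x_-=\frac{x-|x|}{2}$ (resp., in the general case, let $g:\mathbb{R}\to\mathbb{R}$ be a Lipschitz function). For $\varepsilon$ small enough, the equation $$x''+x+\varepsilon f(x,\eta,\varepsilon)=0,\qquad f(x,\eta,\varepsilon)=-\eta x+(1-\varepsilon\eta)g(x),$$ has a $2\pi$-periodic solution, and it may be computed with the iterative process $$H(p,y^{k+1})=-E(p,y^k),\qquad E(p,y)=F(p,y)-H(p,y),\qquad p=(a,\varepsilon),\ y=(\eta,b).$$ Moreover, $\eta$ and $b$ are Lipschitz functions of $a,\varepsilon$, and so, for some constant $\kappa$, $$\left|x-a\cos\theta-b\sin\theta+\varepsilon\,r(\theta,a,0,\eta(0),0)\right|\le\kappa\,\varepsilon^2 .$$
   Context: A prime denotes $d/d\theta$. For $p=(a,\varepsilon)$ and $y=(\eta,b)$, $x$ is the solution of $x''+x+\varepsilon f(x,\eta,\varepsilon)=0$ with $x(0)=a$, $x'(0)=b$. One sets $$r(\theta,a,\varepsilon,\eta,b)=\int_0^\theta\sin(\theta-s)f(x(s),\eta,\varepsilon)\,ds,$$ so that $x=a\cos\theta+b\sin\theta-\varepsilon r(\theta,a,\varepsilon,\eta,b)$, and $F=(F_1,F_2)$ with $$F_1(p,y)=\int_0^{2\pi}\sin(s)f(x(s),\eta,\varepsilon)\,ds,\qquad F_2(p,y)=\int_0^{2\pi}\cos(s)f(x(s),\eta,\varepsilon)\,ds .$$ The solution $x$ is $2\pi$-periodic when $F(p,y)=0$, and this is the equation for $y$ that the iteration solves. The value $\eta(0)$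 of $\eta$ at $\varepsilon=0$ is $$\eta(0)=\frac{1}{a\pi}\int_0^{2\pi}\cos(s)\,g(a\cos s)\,ds,$$ which equals $\frac12$ when $g(x)=x_-$. The function $H=(H_1,H_2)$ is $$H_1(p,y)=\int_0^{2\pi}\sin(s)h(\xi(s),\eta,\varepsilon)\,ds,\qquad H_2(p,y)=\int_0^{2\pi}\cos(s)h(\xi(s),\eta,\varepsilon)\,ds,$$ where $\xi$ solves $\xi''+\xi+\varepsilon h(\xi,\eta,\varepsilon)=0$ with $\xi(0)=a$, $\xi'(0)=b$, and $h(\xi,\eta,\varepsilon)=-\eta\xi+(1-\varepsilon\eta)\alpha\xi$, with $0<\alpha<1$ and $\alpha\neq\eta(0)$. *)

theory Defs
  imports "HOL-Analysis.Analysis"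
begin

text \<open>
  Throughout, parameters are grouped as \<open>p = (a, \<epsilon>)\<close> and unknowns as \<open>y = (\<eta>, b)\<close>, and a
  nonlinearity is a function \<open>\<phi> x \<eta> \<epsilon>\<close>.
\<close>

definition ivp_solution ::
  "(real \<Rightarrow> real \<Rightarrow> real \<Rightarrow> real) \<Rightarrow> real \<times> real \<Rightarrow> real \<times> real \<Rightarrow> (real \<Rightarrow> real) \<Rightarrow> bool"
  where "ivp_solution \<phi> = (\<lambda>(a, \<epsilon>) (\<eta>, b) x. x 0 = a \<and>
    (\<exists>v. v 0 = b \<and>
      (\<forall>t. (x has_real_derivative v t) (at t) \<and>
           (v has_real_derivative - x t - \<epsilon> * \<phi> (x t) \<eta> \<epsilon>) (at t))))"

text \<open>The description below is proper whenever \<open>\<phi>\<close> is globally Lipschitz in its first argument,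
  which is the case for both nonlinearities used here.\<close>

definition sol ::
  "(real \<Rightarrow> real \<Rightarrow> real \<Rightarrow> real) \<Rightarrow> real \<times> real \<Rightarrow> real \<times> real \<Rightarrow> real \<Rightarrow> real"
  where "sol \<phi> p y = (THE x. ivp_solution \<phi> p y x)"

definition bif ::
  "(real \<Rightarrow> real \<Rightarrow> real \<Rightarrow> real) \<Rightarrow> real \<times> real \<Rightarrow> real \<times> real \<Rightarrow> real \<times> real"
  where "bif \<phi> p y =
    (LBINT s=ereal 0..ereal (2 * pi). sin s * \<phi> (sol \<phi> p y s) (fst y) (snd p),
     LBINT s=ereal 0..ereal (2 * pi). cos s * \<phi> (sol \<phi> p y s) (fst y) (snd p))"

text \<open>The integral is oriented, so that \<open>\<theta> < 0\<close> is allowed.\<close>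

definition rem ::
  "(real \<Rightarrow> real \<Rightarrow> real \<Rightarrow> real) \<Rightarrow> real \<Rightarrow> real \<times> real \<Rightarrow> real \<times> real \<Rightarrow> real"
  where "rem \<phi> \<theta> p y =
    (LBINT s=ereal 0..ereal \<theta>. sin (\<theta> - s) * \<phi> (sol \<phi> p y s) (fst y) (snd p))"

definition nonlin :: "(real \<Rightarrow> real) \<Rightarrow> real \<Rightarrow> real \<Rightarrow> real \<Rightarrow> real"
  where "nonlin g x \<eta> \<epsilon> = - \<eta> * x + (1 - \<epsilon> * \<eta>) * g x"

definition lin :: "real \<Rightarrow> real \<Rightarrow> real \<Rightarrow> real \<Rightarrow> real"
  where "lin \<alpha> \<xi> \<eta> \<epsilon> = - \<eta> * \<xi> + (1 - \<epsilon> * \<eta>) * \<alpha> * \<xi>"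

definition F :: "(real \<Rightarrow> real) \<Rightarrow> real \<times> real \<Rightarrow> real \<times> real \<Rightarrow> real \<times> real"
  where "F g = bif (nonlin g)"

definition H :: "real \<Rightarrow> real \<times> real \<Rightarrow> real \<times> real \<Rightarrow> real \<times> real"
  where "H \<alpha> = bif (lin \<alpha>)"

definition E :: "(real \<Rightarrow> real) \<Rightarrow> real \<Rightarrow> real \<times> real \<Rightarrow> real \<times> real \<Rightarrow> real \<times> real"
  where "E g \<alpha> p y = F g p y - H \<alpha> p y"

definition r ::
  "(real \<Rightarrow> real) \<Rightarrow> real \<Rightarrow> real \<Rightarrow> real \<Rightarrow> real \<Rightarrow> real \<Rightarrow> real"
  where "r g \<theta> a \<epsilon> \<eta> b = rem (nonlin g) \<theta> (a, \<epsilon>) (\<eta>, b)"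

definition eta0 :: "(real \<Rightarrow> real) \<Rightarrow> real \<Rightarrow> real"
  where "eta0 g a = 1 / (a * pi) * (LBINT s=ereal 0..ereal (2 * pi). cos s * g (a * cos s))"

definition neg_part :: "real \<Rightarrow> real"
  where "neg_part x = (x - \<bar>x\<bar>) / 2"

text \<open>The equation \<open>H(p, Y (k+1)) = - E(p, Y k)\<close> determines \<open>Y (k+1)\<close> only locally, so
  the iterates are confined to a set \<open>W\<close>.\<close>

definition iteration ::
  "(real \<Rightarrow> real) \<Rightarrow> real \<Rightarrow> real \<times> real \<Rightarrow> (real \<times> real) set \<Rightarrow> (nat \<Rightarrow> real \<times> real) \<Rightarrow> bool"
  where "iteration g \<alpha> p W Y \<longleftrightarrow>
    (\<forall>k. Y k \<in> W) \<and> (\<forall>k. H \<alpha> p (Y (Suc k)) = - E g \<alpha> p (Y k))"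

end

theory Submission
  imports Defs
begin

text \<open>
  The obstacle is that the iteration has a neutral direction. At \<open>\<epsilon> = 0\<close> the solution is a
  harmonic oscillation of some amplitude and phase; \<open>F\<close> vanishes as soon as \<open>\<eta>\<close> has the value that
  belongs to the amplitude, whatever the phase, and the iteration replaces \<open>(\<eta>, b)\<close> by
  \<open>(eta0, b)\<close>, with \<open>eta0\<close> taken at the amplitude \<open>sqrt (a\<^sup>2 + b\<^sup>2)\<close>: it corrects
  \<open>\<eta>\<close> in one step and leaves \<open>b\<close> alone. For
  \<open>\<epsilon> \<noteq> 0\<close> this persists: phase shifts of a periodic solution are periodic solutions, so the zeros of
  \<open>F (a, \<epsilon>)\<close> form a curve, the iteration is not a contraction, and the limit depends on the
  starting point.

  Convergence rests on conservation of energy. The function \<open>x'\<^sup>2/2 + x\<^sup>2/2 + \<epsilon> \<Gamma> x\<close>, with \<open>\<Gamma>\<close> an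
  antiderivative of \<open>f\<close>, is constant along a solution. Comparing the times \<open>0\<close> and \<open>2\<pi>\<close> and
  dividing by \<open>\<epsilon>\<close> gives \<open>F\<^sub>1 = m F\<^sub>2\<close> with a Lipschitz factor \<open>m\<close> of size
  \<open>O(\<bar>b\<bar> + \<bar>\<epsilon>\<bar>)\<close> (\<open>energy_identity\<close>, \<open>slope_properties\<close>). Hence one scalar, \<open>F\<^sub>2\<close>, measures the
  defect. One step of the iteration moves \<open>y\<close> by at most a multiple of \<open>F\<^sub>2\<close>, moves \<open>b\<close> by a small
  multiple of \<open>F\<^sub>2\<close>, and produces a new \<open>F\<^sub>2\<close> that is at most half the old one, because \<open>F - H\<close>
  depends on \<open>\<eta>\<close> only through terms of order \<open>\<epsilon>\<close>. The iterates therefore form a Cauchy sequence whose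
  limit is a zero of \<open>F\<close>, that is, the initial data of a periodic solution.

  The delicate point is that the limit is Lipschitz in \<open>p = (a, \<epsilon>)\<close> although \<open>g\<close> is only Lipschitz: a
  termwise estimate of the increments of \<open>b\<close> loses a logarithm. Since
  \<open>H\<^sub>1 (y (k + 1)) - H\<^sub>1 (y k) = m (H\<^sub>2 (y (k + 1)) - H\<^sub>2 (y k))\<close>, the total change of \<open>H\<^sub>1\<close> is a
  Riemann-Stieltjes sum, and summation by parts moves the difference between two parameters from the
  increments of \<open>H\<^sub>2\<close> to \<open>H\<^sub>2\<close> itself, at the price of the small total variation of \<open>m\<close>
  (\<open>iterates_lipschitz\<close>).

  All this is done for an abstract pair \<open>F, H\<close> in the locale \<open>degenerate_iteration\<close>. The rest shows
  that \<open>F\<close> and \<open>H\<close> qualify, after the linear change of scale that turns the linearisation of \<open>H\<close> into the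
  identity. Since \<open>g\<close> need not have a derivative, all estimates are made for differences of solutions of
  the Volterra equation \<open>x = a cos + b sin - \<epsilon> r\<close>, which for small \<open>\<epsilon>\<close> closes up on \<open>[0, 2\<pi>]\<close>
  without a Gronwall inequality. The error estimate follows, since the limit differs from
  \<open>(eta0 g a, 0)\<close> by \<open>O(\<epsilon>)\<close> and \<open>r\<close> enters the solution with a factor \<open>\<epsilon>\<close>.
\<close>

section \<open>Autonomous differential equations with a Lipschitz right-hand side\<close>

lemma ex_antiderivative_from_zero:
  fixes f :: "real \<Rightarrow> 'a::euclidean_space"
  assumes "continuous_on UNIV f"
  obtains J where "J 0 = 0" "\<And>t. (J has_vector_derivative f t) (at t)"
proof -
  have "\<exists>J. \<forall>t. -\<infinity> < ereal t \<longrightarrow> ereal t < \<infinity> \<longrightarrow> (J has_vector_derivative f t) (at t)"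
    by (rule einterval_antiderivative) (use assms in \<open>auto simp: continuous_on_eq_continuous_at\<close>)
  then obtain J where J: "\<And>t. (J has_vector_derivative f t) (at t)" by auto
  show thesis
    by (rule that[of "\<lambda>t. J t - J 0"]) (auto intro!: derivative_eq_intros J)
qed

text \<open>
  Integration gains the factor \<open>1 / l\<close> against the weight \<open>exp (l * \<bar>t\<bar>)\<close>; this is what makes
  the Picard operator a contraction on the whole line in the weighted supremum norm.
\<close>

lemma exp_weight_bound:
  fixes J :: "real \<Rightarrow> 'a::real_normed_vector"
  assumes J: "J 0 = 0" "\<And>t. (J has_vector_derivative f t) (at t)"
    and l: "l > 0" and f: "\<And>t. norm (f t) \<le> k * exp (l * \<bar>t\<bar>)"
  shows "norm (J t) \<le> k / l * exp (l * \<bar>t\<bar>)"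
proof -
  have one_sided: "norm (I t) \<le> k / l * exp (l * t)"
    if I: "I 0 = 0" "\<And>t. (I has_vector_derivative h t) (at t)"
      and h: "\<And>t. norm (h t) \<le> k * exp (l * \<bar>t\<bar>)" and t: "t \<ge> 0"
    for I h :: "real \<Rightarrow> 'a" and t
  proof (cases "t = 0")
    case True
    have "0 \<le> k * exp (l * \<bar>0\<bar>)" using h[of 0] norm_ge_zero order_trans by blast
    then show ?thesis using True I l by simp
  next
    case False
    then have "t > 0" using t by simp
    have "norm (I t - I 0) \<le> k / l * exp (l * t) - k / l * exp (l * 0)"
    proof (rule differentiable_bound_general[OF \<open>0 < t\<close>, where f' = h and \<phi>' = "\<lambda>s. k * exp (l * s)"])
      show "continuous_on {0..t} I"
        by (meson I(2) continuous_at_imp_continuous_on has_vector_derivative_continuous)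
      show "continuous_on {0..t} (\<lambda>s. k / l * exp (l * s))" by (intro continuous_intros)
      show "((\<lambda>s. k / l * exp (l * s)) has_vector_derivative k * exp (l * s)) (at s)" for s
        unfolding has_real_derivative_iff_has_vector_derivative[symmetric]
        using l by (auto intro!: derivative_eq_intros)
      show "norm (h s) \<le> k * exp (l * s)" if "0 < s" for s
        using h[of s] that by simp
    qed (rule I)
    moreover have "0 \<le> k * exp (l * \<bar>0\<bar>)" using h[of 0] norm_ge_zero order_trans by blast
    ultimately show ?thesis using I l by (simp add: divide_nonneg_pos) (smt (verit) divide_nonneg_pos)
  qed
  show ?thesis
  proof (cases "t \<ge> 0")
    case True
    then show ?thesis using one_sided[OF J f True] by simp
  next
    case False
    have d: "((\<lambda>s. J (- s)) has_vector_derivative - f (- s)) (at s)" for s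
      using vector_diff_chain_at[OF _ J(2), of uminus "- 1" s]
      by (force simp: o_def intro!: derivative_eq_intros)
    have "norm (J (- (- t))) \<le> k / l * exp (l * (- t))"
      by (rule one_sided[where I = "\<lambda>s. J (- s)" and h = "\<lambda>s. - f (- s)"])
         (use False J f[of "- _"] d in auto)
    then show ?thesis using False by simp
  qed
qed

text \<open>
  Picard iteration for \<open>z = z0 + exp (l * \<bar>t\<bar>) u\<close> with \<open>u\<close> bounded and continuous. For \<open>l\<close> larger than
  the Lipschitz constant a single application of the Banach fixed point theorem yields
  the solution for all times, without continuation.
\<close>

lemma lipschitz_ode_global_solution:
  fixes A :: "'a::euclidean_space \<Rightarrow> 'a"
  assumes "K-lipschitz_on UNIV A"
  shows "\<exists>z. z 0 = z0 \<and> (\<forall>t. (z has_vector_derivative A (z t)) (at t))"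
proof -
  have K: "K \<ge> 0" and A: "norm (A x - A y) \<le> K * norm (x - y)" for x y
    using assms by (auto simp: lipschitz_on_def dist_norm)
  have A_cont: "continuous_on UNIV A"
    using assms by (rule lipschitz_on_continuous_on)
  \<comment> \<open>Any weight exceeding \<open>K\<close> would do.\<close>
  define l where "l = K + 1"
  have l: "l > 0" "K / l < 1" "0 \<le> K / l" using K by (auto simp: l_def)
  define Z where "Z u t = z0 + exp (l * \<bar>t\<bar>) *\<^sub>R apply_bcontfun u t" for u :: "real \<Rightarrow>\<^sub>C 'a" and t
  have cont: "continuous_on UNIV (\<lambda>t. A (Z u t))" for u
    unfolding Z_def
    by (intro continuous_on_compose2[OF A_cont] continuous_intros) auto
  have "\<exists>J. J 0 = 0 \<and> (\<forall>t. (J has_vector_derivative A (Z u t)) (at t))" for u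
    by (rule ex_antiderivative_from_zero[OF cont[of u]]) blast
  then obtain J where J: "\<And>u. J u 0 = 0"
      "\<And>u t. (J u has_vector_derivative A (Z u t)) (at t)" by metis
  have bnd: "norm (exp (- l * \<bar>t\<bar>) *\<^sub>R J u t) \<le> (norm (A z0) + K * norm u) / l" for u t
  proof -
    have "norm (A (Z u s)) \<le> (norm (A z0) + K * norm u) * exp (l * \<bar>s\<bar>)" for s
    proof -
      have "norm (A (Z u s)) \<le> norm (A z0) + norm (A (Z u s) - A z0)"
        by (metis add.commute diff_add_cancel norm_triangle_ineq)
      also have "norm (A (Z u s) - A z0) \<le> K * norm (exp (l * \<bar>s\<bar>) *\<^sub>R apply_bcontfun u s)"
        using A[of "Z u s" z0] by (simp add: Z_def)
      also have "\<dots> \<le> K * (exp (l * \<bar>s\<bar>) * norm u)"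
        using norm_bounded[of u s] K by (intro mult_left_mono) auto
      also have "norm (A z0) \<le> norm (A z0) * exp (l * \<bar>s\<bar>)"
        using l by (intro mult_le_cancel_left1[THEN iffD2]) (auto simp: )
      finally show ?thesis by (simp add: algebra_simps)
    qed
    from exp_weight_bound[OF J l(1) this, of t]
    show ?thesis by (simp add: exp_minus field_simps)
  qed
  have J_cont: "continuous_on UNIV (J u)" for u
    by (meson J(2) continuous_at_imp_continuous_on has_vector_derivative_continuous)
  define T where "T u = Bcontfun (\<lambda>t. exp (- l * \<bar>t\<bar>) *\<^sub>R J u t)" for u
  have T: "apply_bcontfun (T u) t = exp (- l * \<bar>t\<bar>) *\<^sub>R J u t" for u t
    unfolding T_def
    by (subst Bcontfun_inverse[OF bcontfun_normI[OF _ bnd]]) (intro continuous_intros J_cont, simp)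
  have "dist (T u) (T v) \<le> K / l * dist u v" for u v
  proof (rule dist_bound)
    fix t
    have *: "norm (A (Z u s) - A (Z v s)) \<le> (K * dist u v) * exp (l * \<bar>s\<bar>)" for s
    proof -
      have "norm (A (Z u s) - A (Z v s)) \<le> K * norm (exp (l * \<bar>s\<bar>) *\<^sub>R (apply_bcontfun u s - apply_bcontfun v s))"
        using A[of "Z u s" "Z v s"] by (simp add: Z_def scaleR_diff_right)
      also have "\<dots> \<le> K * (exp (l * \<bar>s\<bar>) * dist u v)"
        using dist_bounded[of u s v] K by (intro mult_left_mono) (auto simp: dist_norm)
      finally show ?thesis by (simp add: algebra_simps)
    qed
    have "norm (J u t - J v t) \<le> K * dist u v / l * exp (l * \<bar>t\<bar>)"
      by (rule exp_weight_bound[OF _ _ l(1) *]) (auto intro!: derivative_eq_intros J simp: J)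
    then have "exp (- l * \<bar>t\<bar>) * norm (J u t - J v t) \<le> K / l * dist u v"
      by (simp add: exp_minus field_simps)
    then show "dist (apply_bcontfun (T u) t) (apply_bcontfun (T v) t) \<le> K / l * dist u v"
      unfolding T dist_norm scaleR_diff_right[symmetric] norm_scaleR by simp
  qed
  then obtain u where u: "T u = u"
    using banach_fix_type[of "K / l" T] l by auto
  have "Z u t = z0 + J u t" for t
  proof -
    have "apply_bcontfun u t = exp (- l * \<bar>t\<bar>) *\<^sub>R J u t" using T[of u t] u by simp
    then show ?thesis by (simp add: Z_def exp_minus)
  qed
  then show ?thesis
    using J by (intro exI[of _ "\<lambda>t. z0 + J u t"]) (auto intro!: derivative_eq_intros)
qed

text \<open>
  The squared distance of two solutions, damped by \<open>exp (- 2 * K * t)\<close>, does not increase. Negative times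
  are reduced to positive ones by reversing time.
\<close>

lemma lipschitz_ode_unique:
  fixes A :: "'a::euclidean_space \<Rightarrow> 'a"
  assumes A: "K-lipschitz_on UNIV A"
    and z: "\<And>t. (z has_vector_derivative A (z t)) (at t)"
    and w: "\<And>t. (w has_vector_derivative A (w t)) (at t)"
    and "z 0 = w 0"
  shows "z t = w t"
proof -
  have forward: "z t = w t"
    if B: "K-lipschitz_on UNIV B" and z: "\<And>t. (z has_vector_derivative B (z t)) (at t)"
      and w: "\<And>t. (w has_vector_derivative B (w t)) (at t)"
      and 0: "z 0 = w 0" and t: "t \<ge> 0" for z w t and B :: "'a \<Rightarrow> 'a"
  proof -
    define q where "q s = (z s - w s) \<bullet> (z s - w s)" for s
    define N where "N s = exp (- 2 * K * s) * q s" for s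
    have "N t \<le> N 0"
    proof (rule DERIV_nonpos_imp_nonincreasing[OF t])
      fix s
      have "(q has_real_derivative 2 * ((z s - w s) \<bullet> (B (z s) - B (w s)))) (at s)"
        using bounded_bilinear.has_vector_derivative[OF bounded_bilinear_inner
            has_vector_derivative_diff[OF z w] has_vector_derivative_diff[OF z w], of s]
        unfolding has_real_derivative_iff_has_vector_derivative q_def
        by (simp add: inner_commute)
      then have "(N has_real_derivative exp (- 2 * K * s) *
          (2 * ((z s - w s) \<bullet> (B (z s) - B (w s))) - 2 * K * q s)) (at s)"
        unfolding N_def by (auto intro!: derivative_eq_intros simp: algebra_simps)
      moreover have "(z s - w s) \<bullet> (B (z s) - B (w s)) \<le> K * q s"
      proof -
        have "(z s - w s) \<bullet> (B (z s) - B (w s)) \<le> norm (z s - w s) * norm (B (z s) - B (w s))"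
          by (rule norm_cauchy_schwarz)
        also have "\<dots> \<le> norm (z s - w s) * (K * norm (z s - w s))"
          using B by (intro mult_left_mono) (auto simp: lipschitz_on_def dist_norm)
        finally show ?thesis by (simp add: q_def dot_square_norm power2_eq_square algebra_simps)
      qed
      ultimately show "\<exists>y. (N has_real_derivative y) (at s) \<and> y \<le> 0"
        by (intro exI conjI) (auto simp: mult_le_0_iff)
    qed
    then have "(z t - w t) \<bullet> (z t - w t) \<le> 0"
      using 0 by (simp add: N_def q_def mult_le_0_iff)
    then show ?thesis by (metis eq_iff_diff_eq_0 inner_ge_zero inner_eq_zero_iff order_antisym)
  qed
  show ?thesis
  proof (cases "t \<ge> 0")
    case True
    then show ?thesis using forward[OF A z w] assms by blast
  next
    case False
    have d: "((\<lambda>s. y (- s)) has_vector_derivative - A (y (- s))) (at s)"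
      if "\<And>t. (y has_vector_derivative A (y t)) (at t)" for y s
      using vector_diff_chain_at[OF _ that, of uminus "- 1" s]
      by (force simp: o_def intro!: derivative_eq_intros)
    have "z (- (- t)) = w (- (- t))"
      by (rule forward[of "\<lambda>x. - A x" "\<lambda>s. z (- s)" "\<lambda>s. w (- s)"])
         (use False assms d[OF z] d[OF w] in \<open>auto simp: lipschitz_on_def dist_minus\<close>)
    then show ?thesis by simp
  qed
qed

section \<open>An iteration with a neutral direction\<close>

lemma norm_pair_le: "norm z \<le> \<bar>fst z\<bar> + \<bar>snd z\<bar>" for z :: "real \<times> real"
  by (metis norm_Pair_le prod.collapse real_norm_def)

lemma abs_fst_le_norm: "\<bar>fst z\<bar> \<le> norm z" and abs_snd_le_norm: "\<bar>snd z\<bar> \<le> norm z"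
  for z :: "real \<times> real"
  using norm_fst_le[of "fst z" "snd z"] norm_snd_le[of "snd z" "fst z"] by auto

lemma geometric_sum_le: "(\<Sum>k<n. (1/2::real) ^ k) \<le> 2"
proof -
  have "(\<Sum>k<n. (1/2::real) ^ k) \<le> (\<Sum>k. (1/2) ^ k)"
    by (rule sum_le_suminf) (auto intro: summable_geometric)
  then show ?thesis by (simp add: suminf_geometric)
qed

lemma abel_summation:
  fixes c d :: "nat \<Rightarrow> real"
  shows "(\<Sum>k<N. c k * (d (Suc k) - d k))
    = c N * d N - c 0 * d 0 - (\<Sum>k<N. (c (Suc k) - c k) * d (Suc k))"
  by (induction N) (auto simp: algebra_simps)

text \<open>
  The analytic content of the iteration. The parameters \<open>p\<close> range over \<open>P\<close>, the unknowns over \<open>U\<close>, and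
  \<open>w\<close> is a small constant, \<open>L\<close> a large one. The assumption \<open>E_lip\<close> says that \<open>E = F - H\<close> hardly depends
  on the first coordinate; on the second one it depends as strongly as \<open>H\<close> does, which is the
  degeneracy. It is compensated by \<open>snd_F\<close> and \<open>m_small\<close>: all of \<open>F\<close> is controlled by its first component.
  In the application the coordinates have been exchanged and rescaled, so that \<open>fst \<circ> F\<close> is a multiple
  of \<open>F\<^sub>2\<close>.
\<close>

locale degenerate_iteration =
  fixes P :: "'p::metric_space set" and U :: "(real \<times> real) set"
    and ctr :: "'p \<Rightarrow> real \<times> real"
    and F H :: "'p \<Rightarrow> real \<times> real \<Rightarrow> real \<times> real"
    and m :: "'p \<Rightarrow> real \<times> real \<Rightarrow> real"
    and L w \<sigma> \<rho> :: real
  assumes ball_subset: "p \<in> P \<Longrightarrow> cball (ctr p) \<rho> \<subseteq> U"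
    and H_near_id: "\<lbrakk>p \<in> P; p' \<in> P; y \<in> U; y' \<in> U\<rbrakk> \<Longrightarrow>
      norm ((H p y - H p' y') - (y - y')) \<le> L * dist p p' + w * norm (y - y')"
    and E_lip: "\<lbrakk>p \<in> P; p' \<in> P; y \<in> U; y' \<in> U\<rbrakk> \<Longrightarrow>
      norm ((F p y - H p y) - (F p' y' - H p' y'))
        \<le> L * dist p p' + w * \<bar>fst (y - y')\<bar> + L * \<bar>snd (y - y')\<bar>"
    and snd_F: "\<lbrakk>p \<in> P; y \<in> U\<rbrakk> \<Longrightarrow> snd (F p y) = m p y * fst (F p y)"
    and m_small: "\<lbrakk>p \<in> P; y \<in> U\<rbrakk> \<Longrightarrow> \<bar>m p y\<bar> \<le> w"
    and m_lip: "\<lbrakk>p \<in> P; p' \<in> P; y \<in> U; y' \<in> U\<rbrakk> \<Longrightarrow>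
      \<bar>m p y - m p' y'\<bar> \<le> L * dist p p' + L * norm (y - y')"
    and ctr_lip: "\<lbrakk>p \<in> P; p' \<in> P\<rbrakk> \<Longrightarrow> norm (ctr p - ctr p') \<le> L * dist p p'"
    and F_ctr: "p \<in> P \<Longrightarrow> norm (F p (ctr p)) \<le> \<sigma>"
    and L_ge_1: "1 \<le> L" and w_nonneg: "0 \<le> w" and w_small: "150 * L\<^sup>2 * w \<le> 1"
    and \<sigma>_le_w: "\<sigma> \<le> w" and \<sigma>_le_\<rho>: "8 * \<sigma> \<le> \<rho>" and \<rho>_pos: "0 < \<rho>"
begin

lemma Lw_small: "150 * (L * w) \<le> 1" and w_le: "150 * w \<le> 1"
proof -
  have "L * w \<le> L\<^sup>2 * w"
    using L_ge_1 w_nonneg by (intro mult_right_mono) (auto simp: power2_eq_square)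
  moreover have "1 * w \<le> L * w" using L_ge_1 w_nonneg by (intro mult_right_mono)
  ultimately show "150 * (L * w) \<le> 1" "150 * w \<le> 1" using w_small by auto
qed

lemma L_nonneg: "0 \<le> L"
  using L_ge_1 by simp

lemma F_le_fst: "\<lbrakk>p \<in> P; y \<in> U\<rbrakk> \<Longrightarrow> norm (F p y) \<le> (1 + w) * \<bar>fst (F p y)\<bar>"
  using norm_pair_le[of "F p y"] mult_right_mono[OF m_small, of p y "\<bar>fst (F p y)\<bar>"]
  by (simp add: snd_F abs_mult algebra_simps)

lemma F_lip:
  assumes "p \<in> P" "y \<in> U" "y' \<in> U"
  shows "norm (F p y - F p y') \<le> 4 * L * norm (y - y')"
proof -
  have E: "norm ((F p y - H p y) - (F p y' - H p y')) \<le> w * norm (y - y') + L * norm (y - y')"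
    using E_lip[of p p y y'] assms
      mult_left_mono[OF abs_fst_le_norm w_nonneg, of "y - y'"]
      mult_left_mono[OF abs_snd_le_norm L_nonneg, of "y - y'"]
    by simp
  have H: "norm ((H p y - H p y') - (y - y')) \<le> w * norm (y - y')"
    using H_near_id[of p p y y'] assms by simp
  have "F p y - F p y' = ((F p y - H p y) - (F p y' - H p y'))
      + ((H p y - H p y') - (y - y')) + (y - y')" by simp
  then have "norm (F p y - F p y') \<le> (w * norm (y - y') + L * norm (y - y'))
      + w * norm (y - y') + norm (y - y')"
    using E H by (metis (no_types, lifting) add_mono norm_triangle_mono order_refl)
  moreover have "1 * norm (y - y') \<le> L * norm (y - y')"
    using L_ge_1 by (intro mult_right_mono) auto
  moreover have "w * norm (y - y') \<le> L * norm (y - y')"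
    using L_ge_1 w_le by (intro mult_right_mono) auto
  ultimately show ?thesis by simp
qed

lemma H_inj:
  assumes "p \<in> P" "y \<in> U" "y' \<in> U" "H p y = H p y'"
  shows "y = y'"
proof -
  have "norm (y - y') \<le> w * norm (y - y')"
    using H_near_id[of p p y y'] assms by (simp add: norm_minus_commute)
  moreover have "w * norm (y - y') \<le> norm (y - y') / 150"
    using mult_right_mono[OF w_le, of "norm (y - y')"] by simp
  moreover have "0 \<le> norm (y - y')" by simp
  ultimately have "norm (y - y') = 0" by linarith
  then show ?thesis by simp
qed

text \<open>
  Since \<open>H\<close> is close to the identity, a step is almost \<open>- F p y\<close>, whose second component is small
  compared with the first. By the equation for the step, \<open>F\<close> at the new point equals the increment of
  \<open>E\<close>, which sees the first component of the step with the factor \<open>w\<close> and the second with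
  the factor \<open>L\<close>; both contributions are of order \<open>L * w\<close>.
\<close>

lemma step_estimates:
  assumes p: "p \<in> P" and y: "y \<in> U" "y' \<in> U" and step: "H p y' = H p y - F p y"
  shows "norm (y' - y) \<le> 2 * \<bar>fst (F p y)\<bar>" (is "_ \<le> 2 * ?\<tau>")
    and "\<bar>fst (F p y')\<bar> \<le> \<bar>fst (F p y)\<bar> / 2"
proof -
  define d where "d = y' - y"
  have near: "norm (d + F p y) \<le> w * norm d"
    using H_near_id[of p p y' y] p y norm_minus_cancel[of "d + F p y"] by (simp add: step d_def algebra_simps)
  have "norm d \<le> norm (d + F p y) + norm (F p y)"
    by (metis add_diff_cancel_right' norm_triangle_ineq4)
  also have "\<dots> \<le> w * norm d + (1 + w) * ?\<tau>" using near F_le_fst[OF p y(1)] by simp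
  finally have "norm d \<le> w * norm d + (1 + w) * ?\<tau>" .
  moreover have "w * norm d \<le> norm d / 150" using mult_right_mono[OF w_le, of "norm d"] by simp
  moreover have "w * ?\<tau> \<le> ?\<tau> / 150" using mult_right_mono[OF w_le, of ?\<tau>] by simp
  ultimately show d: "norm (y' - y) \<le> 2 * ?\<tau>"
    unfolding d_def[symmetric] by (simp add: algebra_simps)
  have "\<bar>snd d + snd (F p y)\<bar> \<le> w * norm d"
    using near abs_snd_le_norm[of "d + F p y"] by simp
  moreover have "w * norm d \<le> w * (2 * ?\<tau>)"
    using d w_nonneg unfolding d_def by (rule mult_left_mono)
  moreover have "\<bar>snd (F p y)\<bar> \<le> w * ?\<tau>"
    using mult_right_mono[OF m_small[OF p y(1)], of ?\<tau>] by (simp add: snd_F p y abs_mult)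
  ultimately have snd_d: "\<bar>snd d\<bar> \<le> 3 * w * ?\<tau>" by linarith
  have "(F p y' - H p y') - (F p y - H p y) = F p y'" by (simp add: step)
  moreover have "norm ((F p y' - H p y') - (F p y - H p y)) \<le> w * \<bar>fst d\<bar> + L * \<bar>snd d\<bar>"
    using E_lip[of p p y' y] p y by (simp add: d_def)
  ultimately have "norm (F p y') \<le> w * \<bar>fst d\<bar> + L * \<bar>snd d\<bar>" by metis
  also have "\<dots> \<le> w * (2 * ?\<tau>) + L * (3 * w * ?\<tau>)"
    using w_nonneg L_ge_1 abs_fst_le_norm[of d] d snd_d unfolding d_def
    by (intro add_mono mult_left_mono) auto
  also have "\<dots> \<le> ?\<tau> / 2"
    using mult_right_mono[OF w_le, of ?\<tau>] mult_right_mono[OF Lw_small, of ?\<tau>]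
    by (simp add: algebra_simps)
  finally show "\<bar>fst (F p y')\<bar> \<le> ?\<tau> / 2" using abs_fst_le_norm[of "F p y'"] by linarith
qed

text \<open>
  A solution of \<open>H p y' = H p y - F p y\<close> is a fixed point of \<open>z \<mapsto> z - H p z + H p y - F p y\<close>, a
  contraction with constant \<open>w\<close>.
\<close>

lemma step_exists:
  assumes p: "p \<in> P" and sub: "cball y (2 * \<bar>fst (F p y)\<bar>) \<subseteq> U"
  shows "\<exists>y'\<in>cball y (2 * \<bar>fst (F p y)\<bar>). H p y' = H p y - F p y"
proof -
  define s where "s = 2 * \<bar>fst (F p y)\<bar>"
  have s: "0 \<le> s" and sub: "cball y s \<subseteq> U" using sub by (auto simp: s_def)
  then have y: "y \<in> U" by force
  define T where "T z = z - H p z + H p y - F p y" for z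
  have "\<exists>!z\<in>cball y s. T z = z"
  proof (rule Banach_fix)
    show "0 \<le> w" "w < 1" using w_nonneg w_le by auto
    show "T ` cball y s \<subseteq> cball y s"
    proof (intro image_subsetI)
      fix z assume z: "z \<in> cball y s"
      have "norm (T z - y) \<le> norm ((H p z - H p y) - (z - y)) + norm (F p y)"
        using norm_triangle_ineq[of "- ((H p z - H p y) - (z - y))" "- F p y"]
        unfolding T_def by (simp add: norm_minus_commute algebra_simps)
      also have "\<dots> \<le> w * s + (1 + w) * \<bar>fst (F p y)\<bar>"
      proof (rule add_mono[OF _ F_le_fst[OF p y]])
        have "norm ((H p z - H p y) - (z - y)) \<le> w * norm (z - y)"
          using H_near_id[of p p z y] p y z sub by (simp add: subsetD)
        also have "\<dots> \<le> w * s"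
          using z w_nonneg by (intro mult_left_mono) (auto simp: dist_norm norm_minus_commute)
        finally show "norm ((H p z - H p y) - (z - y)) \<le> w * s" .
      qed
      also have "\<dots> \<le> s"
        using mult_right_mono[OF w_le s] s by (simp add: s_def algebra_simps)
      finally show "T z \<in> cball y s" by (simp add: dist_norm norm_minus_commute)
    qed
    show "dist (T z) (T z') \<le> w * dist z z'" if "z \<in> cball y s" "z' \<in> cball y s" for z z'
    proof -
      have "T z - T z' = - ((H p z - H p z') - (z - z'))" by (simp add: T_def)
      then have "norm (T z - T z') = norm ((H p z - H p z') - (z - z'))" by (metis norm_minus_cancel)
      then show ?thesis
        using H_near_id[OF p p subsetD[OF sub that(1)] subsetD[OF sub that(2)]] by (simp add: dist_norm)
    qed
  qed (use s in \<open>auto simp: complete_eq_closed\<close>)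
  then obtain z where "z \<in> cball y s" "T z = z" by blast
  then show ?thesis unfolding T_def s_def by (intro bexI[of _ z]) (auto simp: algebra_simps)
qed

definition iterates :: "'p \<Rightarrow> (nat \<Rightarrow> real \<times> real) \<Rightarrow> bool" where
  "iterates p Y \<longleftrightarrow>
    (\<forall>k. Y k \<in> cball (ctr p) \<rho>) \<and> (\<forall>k. H p (Y (Suc k)) = H p (Y k) - F p (Y k))"

lemma iterates_in_U: "\<lbrakk>p \<in> P; iterates p Y\<rbrakk> \<Longrightarrow> Y k \<in> U"
  using ball_subset unfolding iterates_def by blast

lemma iterates_geometric:
  assumes "p \<in> P" "iterates p Y"
  shows "\<bar>fst (F p (Y k))\<bar> \<le> \<bar>fst (F p (Y 0))\<bar> * (1/2) ^ k"
    and "norm (Y (Suc k) - Y k) \<le> 2 * \<bar>fst (F p (Y 0))\<bar> * (1/2) ^ k"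
proof -
  have st: "norm (Y (Suc k) - Y k) \<le> 2 * \<bar>fst (F p (Y k))\<bar>"
      "\<bar>fst (F p (Y (Suc k)))\<bar> \<le> \<bar>fst (F p (Y k))\<bar> / 2" for k
    using step_estimates[of p "Y k" "Y (Suc k)"] assms iterates_in_U by (auto simp: iterates_def)
  show geo: "\<bar>fst (F p (Y k))\<bar> \<le> \<bar>fst (F p (Y 0))\<bar> * (1/2) ^ k"
  proof (induction k)
    case (Suc k)
    then show ?case using st(2)[of k] by simp
  qed simp
  show "norm (Y (Suc k) - Y k) \<le> 2 * \<bar>fst (F p (Y 0))\<bar> * (1/2) ^ k"
    using st(1)[of k] geo by linarith
qed

lemma iterates_converge:
  assumes p: "p \<in> P" and Y: "iterates p Y"
  shows "\<exists>z\<in>U. Y \<longlonglongrightarrow> z \<and> F p z = 0"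
proof -
  have "summable (\<lambda>k. Y (Suc k) - Y k)"
    by (rule summable_comparison_test'[where g = "\<lambda>k. 2 * \<bar>fst (F p (Y 0))\<bar> * (1/2) ^ k" and N = 0])
       (use iterates_geometric(2)[OF p Y] in \<open>auto intro: summable_mult summable_geometric\<close>)
  then have "(\<lambda>n. Y n - Y 0) \<longlonglongrightarrow> (\<Sum>k. Y (Suc k) - Y k)"
    unfolding summable_sums_iff sums_def sum_lessThan_telescope .
  then obtain z where z: "Y \<longlonglongrightarrow> z"
    using tendsto_add[OF _ tendsto_const[of "Y 0"], of "\<lambda>n. Y n - Y 0"] by fastforce
  have "z \<in> cball (ctr p) \<rho>"
    using closed_sequentially[OF closed_cball _ z] Y by (auto simp: iterates_def)
  then have zU: "z \<in> U" using ball_subset p by blast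
  have "(\<lambda>k. F p (Y k) - F p z) \<longlonglongrightarrow> 0"
  proof (rule Lim_null_comparison)
    show "\<forall>\<^sub>F k in sequentially. norm (F p (Y k) - F p z) \<le> 4 * L * norm (Y k - z)"
      using F_lip p zU iterates_in_U[OF p Y] by simp
    show "(\<lambda>k. 4 * L * norm (Y k - z)) \<longlonglongrightarrow> 0"
      using z by (intro tendsto_mult_right_zero tendsto_norm_zero) (simp add: LIM_zero)
  qed
  then have "(\<lambda>k. F p (Y k)) \<longlonglongrightarrow> F p z" by (rule LIM_zero_cancel)
  moreover have "(\<lambda>k. F p (Y k)) \<longlonglongrightarrow> 0"
  proof (rule Lim_null_comparison)
    have "norm (F p (Y k)) \<le> (1 + w) * \<bar>fst (F p (Y 0))\<bar> * (1/2) ^ k" for k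
      using F_le_fst[OF p iterates_in_U[OF p Y], of k] w_nonneg
        mult_left_mono[OF iterates_geometric(1)[OF p Y, of k], of "1 + w"] by linarith
    then show "\<forall>\<^sub>F k in sequentially. norm (F p (Y k)) \<le> (1 + w) * \<bar>fst (F p (Y 0))\<bar> * (1/2) ^ k"
      by simp
    show "(\<lambda>k. (1 + w) * \<bar>fst (F p (Y 0))\<bar> * (1/2) ^ k) \<longlonglongrightarrow> 0"
      by (intro tendsto_mult_right_zero LIMSEQ_power_zero) simp
  qed
  ultimately have "F p z = 0" by (rule LIMSEQ_unique)
  then show ?thesis using z zU by blast
qed

text \<open>
  The steps sum to at most four times the initial defect \<open>\<bar>fst (F p y0)\<bar>\<close>, which is at most
  \<open>\<sigma> + 4 * L * norm (y0 - ctr p)\<close>. The radius \<open>\<rho> / (34 * L)\<close> is such that this, together with the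
  initial distance from the centre, stays below \<open>\<rho>\<close>.
\<close>

lemma iterates_exist:
  assumes p: "p \<in> P" and y0: "y0 \<in> cball (ctr p) (\<rho> / (34 * L))"
  shows "\<exists>!Y. Y 0 = y0 \<and> iterates p Y"
proof (rule ex_ex1I)
  define \<tau> where "\<tau> y = \<bar>fst (F p y)\<bar>" for y
  have d: "norm (y0 - ctr p) \<le> \<rho> / (34 * L)"
    using y0 by (simp add: dist_norm norm_minus_commute)
  have Ld: "L * (\<rho> / (34 * L)) = \<rho> / 34" using L_ge_1 by simp
  have d': "\<rho> / (34 * L) \<le> \<rho> / 34"
    using L_ge_1 \<rho>_pos by (intro divide_left_mono) auto
  have "norm (y0 - ctr p) \<le> \<rho>" using d d' \<rho>_pos by linarith
  then have "ctr p \<in> cball (ctr p) \<rho>" "y0 \<in> cball (ctr p) \<rho>"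
    using \<rho>_pos by (auto simp: dist_norm norm_minus_commute)
  then have "ctr p \<in> U" "y0 \<in> U" using ball_subset[OF p] by blast+
  then have "norm (F p y0 - F p (ctr p)) \<le> 4 * (L * (\<rho> / (34 * L)))"
    using F_lip[OF p, of y0 "ctr p"] mult_left_mono[OF d, of "4 * L"] L_ge_1 by (simp add: mult.assoc)
  then have "norm (F p y0) \<le> 4 * \<rho> / 34 + \<sigma>"
    using F_ctr[OF p] norm_triangle_ineq2[of "F p y0" "F p (ctr p)"] Ld by linarith
  then have \<tau>0: "norm (y0 - ctr p) + 4 * \<tau> y0 \<le> \<rho>"
    using abs_fst_le_norm[of "F p y0"] \<sigma>_le_\<rho> d d' unfolding \<tau>_def by linarith
  have \<tau>_nonneg: "0 \<le> \<tau> y" for y by (simp add: \<tau>_def)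
  \<comment> \<open>The factor \<open>1 - (1/2) ^ n\<close> leaves room for the remaining steps inside the ball.\<close>
  define Q where "Q n y \<longleftrightarrow> norm (y - y0) \<le> 4 * \<tau> y0 * (1 - (1/2) ^ n) \<and> \<tau> y \<le> \<tau> y0 * (1/2) ^ n"
    for n :: nat and y
  have Q_ball: "y \<in> cball (ctr p) \<rho>" "cball y (2 * \<tau> y) \<subseteq> cball (ctr p) \<rho>" if "Q n y" for n y
  proof -
    have "norm (y - ctr p) \<le> norm (y - y0) + norm (y0 - ctr p)"
      using norm_triangle_ineq[of "y - y0" "y0 - ctr p"] by simp
    moreover have "0 \<le> \<tau> y0 * (1/2) ^ n" using \<tau>_nonneg by simp
    ultimately have *: "norm (y - ctr p) + 2 * \<tau> y \<le> \<rho>"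
      using that \<tau>0 by (auto simp: Q_def algebra_simps)
    show "cball y (2 * \<tau> y) \<subseteq> cball (ctr p) \<rho>"
      using * by (auto simp: cball_subset_cball_iff dist_norm)
    then show "y \<in> cball (ctr p) \<rho>" using subsetD[of "cball y (2 * \<tau> y)" _ y] \<tau>_nonneg[of y] by (simp del: mem_cball)
  qed
  have "\<exists>Y. \<forall>n. Q n (Y n) \<and> H p (Y (Suc n)) = H p (Y n) - F p (Y n)"
  proof (rule dependent_nat_choice)
    show "\<exists>y. Q 0 y" by (rule exI[of _ y0]) (simp add: Q_def)
  next
    fix y n assume Q: "Q n y"
    have "cball y (2 * \<bar>fst (F p y)\<bar>) \<subseteq> U"
      using Q_ball[OF Q] ball_subset[OF p] unfolding \<tau>_def by blast
    then obtain y' where y': "y' \<in> cball y (2 * \<tau> y)" "H p y' = H p y - F p y" "y' \<in> U"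
      using step_exists[OF p] unfolding \<tau>_def by blast
    have yU: "y \<in> U" using Q_ball[OF Q] ball_subset[OF p] by blast
    have "norm (y' - y0) \<le> norm (y' - y) + norm (y - y0)"
      using norm_triangle_ineq[of "y' - y" "y - y0"] by simp
    then have "Q (Suc n) y'"
      using step_estimates[OF p yU y'(3,2)] Q by (auto simp: Q_def \<tau>_def algebra_simps)
    then show "\<exists>y'. Q (Suc n) y' \<and> H p y' = H p y - F p y" using y' by blast
  qed
  then obtain Y where Y: "\<And>n. Q n (Y n)" "\<And>n. H p (Y (Suc n)) = H p (Y n) - F p (Y n)" by blast
  have "Y 0 = y0" using Y(1)[of 0] by (simp add: Q_def)
  then show "\<exists>Y. Y 0 = y0 \<and> iterates p Y"
    using Y Q_ball(1) unfolding iterates_def by blast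
next
  fix Y Z assume Y: "Y 0 = y0 \<and> iterates p Y" and Z: "Z 0 = y0 \<and> iterates p Z"
  have "Y k = Z k" for k
  proof (induction k)
    case (Suc k)
    then have "H p (Y (Suc k)) = H p (Z (Suc k))" using Y Z by (simp add: iterates_def)
    then show ?case using H_inj[OF p] iterates_in_U[OF p] Y Z by blast
  qed (use Y Z in simp)
  then show "Y = Z" by blast
qed

text \<open>
  Let \<open>S\<close> and \<open>B\<close> be the largest differences of the first and of the second coordinates of the two sequences
  up to step \<open>n\<close>. The first coordinate is renewed in every step and forgets its past, hence
  \<open>S = O(D + B)\<close> with \<open>D = dist p p'\<close>. The second coordinate accumulates the increments
  \<open>m * (increment of fst \<circ> H)\<close>. Their difference splits into a part with the difference of the
  factors \<open>m\<close>, multiplied by increments that sum to \<open>O(w)\<close>, and a part with the difference of the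
  increments, which summation by parts bounds by the size and the total variation of \<open>m\<close>, again \<open>O(w)\<close>.
  Thus \<open>B = O(D) + O(w) * (S + B)\<close>, and the last term can be absorbed.
\<close>

lemma iterates_lipschitz:
  assumes p: "p \<in> P" "p' \<in> P" and Y: "iterates p Y" "iterates p' Y'"
    and start: "Y 0 = ctr p" "Y' 0 = ctr p'"
  shows "norm (Y n - Y' n) \<le> 129 * L ^ 3 * dist p p'"
proof -
  define D where "D = dist p p'"
  have D: "0 \<le> D" by (simp add: D_def)
  define h where "h k = H p (Y k)" for k
  define h' where "h' k = H p' (Y' k)" for k
  define S where "S = Max ((\<lambda>k. \<bar>fst (Y k - Y' k)\<bar>) ` {..n})"
  define B where "B = Max ((\<lambda>k. \<bar>snd (Y k - Y' k)\<bar>) ` {..n})"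
  have S: "\<bar>fst (Y k - Y' k)\<bar> \<le> S" if "k \<le> n" for k unfolding S_def using that by (intro Max_ge) auto
  have B: "\<bar>snd (Y k - Y' k)\<bar> \<le> B" if "k \<le> n" for k unfolding B_def using that by (intro Max_ge) auto
  have SB: "norm (Y k - Y' k) \<le> S + B" if "k \<le> n" for k
    using S[OF that] B[OF that] norm_pair_le[of "Y k - Y' k"] by linarith
  have S0: "0 \<le> S" and B0: "0 \<le> B" using S[of 0] B[of 0] by auto
  have U: "Y k \<in> U" "Y' k \<in> U" for k using iterates_in_U p Y by auto
  note L0 = L_nonneg
  have h_near: "norm ((h k - h' k) - (Y k - Y' k)) \<le> L * D + w * (S + B)" if "k \<le> n" for k
    using H_near_id[OF p U(1)[of k] U(2)[of k]] mult_left_mono[OF SB[OF that] w_nonneg]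
    unfolding h_def h'_def D_def by linarith
  have h_Suc: "h (Suc k) = h k - F p (Y k)" "h' (Suc k) = h' k - F p' (Y' k)" for k
    using Y by (auto simp: iterates_def h_def h'_def)
  have \<tau>: "\<bar>fst (F p (Y k))\<bar> \<le> w * (1/2) ^ k" "\<bar>fst (F p' (Y' k))\<bar> \<le> w * (1/2) ^ k" for k
    using iterates_geometric(1)[OF p(1) Y(1), of k] iterates_geometric(1)[OF p(2) Y(2), of k]
      F_ctr[OF p(1)] F_ctr[OF p(2)] abs_fst_le_norm[of "F p (ctr p)"] abs_fst_le_norm[of "F p' (ctr p')"]
      \<sigma>_le_w start mult_right_mono[of _ w "(1/2::real) ^ k"]
    by (smt (verit) zero_le_power half_gt_zero_iff)+
  have S_le: "S \<le> 4 * L * D + 4 * L * B"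
  proof -
    have "S \<in> (\<lambda>k. \<bar>fst (Y k - Y' k)\<bar>) ` {..n}" unfolding S_def by (intro Max_in) auto
    then obtain k where k: "k \<le> n" "S = \<bar>fst (Y k - Y' k)\<bar>" by auto
    show ?thesis
    proof (cases k)
      case 0
      then have "S \<le> L * D"
        using k ctr_lip[OF p] abs_fst_le_norm[of "ctr p - ctr p'"] start by (simp add: D_def)
      moreover have "0 \<le> L * B" "0 \<le> L * D" using L0 B0 D by auto
      ultimately show ?thesis by linarith
    next
      case (Suc j)
      have j: "j \<le> n" using k Suc by simp
      have "h k - h' k = (F p' (Y' j) - H p' (Y' j)) - (F p (Y j) - H p (Y j))"
        by (simp add: Suc h_Suc) (simp add: h_def h'_def)
      then have "norm (h k - h' k) \<le> L * D + w * \<bar>fst (Y j - Y' j)\<bar> + L * \<bar>snd (Y j - Y' j)\<bar>"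
        using E_lip[OF p U(1)[of j] U(2)[of j]] by (simp add: D_def norm_minus_commute)
      also have "\<dots> \<le> L * D + w * S + L * B"
        using S[OF j] B[OF j] w_nonneg L0 by (intro add_mono mult_left_mono) auto
      finally have "norm (h k - h' k) \<le> L * D + w * S + L * B" .
      then have "S \<le> 2 * (L * D) + w * (S + B) + w * S + L * B"
        using h_near[OF k(1)] k(2) abs_fst_le_norm[of "(h k - h' k) - (Y k - Y' k)"]
          abs_fst_le_norm[of "h k - h' k"] by simp
      moreover have "w * S \<le> S / 150" using mult_right_mono[OF w_le S0] by simp
      moreover have "w * B \<le> L * B" using w_le L_ge_1 B0 by (intro mult_right_mono) auto
      moreover have "0 \<le> L * B" "0 \<le> L * D" using L0 B0 D by auto
      ultimately show ?thesis by (simp add: algebra_simps)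
    qed
  qed
  have B_le: "B \<le> 25 * L\<^sup>2 * D"
  proof -
    have "B \<in> (\<lambda>k. \<bar>snd (Y k - Y' k)\<bar>) ` {..n}" unfolding B_def by (intro Max_in) auto
    then obtain N where N: "N \<le> n" "B = \<bar>snd (Y N - Y' N)\<bar>" by auto
    define c where "c k = m p (Y k)" for k
    define c' where "c' k = m p' (Y' k)" for k
    define \<delta> where "\<delta> k = fst (h k) - fst (h' k)" for k
    define X where "X = L * D + 2 * (S + B)"
    have X0: "0 \<le> X" using L0 D S0 B0 by (simp add: X_def)
    have snd_h: "snd (h (Suc k)) - snd (h k) = c k * (fst (h (Suc k)) - fst (h k))"
      "snd (h' (Suc k)) - snd (h' k) = c' k * (fst (h' (Suc k)) - fst (h' k))" for k
      using snd_F p U by (simp_all add: h_Suc c_def c'_def)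
    have \<delta>: "\<bar>\<delta> k\<bar> \<le> X" if "k \<le> n" for k
    proof -
      have "\<bar>\<delta> k\<bar> \<le> norm (h k - h' k)" using abs_fst_le_norm[of "h k - h' k"] by (simp add: \<delta>_def)
      also have "\<dots> \<le> L * D + w * (S + B) + (S + B)"
        using h_near[OF that] SB[OF that] norm_triangle_ineq[of "(h k - h' k) - (Y k - Y' k)" "Y k - Y' k"]
        by simp
      also have "\<dots> \<le> X"
        using mult_right_mono[OF w_le, of "S + B"] S0 B0 by (simp add: X_def)
      finally show ?thesis .
    qed
    have c_diff: "\<bar>c k - c' k\<bar> \<le> L * (D + (S + B))" if "k \<le> n" for k
      using m_lip[OF p U(1)[of k] U(2)[of k]] mult_left_mono[OF SB[OF that] L0]
      by (simp add: c_def c'_def D_def algebra_simps)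
    have c'_var: "\<bar>c' (Suc k) - c' k\<bar> \<le> L * (2 * (w * (1/2) ^ k))" for k
    proof -
      have "norm (Y' (Suc k) - Y' k) \<le> 2 * (w * (1/2) ^ k)"
        using step_estimates(1)[OF p(2) U(2)[of k] U(2)[of "Suc k"]] Y(2) \<tau>(2)[of k]
        by (auto simp: iterates_def)
      then show ?thesis
        using m_lip[OF p(2) p(2) U(2)[of "Suc k"] U(2)[of k]]
          mult_left_mono[of "norm (Y' (Suc k) - Y' k)" _ L] L0
        unfolding c'_def by fastforce
    qed
    \<comment> \<open>The total change of \<open>snd \<circ> h\<close> as a Riemann-Stieltjes sum, for both parameters at once.\<close>
    have tele: "(snd (h N) - snd (h' N)) - (snd (h 0) - snd (h' 0))
        = (\<Sum>k<N. (c k - c' k) * (fst (h (Suc k)) - fst (h k))) + (\<Sum>k<N. c' k * (\<delta> (Suc k) - \<delta> k))"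
    proof -
      have "(snd (h N) - snd (h' N)) - (snd (h 0) - snd (h' 0))
          = (\<Sum>k<N. (snd (h (Suc k)) - snd (h k)) - (snd (h' (Suc k)) - snd (h' k)))"
        unfolding sum_lessThan_telescope[of "\<lambda>k. snd (h k) - snd (h' k)", symmetric]
        by (intro sum.cong) auto
      also have "\<dots> = (\<Sum>k<N. (c k - c' k) * (fst (h (Suc k)) - fst (h k)) + c' k * (\<delta> (Suc k) - \<delta> k))"
        unfolding snd_h by (intro sum.cong) (auto simp: \<delta>_def algebra_simps)
      finally show ?thesis by (simp add: sum.distrib)
    qed
    have sum1: "\<bar>\<Sum>k<N. (c k - c' k) * (fst (h (Suc k)) - fst (h k))\<bar> \<le> 2 * (L * (D + (S + B)) * w)"
    proof -
      have "\<bar>\<Sum>k<N. (c k - c' k) * (fst (h (Suc k)) - fst (h k))\<bar>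
          \<le> (\<Sum>k<N. L * (D + (S + B)) * (w * (1/2) ^ k))"
        using c_diff N(1) \<tau>(1) L0 D S0 B0
        by (intro order_trans[OF sum_abs] sum_mono) (auto simp: abs_mult h_Suc intro!: mult_mono)
      also have "\<dots> = L * (D + (S + B)) * w * (\<Sum>k<N. (1/2) ^ k)" by (simp add: sum_distrib_left mult.assoc)
      also have "\<dots> \<le> L * (D + (S + B)) * w * 2"
        using geometric_sum_le L0 D S0 B0 w_nonneg by (intro mult_left_mono) auto
      finally show ?thesis by simp
    qed
    have sum2: "\<bar>\<Sum>k<N. c' k * (\<delta> (Suc k) - \<delta> k)\<bar> \<le> 6 * (L * w * X)"
    proof -
      have "\<bar>\<Sum>k<N. (c' (Suc k) - c' k) * \<delta> (Suc k)\<bar> \<le> (\<Sum>k<N. L * (2 * (w * (1/2) ^ k)) * X)"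
        using c'_var \<delta> N(1) L0 w_nonneg
        by (intro order_trans[OF sum_abs] sum_mono) (auto simp: abs_mult intro!: mult_mono)
      also have "\<dots> = 2 * L * w * X * (\<Sum>k<N. (1/2) ^ k)" by (simp add: sum_distrib_left algebra_simps)
      also have "\<dots> \<le> 2 * L * w * X * 2"
        using geometric_sum_le L0 X0 w_nonneg by (intro mult_left_mono) auto
      finally have a: "\<bar>\<Sum>k<N. (c' (Suc k) - c' k) * \<delta> (Suc k)\<bar> \<le> 4 * (L * w * X)" by simp
      have "\<bar>c' k * \<delta> k\<bar> \<le> w * X" if "k \<le> n" for k
        unfolding abs_mult c'_def using m_small[OF p(2) U(2)] \<delta>[OF that] w_nonneg by (intro mult_mono) auto
      then have b: "\<bar>c' N * \<delta> N\<bar> \<le> w * X" "\<bar>c' 0 * \<delta> 0\<bar> \<le> w * X" using N(1) by auto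
      have "w * X \<le> L * w * X"
        using L_ge_1 w_nonneg X0 by (intro mult_right_mono) (auto simp: mult_le_cancel_right1)
      then show ?thesis using a b unfolding abel_summation by linarith
    qed
    have start': "\<bar>snd (h 0) - snd (h' 0)\<bar> \<le> 3 * (L * D)"
    proof -
      have c: "norm (Y 0 - Y' 0) \<le> L * D" using ctr_lip[OF p] start by (simp add: D_def)
      have "norm ((h 0 - h' 0) - (Y 0 - Y' 0)) \<le> L * D + w * (L * D)"
        using H_near_id[OF p U(1)[of 0] U(2)[of 0]] mult_left_mono[OF c w_nonneg]
        unfolding h_def h'_def D_def by linarith
      moreover have "w * (L * D) \<le> L * D"
        using w_le L0 D by (intro mult_left_le_one_le) (auto simp: w_nonneg)
      ultimately have "norm (h 0 - h' 0) \<le> 3 * (L * D)"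
        using c norm_triangle_ineq[of "(h 0 - h' 0) - (Y 0 - Y' 0)" "Y 0 - Y' 0"] by simp
      then show ?thesis using abs_snd_le_norm[of "h 0 - h' 0"] by simp
    qed
    have "B \<le> \<bar>snd (h N) - snd (h' N)\<bar> + (L * D + w * (S + B))"
      using h_near[OF N(1)] N(2) abs_snd_le_norm[of "(h N - h' N) - (Y N - Y' N)"] by simp
    then have "B \<le> 4 * (L * D) + w * (S + B) + 2 * (L * (D + (S + B)) * w) + 6 * (L * w * X)"
      using tele sum1 sum2 start' by linarith
    also have "\<dots> = 4 * (L * D) + 2 * (L * w) * D + 6 * (L * (L * w)) * D + (w + 14 * (L * w)) * (S + B)"
      by (simp add: X_def algebra_simps)
    also have "\<dots> \<le> 4 * (L * D) + 2 * (L * w) * D + 6 * (L * (L * w)) * D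
        + 15 * (L * w) * (4 * L * D + 5 * L * B)"
    proof -
      have "w \<le> L * w" using L_ge_1 w_nonneg by (simp add: mult_le_cancel_right1)
      moreover have "1 * B \<le> L * B" using L_ge_1 B0 by (intro mult_right_mono)
      ultimately have "(w + 14 * (L * w)) * (S + B) \<le> 15 * (L * w) * (4 * L * D + 5 * L * B)"
        using S_le S0 B0 L0 w_nonneg by (intro mult_mono) (auto simp: algebra_simps)
      then show ?thesis by simp
    qed
    also have "\<dots> = 4 * (L * D) + 2 * (L * w) * D + 66 * (L\<^sup>2 * w) * D + 75 * (L\<^sup>2 * w) * B"
      by (simp add: power2_eq_square algebra_simps)
    also have "\<dots> \<le> 4 * (L * D) + D + D + B / 2"
    proof -
      have "(L * w) * D \<le> (1 / 150) * D" using Lw_small D by (intro mult_right_mono) auto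
      moreover have "(L\<^sup>2 * w) * D \<le> (1 / 150) * D" using w_small D by (intro mult_right_mono) auto
      moreover have "(L\<^sup>2 * w) * B \<le> (1 / 150) * B" using w_small B0 by (intro mult_right_mono) auto
      ultimately show ?thesis using D by linarith
    qed
    finally have "B \<le> 8 * (L * D) + 4 * D" by simp
    moreover have "L * D \<le> L\<^sup>2 * D" "D \<le> L\<^sup>2 * D"
      using L_ge_1 D power_increasing[of 1 2 L] power_increasing[of 0 2 L]
        mult_right_mono[of 1 "L\<^sup>2" D] by (auto intro!: mult_right_mono)
    moreover have "0 \<le> L\<^sup>2 * D" using D by simp
    ultimately show ?thesis by linarith
  qed
  have "norm (Y n - Y' n) \<le> S + B" by (rule SB) simp
  also have "\<dots> \<le> 4 * (L * D) + 4 * (L * B) + B" using S_le by simp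
  also have "\<dots> \<le> 4 * (L * D) + 4 * (L * (25 * L\<^sup>2 * D)) + 25 * L\<^sup>2 * D"
    using B_le L0 by (intro add_mono mult_left_mono) auto
  also have "\<dots> \<le> 129 * L ^ 3 * D"
  proof -
    have "L \<le> L ^ 3" "L\<^sup>2 \<le> L ^ 3"
      using power_increasing[of 1 3 L] power_increasing[of 2 3 L] L_ge_1 by auto
    then have "L * D \<le> L ^ 3 * D" "L\<^sup>2 * D \<le> L ^ 3 * D" using D by (auto intro: mult_right_mono)
    then show ?thesis by (simp add: power2_eq_square power3_eq_cube algebra_simps)
  qed
  finally show ?thesis by (simp add: D_def)
qed

text \<open>
  The limit of the iteration that starts at the centre, as a function of the parameter.
\<close>

lemma limit_of_iterates:
  obtains lim where
    "\<And>p Y. \<lbrakk>p \<in> P; iterates p Y; Y 0 = ctr p\<rbrakk> \<Longrightarrow> Y \<longlonglongrightarrow> lim p"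
    "\<And>p. p \<in> P \<Longrightarrow> F p (lim p) = 0"
    "\<And>p. p \<in> P \<Longrightarrow> lim p \<in> U"
    "\<And>p. \<lbrakk>p \<in> P; F p (ctr p) = 0\<rbrakk> \<Longrightarrow> lim p = ctr p"
    "\<And>p p'. \<lbrakk>p \<in> P; p' \<in> P\<rbrakk> \<Longrightarrow> norm (lim p - lim p') \<le> 129 * L ^ 3 * dist p p'"
proof -
  have unique: "\<exists>!Y. Y 0 = ctr p \<and> iterates p Y" if "p \<in> P" for p
    using iterates_exist[OF that, of "ctr p"] L_ge_1 \<rho>_pos by simp
  then have "\<forall>p. \<exists>Y. p \<in> P \<longrightarrow> Y 0 = ctr p \<and> iterates p Y" by blast
  then obtain Y where Y: "\<And>p. p \<in> P \<Longrightarrow> Y p 0 = ctr p" "\<And>p. p \<in> P \<Longrightarrow> iterates p (Y p)" by metis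
  have "\<forall>p. \<exists>z. p \<in> P \<longrightarrow> z \<in> U \<and> Y p \<longlonglongrightarrow> z \<and> F p z = 0"
    using iterates_converge Y by blast
  then obtain l where l: "\<And>p. p \<in> P \<Longrightarrow> l p \<in> U" "\<And>p. p \<in> P \<Longrightarrow> Y p \<longlonglongrightarrow> l p"
      "\<And>p. p \<in> P \<Longrightarrow> F p (l p) = 0" by metis
  show thesis
  proof (rule that[of l])
    fix p Z assume "p \<in> P" "iterates p Z" "Z 0 = ctr p"
    then have "Z = Y p" using unique Y by blast
    then show "Z \<longlonglongrightarrow> l p" using l \<open>p \<in> P\<close> by simp
  next
    fix p assume p: "p \<in> P" "F p (ctr p) = 0"
    then have "iterates p (\<lambda>_. ctr p)" using \<rho>_pos by (simp add: iterates_def)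
    then have "Y p = (\<lambda>_. ctr p)" using unique[OF p(1)] Y p by auto
    then show "l p = ctr p" using l(2)[OF p(1)] by (simp add: LIMSEQ_const_iff)
  next
    fix p p' assume p: "p \<in> P" "p' \<in> P"
    have "(\<lambda>n. norm (Y p n - Y p' n)) \<longlonglongrightarrow> norm (l p - l p')"
      by (intro tendsto_norm tendsto_diff l p)
    then show "norm (l p - l p') \<le> 129 * L ^ 3 * dist p p'"
      by (rule Lim_bounded) (use iterates_lipschitz[OF p] Y p in auto)
  qed (use l in auto)
qed

end

section \<open>The oscillator with a Lipschitz nonlinearity\<close>

text \<open>
  The only solution of the harmonic oscillator with vanishing initial data; this identifies two functions
  that satisfy the same variation of constants formula.
\<close>

lemma harmonic_zero:
  assumes p: "\<And>t. (p has_real_derivative q t) (at t)"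
    and q: "\<And>t. (q has_real_derivative - p t) (at t)"
    and "p 0 = 0" "q 0 = 0"
  shows "p t = 0" "q t = 0"
proof -
  have "((\<lambda>t. (p t)\<^sup>2 + (q t)\<^sup>2) has_real_derivative 0) (at t)" for t
    by (auto intro!: derivative_eq_intros p q)
  then have "(p t)\<^sup>2 + (q t)\<^sup>2 = (p 0)\<^sup>2 + (q 0)\<^sup>2" by (intro DERIV_isconst_all) blast
  then show "p t = 0" "q t = 0" using assms by (auto simp: sum_power2_eq_zero_iff)
qed

lemma ex_real_antiderivative:
  assumes "continuous_on UNIV f"
  shows "\<exists>J. J 0 = 0 \<and> (\<forall>t. (J has_real_derivative f t) (at t))"
  unfolding has_real_derivative_iff_has_vector_derivative
  by (rule ex_antiderivative_from_zero[OF assms]) blast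

text \<open>
  The pair of integrals by which \<open>bif\<close> tests the nonlinearity; \<open>F\<close> is the moment pair of
  \<open>\<phi>\<close> along the solution.
\<close>

definition moments :: "(real \<Rightarrow> real) \<Rightarrow> real \<times> real" where
  "moments u = (integral {0..2*pi} (\<lambda>s. sin s * u s), integral {0..2*pi} (\<lambda>s. cos s * u s))"

lemma LBINT_eq_integral:
  fixes u :: "real \<Rightarrow> real"
  assumes "continuous_on UNIV u" "0 \<le> t"
  shows "(LBINT s=ereal 0..ereal t. u s) = integral {0..t} u"
  by (intro interval_integral_eq_integral borel_integrable_atLeastAtMost' continuous_on_subset[OF assms(1)])
     (use assms in auto)

lemma moments_diff:
  assumes "continuous_on UNIV u" "continuous_on UNIV v"
  shows "moments u - moments v = moments (\<lambda>s. u s - v s)"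
  unfolding moments_def diff_Pair right_diff_distrib
  by (subst (1 2) integral_diff)
     (auto intro!: integrable_continuous_interval continuous_intros continuous_on_subset[OF assms(1)]
       continuous_on_subset[OF assms(2)])

lemma norm_moments_le:
  assumes u: "continuous_on UNIV u" and M: "\<And>s. \<lbrakk>0 \<le> s; s \<le> 2*pi\<rbrakk> \<Longrightarrow> \<bar>u s\<bar> \<le> M"
  shows "norm (moments u) \<le> 4 * pi * M"
proof -
  have "norm (integral {0..2*pi} (\<lambda>s. k s * u s)) \<le> M * (2*pi - 0)"
    if "\<And>s. \<bar>k s\<bar> \<le> 1" "continuous_on UNIV k" for k
  proof (rule integral_bound)
    show "continuous_on {0..2*pi} (\<lambda>s. k s * u s)"
      by (intro continuous_intros continuous_on_subset[OF u] continuous_on_subset[OF that(2)]) auto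
    show "norm (k s * u s) \<le> M" if "s \<in> {0..2*pi}" for s
      using that M[of s] \<open>\<bar>k s\<bar> \<le> 1\<close> mult_mono[of "\<bar>k s\<bar>" 1 "\<bar>u s\<bar>" M] by (simp add: abs_mult)
  qed simp
  from this[of sin] this[of cos] show ?thesis
    using norm_pair_le[of "moments u"] continuous_on_sin[OF continuous_on_id, of "UNIV :: real set"]
      continuous_on_cos[OF continuous_on_id, of "UNIV :: real set"]
    by (auto simp: moments_def mult.commute)
qed

lemma moments_trig: "moments (\<lambda>s. c * cos s + d * sin s) = (pi * d, pi * c)"
proof -
  have sc: "cos s * cos s + sin s * sin s = 1" for s :: real by (rule sin_cos_squared_add3)
  have "((\<lambda>s. c * (sin s)\<^sup>2 / 2 + d * (s - sin s * cos s) / 2) has_real_derivative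
      c * (2 * sin s * cos s) / 2 + d * (1 - (cos s * cos s - sin s * sin s)) / 2) (at s)" for s
    by (auto intro!: derivative_eq_intros)
  moreover have "c * (2 * sin s * cos s) / 2 + d * (1 - (cos s * cos s - sin s * sin s)) / 2
      = sin s * (c * cos s + d * sin s)" for s
    using sc[of s] by algebra
  ultimately have sin_part: "((\<lambda>s. sin s * (c * cos s + d * sin s)) has_integral
      (c * (sin (2*pi))\<^sup>2 / 2 + d * (2*pi - sin (2*pi) * cos (2*pi)) / 2)
      - (c * (sin 0)\<^sup>2 / 2 + d * (0 - sin 0 * cos 0) / 2)) {0..2*pi}"
    by (intro fundamental_theorem_of_calculus)
       (auto simp: has_real_derivative_iff_has_vector_derivative[symmetric] has_field_derivative_at_within)
  have "((\<lambda>s. d * (sin s)\<^sup>2 / 2 + c * (s + sin s * cos s) / 2) has_real_derivative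
      d * (2 * sin s * cos s) / 2 + c * (1 + (cos s * cos s - sin s * sin s)) / 2) (at s)" for s
    by (auto intro!: derivative_eq_intros)
  moreover have "d * (2 * sin s * cos s) / 2 + c * (1 + (cos s * cos s - sin s * sin s)) / 2
      = cos s * (c * cos s + d * sin s)" for s
    using sc[of s] by algebra
  ultimately have "((\<lambda>s. cos s * (c * cos s + d * sin s)) has_integral
      (d * (sin (2*pi))\<^sup>2 / 2 + c * (2*pi + sin (2*pi) * cos (2*pi)) / 2)
      - (d * (sin 0)\<^sup>2 / 2 + c * (0 + sin 0 * cos 0) / 2)) {0..2*pi}"
    by (intro fundamental_theorem_of_calculus)
       (auto simp: has_real_derivative_iff_has_vector_derivative[symmetric] has_field_derivative_at_within)
  with sin_part show ?thesis by (auto simp: moments_def dest!: integral_unique)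
qed

lemma mult_diff_le: "\<bar>u * v - u' * v'\<bar> \<le> \<bar>u\<bar> * \<bar>v - v'\<bar> + \<bar>u - u'\<bar> * \<bar>v'\<bar>" for u v u' v' :: real
proof -
  have "u * v - u' * v' = u * (v - v') + (u - u') * v'" by (simp add: algebra_simps)
  then show ?thesis by (metis abs_mult abs_triangle_ineq)
qed

locale lipschitz_oscillator =
  fixes g :: "real \<Rightarrow> real" and C :: real
  assumes g: "C-lipschitz_on UNIV g"
begin

abbreviation \<phi> where "\<phi> \<equiv> nonlin g"

lemma C_nonneg: "0 \<le> C" and g_lip: "\<bar>g u - g v\<bar> \<le> C * \<bar>u - v\<bar>"
  using g by (auto simp: lipschitz_on_def dist_real_def)

lemma \<phi>_lip: "\<bar>\<phi> u \<eta> \<epsilon> - \<phi> v \<eta> \<epsilon>\<bar> \<le> (\<bar>\<eta>\<bar> + \<bar>1 - \<epsilon> * \<eta>\<bar> * C) * \<bar>u - v\<bar>"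
proof -
  have "\<phi> u \<eta> \<epsilon> - \<phi> v \<eta> \<epsilon> = - \<eta> * (u - v) + (1 - \<epsilon> * \<eta>) * (g u - g v)"
    by (simp add: nonlin_def algebra_simps)
  then have "\<bar>\<phi> u \<eta> \<epsilon> - \<phi> v \<eta> \<epsilon>\<bar> \<le> \<bar>\<eta>\<bar> * \<bar>u - v\<bar> + \<bar>1 - \<epsilon> * \<eta>\<bar> * \<bar>g u - g v\<bar>"
    by (metis abs_minus_cancel abs_mult abs_triangle_ineq)
  also have "\<dots> \<le> \<bar>\<eta>\<bar> * \<bar>u - v\<bar> + \<bar>1 - \<epsilon> * \<eta>\<bar> * (C * \<bar>u - v\<bar>)"
    by (intro add_left_mono mult_left_mono g_lip) auto
  finally show ?thesis by (simp add: algebra_simps)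
qed

lemma continuous_on_\<phi> [continuous_intros]:
  assumes "continuous_on S u" shows "continuous_on S (\<lambda>s. \<phi> (u s) \<eta> \<epsilon>)"
  unfolding nonlin_def
  by (intro continuous_intros assms
      continuous_on_compose2[OF lipschitz_on_continuous_on[OF g] assms]) auto

lemma ivp_ex1: "\<exists>!x. ivp_solution \<phi> p y x"
proof -
  obtain a \<epsilon> where p: "p = (a, \<epsilon>)" by (cases p)
  obtain \<eta> b where y: "y = (\<eta>, b)" by (cases y)
  define A where "A z = (snd z, - fst z - \<epsilon> * \<phi> (fst z) \<eta> \<epsilon>)" for z :: "real \<times> real"
  define M where "M = \<bar>\<eta>\<bar> + \<bar>1 - \<epsilon> * \<eta>\<bar> * C"
  have "(2 + \<bar>\<epsilon>\<bar> * M)-lipschitz_on UNIV A"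
  proof (rule lipschitz_onI)
    fix z z'
    have "\<bar>snd (A z - A z')\<bar> \<le> \<bar>fst (z - z')\<bar> + \<bar>\<epsilon> * (\<phi> (fst z) \<eta> \<epsilon> - \<phi> (fst z') \<eta> \<epsilon>)\<bar>"
      by (simp add: A_def algebra_simps abs_if)
    also have "\<dots> \<le> \<bar>fst (z - z')\<bar> + \<bar>\<epsilon>\<bar> * (M * \<bar>fst (z - z')\<bar>)"
      unfolding abs_mult using \<phi>_lip by (intro add_left_mono mult_left_mono) (auto simp: M_def)
    also have "\<dots> \<le> (1 + \<bar>\<epsilon>\<bar> * M) * norm (z - z')"
      using mult_left_mono[OF abs_fst_le_norm[of "z - z'"], of "1 + \<bar>\<epsilon>\<bar> * M"] C_nonneg
      by (simp add: M_def algebra_simps)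
    finally have "\<bar>snd (A z - A z')\<bar> \<le> (1 + \<bar>\<epsilon>\<bar> * M) * norm (z - z')" .
    moreover have "\<bar>fst (A z - A z')\<bar> \<le> norm (z - z')"
      using abs_snd_le_norm[of "z - z'"] by (simp add: A_def)
    ultimately show "dist (A z) (A z') \<le> (2 + \<bar>\<epsilon>\<bar> * M) * dist z z'"
      using norm_pair_le[of "A z - A z'"] unfolding dist_norm by (simp add: algebra_simps)
  qed (use C_nonneg in \<open>auto simp: M_def\<close>)
  note A = this
  have to_system: "\<exists>v. v 0 = b \<and> x 0 = a \<and> (\<forall>t. ((\<lambda>t. (x t, v t)) has_vector_derivative A (x t, v t)) (at t))"
    if "ivp_solution \<phi> p y x" for x
    using that unfolding ivp_solution_def p y A_def has_real_derivative_iff_has_vector_derivative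
    by (auto intro!: has_vector_derivative_Pair)
  show ?thesis
  proof (rule ex_ex1I)
    obtain z where z: "z 0 = (a, b)" "\<And>t. (z has_vector_derivative A (z t)) (at t)"
      using lipschitz_ode_global_solution[OF A] by blast
    have "((\<lambda>t. fst (z t)) has_real_derivative snd (z t)) (at t)"
         "((\<lambda>t. snd (z t)) has_real_derivative - fst (z t) - \<epsilon> * \<phi> (fst (z t)) \<eta> \<epsilon>) (at t)" for t
      using bounded_linear.has_vector_derivative[OF bounded_linear_fst z(2)[of t]]
        bounded_linear.has_vector_derivative[OF bounded_linear_snd z(2)[of t]]
      unfolding has_real_derivative_iff_has_vector_derivative A_def by auto
    then show "\<exists>x. ivp_solution \<phi> p y x"
      unfolding p y ivp_solution_def using z(1)
      by (intro exI[of _ "\<lambda>t. fst (z t)"]) (auto intro!: exI[of _ "\<lambda>t. snd (z t)"])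
  next
    fix x x' assume "ivp_solution \<phi> p y x" "ivp_solution \<phi> p y x'"
    then obtain v v' where "v 0 = b" "x 0 = a" "v' 0 = b" "x' 0 = a"
      "\<And>t. ((\<lambda>t. (x t, v t)) has_vector_derivative A (x t, v t)) (at t)"
      "\<And>t. ((\<lambda>t. (x' t, v' t)) has_vector_derivative A (x' t, v' t)) (at t)"
      using to_system by meson
    then have "(x t, v t) = (x' t, v' t)" for t
      using lipschitz_ode_unique[OF A, of "\<lambda>t. (x t, v t)" "\<lambda>t. (x' t, v' t)" t] by simp
    then show "x = x'" by auto
  qed
qed

lemma ivp_sol: "ivp_solution \<phi> p y (sol \<phi> p y)"
  unfolding sol_def by (rule theI'[OF ivp_ex1])

lemma sol_eqI: "ivp_solution \<phi> p y x \<Longrightarrow> x = sol \<phi> p y"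
  using ivp_ex1 ivp_sol by blast

lemma continuous_on_sol [continuous_intros]: "continuous_on S (sol \<phi> p y)"
proof -
  have "isCont (sol \<phi> p y) t" for t
    using ivp_sol[of p y] unfolding ivp_solution_def by (force simp: split_beta intro: DERIV_isCont)
  then show ?thesis by (simp add: continuous_at_imp_continuous_on)
qed

text \<open>
  Variation of constants. With \<open>I1\<close> and \<open>I2\<close> the antiderivatives of \<open>sin \<cdot> f\<close> and \<open>cos \<cdot> f\<close> that vanish
  at \<open>0\<close>, the remainder is \<open>sin \<cdot> I2 - cos \<cdot> I1\<close>, and \<open>F\<close> collects the values of \<open>I1\<close> and \<open>I2\<close> at
  \<open>2\<pi>\<close>. Thus \<open>x (2\<pi>) = a + \<epsilon> F\<^sub>1\<close> and \<open>x' (2\<pi>) = b - \<epsilon> F\<^sub>2\<close>.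
\<close>

lemma sol_representation:
  fixes a \<epsilon> \<eta> b
  defines "x \<equiv> sol \<phi> (a, \<epsilon>) (\<eta>, b)"
  obtains v I1 I2 where
    "x 0 = a" "v 0 = b" "I1 0 = 0" "I2 0 = 0"
    "\<And>t. (x has_real_derivative v t) (at t)"
    "\<And>t. (v has_real_derivative - x t - \<epsilon> * \<phi> (x t) \<eta> \<epsilon>) (at t)"
    "\<And>t. (I1 has_real_derivative sin t * \<phi> (x t) \<eta> \<epsilon>) (at t)"
    "\<And>t. (I2 has_real_derivative cos t * \<phi> (x t) \<eta> \<epsilon>) (at t)"
    "\<And>t. x t = a * cos t + b * sin t - \<epsilon> * (sin t * I2 t - cos t * I1 t)"
    "\<And>t. v t = - a * sin t + b * cos t - \<epsilon> * (cos t * I2 t + sin t * I1 t)"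
    "\<And>t. rem \<phi> t (a, \<epsilon>) (\<eta>, b) = sin t * I2 t - cos t * I1 t"
    "F g (a, \<epsilon>) (\<eta>, b) = (I1 (2*pi), I2 (2*pi))"
proof -
  obtain v where x: "x 0 = a" "v 0 = b"
    "\<And>t. (x has_real_derivative v t) (at t)"
    "\<And>t. (v has_real_derivative - x t - \<epsilon> * \<phi> (x t) \<eta> \<epsilon>) (at t)"
    using ivp_sol[of "(a, \<epsilon>)" "(\<eta>, b)"] unfolding ivp_solution_def x_def by auto
  define f where "f t = \<phi> (x t) \<eta> \<epsilon>" for t
  have f: "continuous_on S f" for S unfolding f_def x_def by (intro continuous_intros)
  obtain I1 where I1: "I1 0 = 0" "\<And>t. (I1 has_real_derivative sin t * f t) (at t)"
    using ex_real_antiderivative[OF continuous_on_mult[OF continuous_on_sin[OF continuous_on_id] f]]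
    by auto
  obtain I2 where I2: "I2 0 = 0" "\<And>t. (I2 has_real_derivative cos t * f t) (at t)"
    using ex_real_antiderivative[OF continuous_on_mult[OF continuous_on_cos[OF continuous_on_id] f]]
    by auto
  have trig: "cos t * (cos t * u) + sin t * (sin t * u) = u" for t u :: real
    using sin_cos_squared_add3[of t] by algebra
  define p where "p t = x t - (a * cos t + b * sin t - \<epsilon> * (sin t * I2 t - cos t * I1 t))" for t
  define q where "q t = v t - (- a * sin t + b * cos t - \<epsilon> * (cos t * I2 t + sin t * I1 t))" for t
  have "(p has_real_derivative v t - (a * (- sin t) + b * cos t
      - \<epsilon> * ((cos t * I2 t + sin t * (cos t * f t)) - (- sin t * I1 t + cos t * (sin t * f t))))) (at t)" for t
    unfolding p_def by (rule derivative_eq_intros x(3) I1(2) I2(2) refl | simp)+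
  then have "(p has_real_derivative q t) (at t)" for t
    by (rule DERIV_cong) (simp add: q_def algebra_simps)
  moreover
  have "(q has_real_derivative (- x t - \<epsilon> * f t) - (- a * cos t + b * (- sin t)
      - \<epsilon> * ((- sin t * I2 t + cos t * (cos t * f t)) + (cos t * I1 t + sin t * (sin t * f t))))) (at t)" for t
    unfolding q_def f_def by (rule derivative_eq_intros x(4) I1(2)[unfolded f_def] I2(2)[unfolded f_def] refl | simp)+
  then have "(q has_real_derivative - p t) (at t)" for t
    by (rule DERIV_cong) (use trig[of t "f t"] in \<open>simp add: p_def algebra_simps\<close>)
  moreover have "p 0 = 0" "q 0 = 0" by (simp_all add: p_def q_def x I1 I2)
  ultimately have pq: "p t = 0" "q t = 0" for t using harmonic_zero by blast+
  have LB: "(LBINT s=ereal 0..ereal t. k s * f s) = I t - I 0"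
    if "continuous_on UNIV k" "\<And>t. (I has_real_derivative k t * f t) (at t)" for k I t
    using that f
    by (intro interval_integral_FTC_finite continuous_intros)
       (auto simp: has_real_derivative_iff_has_vector_derivative intro: has_vector_derivative_at_within continuous_on_subset)
  have "rem \<phi> t (a, \<epsilon>) (\<eta>, b) = sin t * I2 t - cos t * I1 t" for t
  proof -
    have "((\<lambda>s. sin t * I2 s - cos t * I1 s) has_real_derivative sin (t - s) * f s) (at s)" for s
      by (auto intro!: derivative_eq_intros I1 I2 simp: sin_diff algebra_simps)
    from LB[of "\<lambda>s. sin (t - s)", OF _ this, of t]
    show ?thesis by (simp add: rem_def f_def x_def[symmetric] I1 I2 continuous_intros)
  qed
  moreover have "F g (a, \<epsilon>) (\<eta>, b) = (I1 (2*pi), I2 (2*pi))"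
    using LB[of sin I1 "2*pi"] LB[of cos I2 "2*pi"] I1 I2
    by (simp add: F_def bif_def x_def[symmetric] f_def continuous_intros)
  ultimately show thesis
    using x I1 I2 pq unfolding p_def q_def f_def by (intro that[of v I1 I2]) auto
qed

lemma F_eq_moments:
  "F g p y = moments (\<lambda>s. \<phi> (sol \<phi> p y s) (fst y) (snd p))"
  unfolding F_def bif_def moments_def
  by (subst (1 2) LBINT_eq_integral) (auto intro!: continuous_intros)

lemma sol_eq_integral:
  assumes "0 \<le> t"
  shows "sol \<phi> (a, \<epsilon>) (\<eta>, b) t = a * cos t + b * sin t
    - integral {0..t} (\<lambda>s. sin (t - s) * (\<epsilon> * \<phi> (sol \<phi> (a, \<epsilon>) (\<eta>, b) s) \<eta> \<epsilon>))"
proof -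
  let ?f = "\<lambda>s. \<phi> (sol \<phi> (a, \<epsilon>) (\<eta>, b) s) \<eta> \<epsilon>"
  have "rem \<phi> t (a, \<epsilon>) (\<eta>, b) = integral {0..t} (\<lambda>s. sin (t - s) * ?f s)"
    unfolding rem_def
    by (subst LBINT_eq_integral) (auto intro!: continuous_intros assms)
  then have int: "\<epsilon> * rem \<phi> t (a, \<epsilon>) (\<eta>, b) = integral {0..t} (\<lambda>s. sin (t - s) * (\<epsilon> * ?f s))"
    by (subst mult.left_commute) simp
  have "sol \<phi> (a, \<epsilon>) (\<eta>, b) t = a * cos t + b * sin t - \<epsilon> * rem \<phi> t (a, \<epsilon>) (\<eta>, b)"
    by (rule sol_representation[of a \<epsilon> \<eta> b]) simp
  then show ?thesis unfolding int .
qed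

text \<open>
  If \<open>F\<close> vanishes, the solution returns to its initial data after \<open>2\<pi>\<close> and is periodic by uniqueness.
  Then \<open>I1\<close> and \<open>I2\<close> have periodic derivatives and equal values at \<open>0\<close> and \<open>2\<pi>\<close>, so the
  remainder is periodic as well. At \<open>\<epsilon> = 0\<close> every solution is periodic, but the remainder is so only because
  of \<open>F = 0\<close>.
\<close>

lemma periodic_if_F_eq_0:
  assumes "F g (a, \<epsilon>) (\<eta>, b) = 0"
  shows sol_periodic: "sol \<phi> (a, \<epsilon>) (\<eta>, b) (t + 2*pi) = sol \<phi> (a, \<epsilon>) (\<eta>, b) t"
    and rem_periodic: "rem \<phi> (t + 2*pi) (a, \<epsilon>) (\<eta>, b) = rem \<phi> t (a, \<epsilon>) (\<eta>, b)"
proof -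
  define x where "x = sol \<phi> (a, \<epsilon>) (\<eta>, b)"
  obtain v I1 I2 where *:
    "x 0 = a" "v 0 = b" "I1 0 = 0" "I2 0 = 0"
    "\<And>t. (x has_real_derivative v t) (at t)"
    "\<And>t. (v has_real_derivative - x t - \<epsilon> * \<phi> (x t) \<eta> \<epsilon>) (at t)"
    "\<And>t. (I1 has_real_derivative sin t * \<phi> (x t) \<eta> \<epsilon>) (at t)"
    "\<And>t. (I2 has_real_derivative cos t * \<phi> (x t) \<eta> \<epsilon>) (at t)"
    "\<And>t. x t = a * cos t + b * sin t - \<epsilon> * (sin t * I2 t - cos t * I1 t)"
    "\<And>t. v t = - a * sin t + b * cos t - \<epsilon> * (cos t * I2 t + sin t * I1 t)"
    "\<And>t. rem \<phi> t (a, \<epsilon>) (\<eta>, b) = sin t * I2 t - cos t * I1 t"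
    "F g (a, \<epsilon>) (\<eta>, b) = (I1 (2*pi), I2 (2*pi))"
    by (rule sol_representation[of a \<epsilon> \<eta> b]) (auto simp: x_def)
  have I: "I1 (2*pi) = 0" "I2 (2*pi) = 0" using * assms by (auto simp: zero_prod_def)
  \<comment> \<open>The shifted solution has the same initial data.\<close>
  have "ivp_solution \<phi> (a, \<epsilon>) (\<eta>, b) (\<lambda>t. x (t + 2*pi))"
    unfolding ivp_solution_def prod.case
  proof (intro conjI exI[of _ "\<lambda>t. v (t + 2*pi)"] allI)
    show "x (0 + 2*pi) = a" "v (0 + 2*pi) = b" using *(9)[of "2*pi"] *(10)[of "2*pi"] I by simp_all
    show "((\<lambda>t. x (t + 2*pi)) has_real_derivative v (t + 2*pi)) (at t)" for t
      using *(5)[of "t + 2*pi"] by (simp add: DERIV_shift add.commute)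
    show "((\<lambda>t. v (t + 2*pi)) has_real_derivative - x (t + 2*pi) - \<epsilon> * \<phi> (x (t + 2*pi)) \<eta> \<epsilon>) (at t)" for t
      using *(6)[of "t + 2*pi"] by (simp add: DERIV_shift add.commute)
  qed
  then have per: "x (t + 2*pi) = x t" for t using sol_eqI unfolding x_def by metis
  then show "sol \<phi> (a, \<epsilon>) (\<eta>, b) (t + 2*pi) = sol \<phi> (a, \<epsilon>) (\<eta>, b) t" by (simp add: x_def)
  have shift: "I (t + 2*pi) = I t"
    if "\<And>t. (I has_real_derivative k t * \<phi> (x t) \<eta> \<epsilon>) (at t)" "\<And>t. k (t + 2*pi) = k t" "I (2*pi) = I 0"
    for I k t
  proof -
    have "((\<lambda>t. I (t + 2*pi) - I t) has_real_derivative k t * \<phi> (x t) \<eta> \<epsilon> - k t * \<phi> (x t) \<eta> \<epsilon>) (at t)" for t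
      using that(1)[of "t + 2*pi"] by (intro DERIV_diff that(1)) (simp add: DERIV_shift add.commute that(2) per)
    then have "I (t + 2*pi) - I t = I (0 + 2*pi) - I 0"
      by (intro DERIV_isconst_all[of "\<lambda>t. I (t + 2*pi) - I t"]) auto
    then show ?thesis using that(3) by simp
  qed
  show "rem \<phi> (t + 2*pi) (a, \<epsilon>) (\<eta>, b) = rem \<phi> t (a, \<epsilon>) (\<eta>, b)"
    using shift[OF *(7)] shift[OF *(8)] * I by simp
qed

text \<open>
  The difference quotient of an antiderivative of \<open>\<phi>\<close> between \<open>a\<close> and \<open>a + \<epsilon> X\<close>, written as a mean value so
  that it makes sense at \<open>\<epsilon> X = 0\<close> and is visibly Lipschitz in all arguments.
\<close>

definition mean_\<phi> :: "real \<times> real \<Rightarrow> real \<Rightarrow> real \<Rightarrow> real" where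
  "mean_\<phi> p \<eta> X = integral {0..1} (\<lambda>t. \<phi> (fst p + t * (snd p * X)) \<eta> (snd p))"

text \<open>
  Conservation of energy between the times \<open>0\<close> and \<open>2\<pi>\<close>, divided by \<open>\<epsilon>\<close>. To include \<open>\<epsilon> = 0\<close>, the quantity
  \<open>K\<close> in the proof is the energy after substitution of the variation of constants formula, minus its initial
  harmonic part, and with one factor \<open>\<epsilon>\<close> already removed.
\<close>

lemma energy_identity:
  "fst (F g (a, \<epsilon>) (\<eta>, b)) *
     (a + \<epsilon> * (fst (F g (a, \<epsilon>) (\<eta>, b)) / 2 + mean_\<phi> (a, \<epsilon>) \<eta> (fst (F g (a, \<epsilon>) (\<eta>, b)))))
   = snd (F g (a, \<epsilon>) (\<eta>, b)) * (b - \<epsilon> * snd (F g (a, \<epsilon>) (\<eta>, b)) / 2)"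
proof -
  define x where "x = sol \<phi> (a, \<epsilon>) (\<eta>, b)"
  obtain v I1 I2 where *:
    "x 0 = a" "v 0 = b" "I1 0 = 0" "I2 0 = 0"
    "\<And>t. (x has_real_derivative v t) (at t)"
    "\<And>t. (v has_real_derivative - x t - \<epsilon> * \<phi> (x t) \<eta> \<epsilon>) (at t)"
    "\<And>t. (I1 has_real_derivative sin t * \<phi> (x t) \<eta> \<epsilon>) (at t)"
    "\<And>t. (I2 has_real_derivative cos t * \<phi> (x t) \<eta> \<epsilon>) (at t)"
    "\<And>t. x t = a * cos t + b * sin t - \<epsilon> * (sin t * I2 t - cos t * I1 t)"
    "\<And>t. v t = - a * sin t + b * cos t - \<epsilon> * (cos t * I2 t + sin t * I1 t)"
    "\<And>t. rem \<phi> t (a, \<epsilon>) (\<eta>, b) = sin t * I2 t - cos t * I1 t"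
    "F g (a, \<epsilon>) (\<eta>, b) = (I1 (2*pi), I2 (2*pi))"
    by (rule sol_representation[of a \<epsilon> \<eta> b]) (auto simp: x_def)
  have "continuous_on UNIV (\<lambda>u. \<phi> u \<eta> \<epsilon>)" by (intro continuous_intros)
  then obtain G where G: "\<And>u. (G has_real_derivative \<phi> u \<eta> \<epsilon>) (at u)"
    using ex_real_antiderivative by blast
  define K where "K t = a * I1 t + \<epsilon> * (I1 t)\<^sup>2 / 2 - b * I2 t + \<epsilon> * (I2 t)\<^sup>2 / 2 + G (x t)" for t
  have "(K has_real_derivative 0) (at t)" for t
  proof -
    have "((\<lambda>t. G (x t)) has_real_derivative \<phi> (x t) \<eta> \<epsilon> * v t) (at t)"
      by (rule DERIV_chain2[OF G *(5)])
    then show ?thesis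
      unfolding K_def *(10)
      by (auto intro!: derivative_eq_intros *(7,8) simp: power2_eq_square algebra_simps)
  qed
  then have "K (2*pi) = K 0" by (intro DERIV_isconst_all) blast
  moreover have "x (2*pi) = a + \<epsilon> * I1 (2*pi)" using *(9)[of "2*pi"] by simp
  ultimately have K: "a * I1 (2*pi) + \<epsilon> * (I1 (2*pi))\<^sup>2 / 2 - b * I2 (2*pi) + \<epsilon> * (I2 (2*pi))\<^sup>2 / 2
      + (G (a + \<epsilon> * I1 (2*pi)) - G a) = 0"
    unfolding K_def by (simp add: *)
  have "((\<lambda>t. (\<epsilon> * X) * \<phi> (a + t * (\<epsilon> * X)) \<eta> \<epsilon>) has_integral G (a + 1 * (\<epsilon> * X)) - G (a + 0 * (\<epsilon> * X))) {0..1}" for X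
  proof (rule fundamental_theorem_of_calculus)
    fix t :: real
    have "((\<lambda>t. G (a + t * (\<epsilon> * X))) has_real_derivative \<phi> (a + t * (\<epsilon> * X)) \<eta> \<epsilon> * (\<epsilon> * X)) (at t)"
      by (rule DERIV_chain2[OF G]) (auto intro!: derivative_eq_intros)
    then show "((\<lambda>t. G (a + t * (\<epsilon> * X))) has_vector_derivative (\<epsilon> * X) * \<phi> (a + t * (\<epsilon> * X)) \<eta> \<epsilon>) (at t within {0..1})"
      unfolding has_real_derivative_iff_has_vector_derivative[symmetric]
      by (simp add: mult.commute has_field_derivative_at_within)
  qed simp
  from integral_unique[OF this] have mean: "(\<epsilon> * X) * mean_\<phi> (a, \<epsilon>) \<eta> X = G (a + \<epsilon> * X) - G a" for X
    unfolding mean_\<phi>_def integral_mult_right fst_conv snd_conv by simp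
  show ?thesis using K mean[of "I1 (2*pi)"] by (simp add: *(12) power2_eq_square algebra_simps)
qed

end

section \<open>Real functions that are bounded and Lipschitz\<close>

text \<open>
  Boundedness is part of the notion because products and quotients of Lipschitz functions are Lipschitz only on
  sets where the functions are bounded.
\<close>

definition bounded_lipschitz :: "'a::metric_space set \<Rightarrow> ('a \<Rightarrow> real) \<Rightarrow> bool" where
  "bounded_lipschitz S f \<longleftrightarrow> (\<exists>K\<ge>0. (\<forall>x\<in>S. \<bar>f x\<bar> \<le> K) \<and> (\<forall>x\<in>S. \<forall>y\<in>S. \<bar>f x - f y\<bar> \<le> K * dist x y))"

lemma bounded_lipschitzI:
  assumes "\<And>x. x \<in> S \<Longrightarrow> \<bar>f x\<bar> \<le> B" "\<And>x y. \<lbrakk>x \<in> S; y \<in> S\<rbrakk> \<Longrightarrow> \<bar>f x - f y\<bar> \<le> M * dist x y"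
  shows "bounded_lipschitz S f"
  unfolding bounded_lipschitz_def
proof (intro exI[of _ "max 0 (max B M)"] conjI ballI)
  fix x y assume "x \<in> S" "y \<in> S"
  then have "\<bar>f x - f y\<bar> \<le> M * dist x y" by (rule assms)
  also have "\<dots> \<le> max 0 (max B M) * dist x y" by (intro mult_right_mono) auto
  finally show "\<bar>f x - f y\<bar> \<le> max 0 (max B M) * dist x y" .
qed (use assms(1) in \<open>auto simp: le_max_iff_disj\<close>)

lemma bounded_lipschitzE:
  assumes "bounded_lipschitz S f"
  obtains K where "0 \<le> K" "\<And>x. x \<in> S \<Longrightarrow> \<bar>f x\<bar> \<le> K"
    "\<And>x y. \<lbrakk>x \<in> S; y \<in> S\<rbrakk> \<Longrightarrow> \<bar>f x - f y\<bar> \<le> K * dist x y"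
  using assms unfolding bounded_lipschitz_def by blast

lemma bounded_lipschitz_const: "bounded_lipschitz S (\<lambda>_. c)"
  by (rule bounded_lipschitzI[of _ _ "\<bar>c\<bar>" 0]) auto

lemma bounded_lipschitz_add:
  assumes "bounded_lipschitz S f" "bounded_lipschitz S h"
  shows "bounded_lipschitz S (\<lambda>x. f x + h x)"
proof -
  obtain K where K: "0 \<le> K" "\<And>x. x \<in> S \<Longrightarrow> \<bar>f x\<bar> \<le> K" "\<And>x y. \<lbrakk>x \<in> S; y \<in> S\<rbrakk> \<Longrightarrow> \<bar>f x - f y\<bar> \<le> K * dist x y"
    using assms(1) by (rule bounded_lipschitzE) blast
  obtain M where M: "0 \<le> M" "\<And>x. x \<in> S \<Longrightarrow> \<bar>h x\<bar> \<le> M" "\<And>x y. \<lbrakk>x \<in> S; y \<in> S\<rbrakk> \<Longrightarrow> \<bar>h x - h y\<bar> \<le> M * dist x y"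
    using assms(2) by (rule bounded_lipschitzE) blast
  show ?thesis
  proof (rule bounded_lipschitzI)
    show "\<bar>f x + h x\<bar> \<le> K + M" if "x \<in> S" for x using K(2)[OF that] M(2)[OF that] by linarith
    show "\<bar>(f x + h x) - (f y + h y)\<bar> \<le> (K + M) * dist x y" if "x \<in> S" "y \<in> S" for x y
      using K(3)[OF that] M(3)[OF that] by (simp add: algebra_simps)
  qed
qed

lemma bounded_lipschitz_mult:
  assumes "bounded_lipschitz S f" "bounded_lipschitz S h"
  shows "bounded_lipschitz S (\<lambda>x. f x * h x)"
proof -
  obtain K where K: "0 \<le> K" "\<And>x. x \<in> S \<Longrightarrow> \<bar>f x\<bar> \<le> K" "\<And>x y. \<lbrakk>x \<in> S; y \<in> S\<rbrakk> \<Longrightarrow> \<bar>f x - f y\<bar> \<le> K * dist x y"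
    using assms(1) by (rule bounded_lipschitzE) blast
  obtain M where M: "0 \<le> M" "\<And>x. x \<in> S \<Longrightarrow> \<bar>h x\<bar> \<le> M" "\<And>x y. \<lbrakk>x \<in> S; y \<in> S\<rbrakk> \<Longrightarrow> \<bar>h x - h y\<bar> \<le> M * dist x y"
    using assms(2) by (rule bounded_lipschitzE) blast
  show ?thesis
  proof (rule bounded_lipschitzI)
    show "\<bar>f x * h x\<bar> \<le> K * M" if "x \<in> S" for x
      unfolding abs_mult using K M that by (intro mult_mono) auto
    show "\<bar>f x * h x - f y * h y\<bar> \<le> (K * M + K * M) * dist x y" if "x \<in> S" "y \<in> S" for x y
    proof -
      have "\<bar>f x\<bar> * \<bar>h x - h y\<bar> \<le> K * (M * dist x y)" using K M that by (intro mult_mono) auto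
      moreover have "\<bar>f x - f y\<bar> * \<bar>h y\<bar> \<le> (K * dist x y) * M" using K M that by (intro mult_mono) auto
      ultimately show ?thesis using mult_diff_le[of "f x" "h x" "f y" "h y"] by (simp add: algebra_simps)
    qed
  qed
qed

lemma bounded_lipschitz_diff:
  assumes "bounded_lipschitz S f" "bounded_lipschitz S h"
  shows "bounded_lipschitz S (\<lambda>x. f x - h x)"
  using bounded_lipschitz_add[OF assms(1) bounded_lipschitz_mult[OF bounded_lipschitz_const[of S "- 1"] assms(2)]]
  by simp

lemma bounded_lipschitz_divide:
  assumes f: "bounded_lipschitz S f" and h: "bounded_lipschitz S h"
    and c: "0 < c" "\<And>x. x \<in> S \<Longrightarrow> c \<le> \<bar>h x\<bar>"
  shows "bounded_lipschitz S (\<lambda>x. f x / h x)"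
proof -
  obtain M where M: "0 \<le> M" "\<And>x y. \<lbrakk>x \<in> S; y \<in> S\<rbrakk> \<Longrightarrow> \<bar>h x - h y\<bar> \<le> M * dist x y"
    using h by (rule bounded_lipschitzE) blast
  have "bounded_lipschitz S (\<lambda>x. 1 / h x)"
  proof (rule bounded_lipschitzI)
    show "\<bar>1 / h x\<bar> \<le> 1 / c" if "x \<in> S" for x
      using c(1) c(2)[OF that] by (auto simp: abs_divide intro!: divide_left_mono mult_pos_pos)
    show "\<bar>1 / h x - 1 / h y\<bar> \<le> (M / (c * c)) * dist x y" if "x \<in> S" "y \<in> S" for x y
    proof -
      have nz: "0 < \<bar>h x\<bar>" "0 < \<bar>h y\<bar>" using c(1) c(2)[OF that(1)] c(2)[OF that(2)] by linarith+
      then have "\<bar>1 / h x - 1 / h y\<bar> = \<bar>h x - h y\<bar> / (\<bar>h x\<bar> * \<bar>h y\<bar>)"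
        by (simp add: diff_frac_eq abs_divide abs_mult abs_minus_commute)
      also have "\<dots> \<le> (M * dist x y) / (c * c)"
        using M that c nz by (intro frac_le mult_mono mult_pos_pos) auto
      finally show ?thesis by simp
    qed
  qed
  from bounded_lipschitz_mult[OF f this] show ?thesis by simp
qed

lemma bounded_lipschitz_subset: "bounded_lipschitz T f \<Longrightarrow> S \<subseteq> T \<Longrightarrow> bounded_lipschitz S f"
  unfolding bounded_lipschitz_def by (meson subsetD)

section \<open>Estimates that are uniform in the parameters\<close>

lemma volterra_kernel_bound:
  assumes f: "continuous_on UNIV f" and B: "\<And>s. \<lbrakk>0 \<le> s; s \<le> 2*pi\<rbrakk> \<Longrightarrow> \<bar>f s\<bar> \<le> B"
    and t: "0 \<le> t" "t \<le> 2*pi"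
  shows "\<bar>integral {0..t} (\<lambda>s. sin (t - s) * f s)\<bar> \<le> 2 * pi * B"
proof -
  have B0: "0 \<le> B" using B[of 0] by auto
  have "norm (integral {0..t} (\<lambda>s. sin (t - s) * f s)) \<le> B * (t - 0)"
  proof (rule integral_bound[OF t(1)])
    show "continuous_on {0..t} (\<lambda>s. sin (t - s) * f s)"
      by (intro continuous_intros continuous_on_subset[OF f]) auto
    show "norm (sin (t - s) * f s) \<le> B" if "s \<in> {0..t}" for s
      using that B[of s] t mult_mono[of "\<bar>sin (t - s)\<bar>" 1 "\<bar>f s\<bar>" B] by (simp add: abs_mult)
  qed
  also have "\<dots> \<le> B * (2*pi)" using B0 t by (intro mult_left_mono) auto
  finally show ?thesis by (simp add: mult.commute)
qed

text \<open>
  A bound of a continuous function by a constant plus half of its own maximum; this replaces the Gronwall inequality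
  when \<open>\<epsilon>\<close> is small.
\<close>

lemma self_bound:
  assumes u: "continuous_on UNIV u"
    and self: "\<And>t M. \<lbrakk>0 \<le> t; t \<le> 2*pi; \<And>s. \<lbrakk>0 \<le> s; s \<le> 2*pi\<rbrakk> \<Longrightarrow> \<bar>u s\<bar> \<le> M\<rbrakk> \<Longrightarrow> \<bar>u t\<bar> \<le> c + M / 2"
    and t: "0 \<le> t" "t \<le> 2*pi"
  shows "\<bar>u t\<bar> \<le> 2 * (c::real)"
proof -
  have "\<exists>s\<in>{0..2*pi}. \<forall>t\<in>{0..2*pi}. \<bar>u t\<bar> \<le> \<bar>u s\<bar>"
    by (rule continuous_attains_sup) (auto intro!: continuous_intros continuous_on_subset[OF u])
  then obtain s where s: "0 \<le> s" "s \<le> 2*pi" "\<And>t. \<lbrakk>0 \<le> t; t \<le> 2*pi\<rbrakk> \<Longrightarrow> \<bar>u t\<bar> \<le> \<bar>u s\<bar>" by auto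
  show ?thesis using self[OF s(1,2) s(3)] s(3)[OF t] by simp
qed

lemma abs_cos_sin_le: "\<bar>c * cos t + d * sin t\<bar> \<le> \<bar>c\<bar> + \<bar>d\<bar>" for c d t :: real
proof -
  have "\<bar>c * cos t\<bar> \<le> \<bar>c\<bar>" "\<bar>d * sin t\<bar> \<le> \<bar>d\<bar>"
    by (auto simp: abs_mult intro!: mult_right_le_one_le)
  then show ?thesis by linarith
qed

lemma abs_diff_le_dist: "\<bar>fst p - fst p'\<bar> \<le> dist p p'" "\<bar>snd p - snd p'\<bar> \<le> dist p p'"
  for p p' :: "real \<times> real"
  using abs_fst_le_norm[of "p - p'"] abs_snd_le_norm[of "p - p'"] by (auto simp: dist_norm)

lemma dist_components_le:
  "\<bar>fst (fst q) - fst (fst q')\<bar> \<le> dist q q'" "\<bar>snd (fst q) - snd (fst q')\<bar> \<le> dist q q'"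
  "\<bar>fst (snd q) - fst (snd q')\<bar> \<le> dist q q'" "\<bar>snd (snd q) - snd (snd q')\<bar> \<le> dist q q'"
  for q q' :: "(real \<times> real) \<times> (real \<times> real)"
  using dist_fst_le[of q q'] dist_snd_le[of q q']
    dist_fst_le[of "fst q" "fst q'"] dist_snd_le[of "fst q" "fst q'"]
    dist_fst_le[of "snd q" "snd q'"] dist_snd_le[of "snd q" "snd q'"]
  by (auto simp: dist_real_def)

text \<open>
  A box of parameters on which the Volterra operator \<open>x \<mapsto> \<epsilon> r\<close> is a contraction with constant \<open>1/2\<close> in the
  supremum norm on \<open>[0, 2\<pi>]\<close>.
\<close>

locale oscillator_box = lipschitz_oscillator +
  fixes A e :: real
  assumes A: "1 \<le> A" and e: "0 < e" "e \<le> 1" and e_small: "4 * pi * e * (A + (1 + A) * C) \<le> 1"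
begin

definition box :: "real \<times> real \<Rightarrow> real \<times> real \<Rightarrow> bool" where
  "box p y \<longleftrightarrow> \<bar>fst p\<bar> \<le> A \<and> \<bar>snd p\<bar> \<le> e \<and> \<bar>fst y\<bar> \<le> A \<and> \<bar>snd y\<bar> \<le> A"

text \<open>
  A Lipschitz constant of \<open>\<phi>\<close> in its first argument, for all parameters in the box.
\<close>

definition lip_const where "lip_const = A + (1 + A) * C"

lemma lip_const_nonneg: "0 \<le> lip_const" using A C_nonneg by (simp add: lip_const_def)

lemma small_\<epsilon>: "\<bar>\<epsilon>\<bar> \<le> e \<Longrightarrow> 2 * pi * (\<bar>\<epsilon>\<bar> * lip_const) \<le> 1 / 2"
proof -
  assume "\<bar>\<epsilon>\<bar> \<le> e"
  then have "4 * pi * (\<bar>\<epsilon>\<bar> * lip_const) \<le> 4 * pi * (e * lip_const)"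
    using lip_const_nonneg by (intro mult_left_mono mult_right_mono) auto
  then show ?thesis using e_small by (simp add: lip_const_def algebra_simps)
qed

lemma abs_one_minus_le: "box p y \<Longrightarrow> \<bar>1 - snd p * fst y\<bar> \<le> 1 + A"
proof -
  assume b: "box p y"
  have "\<bar>snd p * fst y\<bar> \<le> 1 * A"
    unfolding abs_mult using b e A by (intro mult_mono) (auto simp: box_def)
  then show ?thesis by (simp add: abs_if split: if_splits)
qed

lemma \<phi>_lip_box: "box p y \<Longrightarrow> \<bar>\<phi> u (fst y) (snd p) - \<phi> v (fst y) (snd p)\<bar> \<le> lip_const * \<bar>u - v\<bar>"
proof -
  assume b: "box p y"
  have "\<bar>fst y\<bar> + \<bar>1 - snd p * fst y\<bar> * C \<le> lip_const"
    unfolding lip_const_def using b abs_one_minus_le[OF b] C_nonneg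
    by (intro add_mono mult_right_mono) (auto simp: box_def)
  then show ?thesis
    using \<phi>_lip[of u "fst y" "snd p" v] mult_right_mono[of _ lip_const "\<bar>u - v\<bar>"] by fastforce
qed

text \<open>
  A bound for all solutions on \<open>[0, 2\<pi>]\<close>: twice the bound of the Volterra right-hand side at \<open>x = 0\<close>.
\<close>

definition sol_sup where "sol_sup = 2 * (2 * A + 2 * pi * ((1 + A) * \<bar>g 0\<bar>))"

lemma sol_sup_nonneg: "0 \<le> sol_sup"
  using A by (simp add: sol_sup_def)

lemma sol_bounded:
  assumes "box p y" "0 \<le> t" "t \<le> 2*pi"
  shows "\<bar>sol \<phi> p y t\<bar> \<le> sol_sup"
proof -
  define \<Phi> where "\<Phi> = (1 + A) * \<bar>g 0\<bar>"
  define c where "c = 2 * A + 2 * pi * \<Phi>"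
  have \<Phi>0: "0 \<le> \<Phi>" using A by (simp add: \<Phi>_def)
  have "\<bar>sol \<phi> p y t\<bar> \<le> 2 * c" if b: "box p y" and t: "0 \<le> t" "t \<le> 2*pi" for p y t
  proof (rule self_bound[OF continuous_on_sol _ t])
    fix t M assume t: "0 \<le> t" "t \<le> 2*pi" and M: "\<And>s. \<lbrakk>0 \<le> s; s \<le> 2*pi\<rbrakk> \<Longrightarrow> \<bar>sol \<phi> p y s\<bar> \<le> M"
    have M0: "0 \<le> M" using M[of 0] by auto
    define f where "f s = snd p * \<phi> (sol \<phi> p y s) (fst y) (snd p)" for s
    have "\<bar>integral {0..t} (\<lambda>s. sin (t - s) * f s)\<bar> \<le> 2 * pi * (\<bar>snd p\<bar> * (\<Phi> + lip_const * M))"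
    proof (rule volterra_kernel_bound[OF _ _ t])
      show "continuous_on UNIV f" unfolding f_def by (intro continuous_intros)
      fix s assume s: "0 \<le> s" "s \<le> 2*pi"
      have "\<phi> 0 (fst y) (snd p) = (1 - snd p * fst y) * g 0" by (simp add: nonlin_def)
      then have "\<bar>\<phi> 0 (fst y) (snd p)\<bar> \<le> \<Phi>"
        using abs_one_minus_le[OF b] by (auto simp: abs_mult \<Phi>_def intro: mult_right_mono)
      moreover have "lip_const * \<bar>sol \<phi> p y s - 0\<bar> \<le> lip_const * M"
        using M[OF s] lip_const_nonneg by (intro mult_left_mono) auto
      ultimately have "\<bar>\<phi> (sol \<phi> p y s) (fst y) (snd p)\<bar> \<le> \<Phi> + lip_const * M"
        using \<phi>_lip_box[OF b, of "sol \<phi> p y s" 0] by linarith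
      then show "\<bar>f s\<bar> \<le> \<bar>snd p\<bar> * (\<Phi> + lip_const * M)" by (simp add: f_def abs_mult mult_left_mono)
    qed
    also have "\<dots> \<le> 2 * pi * \<Phi> + M / 2"
    proof -
      have "2 * pi * (\<bar>snd p\<bar> * lip_const) * M \<le> 1 / 2 * M"
        using b small_\<epsilon> M0 by (intro mult_right_mono) (auto simp: box_def)
      moreover have "\<bar>snd p\<bar> * \<Phi> \<le> 1 * \<Phi>" using b e \<Phi>0 by (intro mult_right_mono) (auto simp: box_def)
      then have "2 * pi * (\<bar>snd p\<bar> * \<Phi>) \<le> 2 * pi * \<Phi>" by simp
      moreover have "2 * pi * (\<bar>snd p\<bar> * (\<Phi> + lip_const * M)) = 2 * pi * (\<bar>snd p\<bar> * \<Phi>) + 2 * pi * (\<bar>snd p\<bar> * lip_const) * M"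
        by (simp add: algebra_simps)
      ultimately show ?thesis by linarith
    qed
    finally have "\<bar>integral {0..t} (\<lambda>s. sin (t - s) * f s)\<bar> \<le> 2 * pi * \<Phi> + M / 2" .
    moreover have "sol \<phi> p y t = fst p * cos t + snd y * sin t - integral {0..t} (\<lambda>s. sin (t - s) * f s)"
      using sol_eq_integral[OF t(1), of "fst p" "snd p" "fst y" "snd y"] by (simp add: f_def)
    ultimately show "\<bar>sol \<phi> p y t\<bar> \<le> c + M / 2"
      using abs_cos_sin_le[of "fst p" t "snd y"] b unfolding c_def box_def by linarith
  qed
  from this[OF assms] show ?thesis by (simp add: sol_sup_def c_def \<Phi>_def)
qed

lemma g_bound: "\<bar>u\<bar> \<le> B \<Longrightarrow> \<bar>g u\<bar> \<le> \<bar>g 0\<bar> + C * B"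
proof -
  assume "\<bar>u\<bar> \<le> B"
  then have "C * \<bar>u - 0\<bar> \<le> C * B" using C_nonneg by (intro mult_left_mono) auto
  then show ?thesis using g_lip[of u 0] by linarith
qed

lemma abs_\<epsilon>\<eta>_diff_le:
  assumes "box p y"
  shows "\<bar>snd p * fst y - snd p' * fst y'\<bar> \<le> A * \<bar>snd p - snd p'\<bar> + \<bar>snd p'\<bar> * \<bar>fst y - fst y'\<bar>"
proof -
  have "snd p * fst y - snd p' * fst y' = fst y * (snd p - snd p') + snd p' * (fst y - fst y')"
    by (simp add: algebra_simps)
  then have "\<bar>snd p * fst y - snd p' * fst y'\<bar>
      \<le> \<bar>fst y\<bar> * \<bar>snd p - snd p'\<bar> + \<bar>snd p'\<bar> * \<bar>fst y - fst y'\<bar>"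
    by (metis abs_mult abs_triangle_ineq)
  moreover have "\<bar>fst y\<bar> * \<bar>snd p - snd p'\<bar> \<le> A * \<bar>snd p - snd p'\<bar>"
    using assms by (intro mult_right_mono) (auto simp: box_def)
  ultimately show ?thesis by linarith
qed

definition g_sup where "g_sup = \<bar>g 0\<bar> + C * sol_sup"
definition param_const where "param_const = A * sol_sup + (1 + A) * g_sup + sol_sup + A * g_sup"

lemma g_sup_nonneg: "0 \<le> g_sup" and param_const_nonneg: "0 \<le> param_const"
  using A C_nonneg sol_sup_nonneg by (auto simp: g_sup_def param_const_def)

text \<open>
  In the last estimate \<open>\<eta>\<close> enters with the factor \<open>\<epsilon>\<close>. This is the origin of the weak dependence of
  \<open>F - H\<close> on \<open>\<eta>\<close>.
\<close>

lemma \<phi>_param_diff: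
  assumes b: "box p y" "box p' y'" and u: "\<bar>u\<bar> \<le> sol_sup"
  shows "\<bar>\<phi> u (fst y) (snd p)\<bar> \<le> param_const"
    and "\<bar>\<phi> u (fst y) (snd p) - \<phi> u (fst y') (snd p')\<bar> \<le> param_const * (\<bar>snd p - snd p'\<bar> + \<bar>fst y - fst y'\<bar>)"
    and "\<bar>snd p * \<phi> u (fst y) (snd p) - snd p' * \<phi> u (fst y') (snd p')\<bar>
        \<le> param_const * (\<bar>snd p - snd p'\<bar> + \<bar>snd p'\<bar> * \<bar>fst y - fst y'\<bar>)"
proof -
  note sol_sup = sol_sup_nonneg
  define K where "K = A * sol_sup + (1 + A) * g_sup"
  have param_const: "param_const = K + sol_sup + A * g_sup" by (simp add: param_const_def K_def)
  have G0: "0 \<le> g_sup" and K0: "0 \<le> K" using A C_nonneg sol_sup by (auto simp: g_sup_def K_def)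
  have bd: "\<bar>\<phi> u (fst y) (snd p)\<bar> \<le> K"
  proof -
    have "\<bar>\<phi> u (fst y) (snd p)\<bar> \<le> \<bar>fst y\<bar> * \<bar>u\<bar> + \<bar>1 - snd p * fst y\<bar> * \<bar>g u\<bar>"
      unfolding nonlin_def
      using abs_triangle_ineq[of "- fst y * u" "(1 - snd p * fst y) * g u"] by (simp add: abs_mult)
    also have "\<dots> \<le> K"
      unfolding K_def using b u abs_one_minus_le[OF b(1)] g_bound[OF u] A
      by (intro add_mono mult_mono) (auto simp: box_def g_sup_def)
    finally show ?thesis .
  qed
  have d: "\<bar>\<phi> u (fst y) (snd p) - \<phi> u (fst y') (snd p')\<bar> \<le> sol_sup * \<bar>fst y - fst y'\<bar> + g_sup * (A * \<bar>snd p - snd p'\<bar> + \<bar>snd p'\<bar> * \<bar>fst y - fst y'\<bar>)"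
  proof -
    have "\<phi> u (fst y) (snd p) - \<phi> u (fst y') (snd p') = - u * (fst y - fst y') - g u * (snd p * fst y - snd p' * fst y')"
      by (simp add: nonlin_def algebra_simps)
    then have "\<bar>\<phi> u (fst y) (snd p) - \<phi> u (fst y') (snd p')\<bar>
        \<le> \<bar>u\<bar> * \<bar>fst y - fst y'\<bar> + \<bar>g u\<bar> * \<bar>snd p * fst y - snd p' * fst y'\<bar>"
      using abs_triangle_ineq4[of "- u * (fst y - fst y')" "g u * (snd p * fst y - snd p' * fst y')"]
      by (simp only: abs_mult abs_minus_cancel)
    also have "\<dots> \<le> sol_sup * \<bar>fst y - fst y'\<bar> + g_sup * (A * \<bar>snd p - snd p'\<bar> + \<bar>snd p'\<bar> * \<bar>fst y - fst y'\<bar>)"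
      using u g_bound[OF u] abs_\<epsilon>\<eta>_diff_le[OF b(1)] G0 by (intro add_mono mult_mono) (auto simp: g_sup_def)
    finally show ?thesis .
  qed
  show "\<bar>\<phi> u (fst y) (snd p)\<bar> \<le> param_const"
    using bd A G0 sol_sup mult_nonneg_nonneg[of A g_sup] unfolding param_const by linarith
  have e1: "\<bar>snd p'\<bar> \<le> 1" using b e by (auto simp: box_def)
  have "\<bar>snd p'\<bar> * \<bar>fst y - fst y'\<bar> \<le> A * \<bar>fst y - fst y'\<bar>"
    using e1 A by (intro mult_right_mono) auto
  then have "g_sup * (A * \<bar>snd p - snd p'\<bar> + \<bar>snd p'\<bar> * \<bar>fst y - fst y'\<bar>) \<le> g_sup * (A * (\<bar>snd p - snd p'\<bar> + \<bar>fst y - fst y'\<bar>))"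
    using G0 by (intro mult_left_mono) (auto simp: algebra_simps)
  then have "\<bar>\<phi> u (fst y) (snd p) - \<phi> u (fst y') (snd p')\<bar>
      \<le> sol_sup * \<bar>fst y - fst y'\<bar> + A * g_sup * (\<bar>snd p - snd p'\<bar> + \<bar>fst y - fst y'\<bar>)"
    using d by (simp add: algebra_simps)
  moreover have "0 \<le> K * (\<bar>snd p - snd p'\<bar> + \<bar>fst y - fst y'\<bar>)" "0 \<le> sol_sup * \<bar>snd p - snd p'\<bar>"
    using K0 sol_sup by auto
  ultimately show "\<bar>\<phi> u (fst y) (snd p) - \<phi> u (fst y') (snd p')\<bar> \<le> param_const * (\<bar>snd p - snd p'\<bar> + \<bar>fst y - fst y'\<bar>)"
    by (simp add: param_const algebra_simps)
  have "\<bar>snd p * \<phi> u (fst y) (snd p) - snd p' * \<phi> u (fst y') (snd p')\<bar>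
      \<le> \<bar>snd p'\<bar> * \<bar>\<phi> u (fst y) (snd p) - \<phi> u (fst y') (snd p')\<bar> + \<bar>\<phi> u (fst y) (snd p)\<bar> * \<bar>snd p - snd p'\<bar>"
  proof -
    have "snd p * \<phi> u (fst y) (snd p) - snd p' * \<phi> u (fst y') (snd p')
      = snd p' * (\<phi> u (fst y) (snd p) - \<phi> u (fst y') (snd p')) + \<phi> u (fst y) (snd p) * (snd p - snd p')"
      by (simp add: algebra_simps)
    then show ?thesis by (metis abs_mult abs_triangle_ineq)
  qed
  also have "\<dots> \<le> (sol_sup * (\<bar>snd p'\<bar> * \<bar>fst y - fst y'\<bar>) + g_sup * (A * \<bar>snd p - snd p'\<bar> + \<bar>snd p'\<bar> * \<bar>fst y - fst y'\<bar>))
      + K * \<bar>snd p - snd p'\<bar>"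
  proof (intro add_mono mult_right_mono bd)
    let ?B = "A * \<bar>snd p - snd p'\<bar> + \<bar>snd p'\<bar> * \<bar>fst y - fst y'\<bar>"
    have "\<bar>snd p'\<bar> * \<bar>\<phi> u (fst y) (snd p) - \<phi> u (fst y') (snd p')\<bar>
        \<le> \<bar>snd p'\<bar> * (sol_sup * \<bar>fst y - fst y'\<bar> + g_sup * ?B)"
      by (intro mult_left_mono d) auto
    also have "\<dots> \<le> sol_sup * (\<bar>snd p'\<bar> * \<bar>fst y - fst y'\<bar>) + g_sup * ?B"
    proof -
      have "\<bar>snd p'\<bar> * (g_sup * ?B) \<le> g_sup * ?B"
        using e1 G0 A by (intro mult_left_le_one_le) auto
      then show ?thesis by (simp add: algebra_simps)
    qed
    finally show "\<bar>snd p'\<bar> * \<bar>\<phi> u (fst y) (snd p) - \<phi> u (fst y') (snd p')\<bar>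
        \<le> sol_sup * (\<bar>snd p'\<bar> * \<bar>fst y - fst y'\<bar>) + g_sup * ?B" .
  qed auto
  also have "\<dots> \<le> param_const * (\<bar>snd p - snd p'\<bar> + \<bar>snd p'\<bar> * \<bar>fst y - fst y'\<bar>)"
  proof -
    have "1 * (g_sup * (\<bar>snd p'\<bar> * \<bar>fst y - fst y'\<bar>)) \<le> A * (g_sup * (\<bar>snd p'\<bar> * \<bar>fst y - fst y'\<bar>))"
      using A G0 by (intro mult_right_mono) auto
    moreover have "0 \<le> K * (\<bar>snd p'\<bar> * \<bar>fst y - fst y'\<bar>)" "0 \<le> sol_sup * \<bar>snd p - snd p'\<bar>" using K0 sol_sup by auto
    ultimately show ?thesis by (simp add: param_const algebra_simps)
  qed
  finally show "\<bar>snd p * \<phi> u (fst y) (snd p) - snd p' * \<phi> u (fst y') (snd p')\<bar>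
      \<le> param_const * (\<bar>snd p - snd p'\<bar> + \<bar>snd p'\<bar> * \<bar>fst y - fst y'\<bar>)" .
qed

definition flow_const where "flow_const = 2 + 4 * pi * param_const + 4 * pi * lip_const + (1 + 4 * pi * lip_const) * (4 * pi * param_const)"

lemma flow_const_nonneg: "0 \<le> flow_const"
  using lip_const_nonneg param_const_nonneg by (simp add: flow_const_def)

text \<open>
  Both bounds come from the Volterra equation for the difference of two solutions. The second one says that the
  difference is harmonic up to terms with a factor \<open>\<epsilon>\<close>, except for the change of \<open>\<epsilon>\<close> itself.
\<close>

lemma sol_diff:
  assumes b: "box p y" "box p' y'" and t: "0 \<le> t" "t \<le> 2*pi"
  shows "\<bar>sol \<phi> p y t - sol \<phi> p' y' t\<bar> \<le> flow_const * (\<bar>fst p - fst p'\<bar> + \<bar>snd y - snd y'\<bar>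
        + \<bar>snd p - snd p'\<bar> + \<bar>snd p'\<bar> * \<bar>fst y - fst y'\<bar>)"
    and "\<bar>(sol \<phi> p y t - sol \<phi> p' y' t) - ((fst p - fst p') * cos t + (snd y - snd y') * sin t)\<bar>
        \<le> flow_const * (\<bar>snd p - snd p'\<bar> + \<bar>snd p'\<bar> * \<bar>fst y - fst y'\<bar>
            + \<bar>snd p\<bar> * (\<bar>fst p - fst p'\<bar> + \<bar>snd y - snd y'\<bar>))"
proof -
  define N where "N = \<bar>fst p - fst p'\<bar> + \<bar>snd y - snd y'\<bar>"
  define D where "D = \<bar>snd p - snd p'\<bar> + \<bar>snd p'\<bar> * \<bar>fst y - fst y'\<bar>"
  have ND: "0 \<le> N" "0 \<le> D" by (auto simp: N_def D_def)
  let ?x = "sol \<phi> p y" and ?x' = "sol \<phi> p' y'"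
  define f where "f s = snd p * \<phi> (?x s) (fst y) (snd p) - snd p' * \<phi> (?x' s) (fst y') (snd p')" for s
  have cont: "continuous_on UNIV f" unfolding f_def by (intro continuous_intros)
  have rep: "(?x t - ?x' t) - ((fst p - fst p') * cos t + (snd y - snd y') * sin t)
      = - integral {0..t} (\<lambda>s. sin (t - s) * f s)" if t: "0 \<le> t" for t
  proof -
    have "integral {0..t} (\<lambda>s. sin (t - s) * f s)
        = integral {0..t} (\<lambda>s. sin (t - s) * (snd p * \<phi> (?x s) (fst y) (snd p)))
        - integral {0..t} (\<lambda>s. sin (t - s) * (snd p' * \<phi> (?x' s) (fst y') (snd p')))"
      unfolding f_def right_diff_distrib
      by (rule integral_diff) (auto intro!: integrable_continuous_interval continuous_intros)
    then show ?thesis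
      using sol_eq_integral[OF t, of "fst p" "snd p" "fst y" "snd y"]
        sol_eq_integral[OF t, of "fst p'" "snd p'" "fst y'" "snd y'"] by (simp add: algebra_simps)
  qed
  have f_le: "\<bar>f s\<bar> \<le> \<bar>snd p\<bar> * (lip_const * M) + param_const * D"
    if s: "0 \<le> s" "s \<le> 2*pi" and M: "\<bar>?x s - ?x' s\<bar> \<le> M" for s M
  proof -
    have "f s = snd p * (\<phi> (?x s) (fst y) (snd p) - \<phi> (?x' s) (fst y) (snd p))
        + (snd p * \<phi> (?x' s) (fst y) (snd p) - snd p' * \<phi> (?x' s) (fst y') (snd p'))"
      by (simp add: f_def algebra_simps)
    then have "\<bar>f s\<bar> \<le> \<bar>snd p\<bar> * \<bar>\<phi> (?x s) (fst y) (snd p) - \<phi> (?x' s) (fst y) (snd p)\<bar>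
        + \<bar>snd p * \<phi> (?x' s) (fst y) (snd p) - snd p' * \<phi> (?x' s) (fst y') (snd p')\<bar>"
      using abs_triangle_ineq[of "snd p * (\<phi> (?x s) (fst y) (snd p) - \<phi> (?x' s) (fst y) (snd p))"]
      by (simp only: abs_mult)
    also have "\<dots> \<le> \<bar>snd p\<bar> * (lip_const * M) + param_const * D"
      unfolding D_def
      using M lip_const_nonneg
      by (intro add_mono mult_left_mono \<phi>_param_diff(3)[OF b sol_bounded[OF b(2) s]] order_trans[OF \<phi>_lip_box[OF b(1)]]) auto
    finally show ?thesis .
  qed
  have bound: "\<bar>(?x t - ?x' t) - ((fst p - fst p') * cos t + (snd y - snd y') * sin t)\<bar>
      \<le> 2 * pi * (\<bar>snd p\<bar> * (lip_const * M) + param_const * D)"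
    if t: "0 \<le> t" "t \<le> 2*pi" and M: "\<And>s. \<lbrakk>0 \<le> s; s \<le> 2*pi\<rbrakk> \<Longrightarrow> \<bar>?x s - ?x' s\<bar> \<le> M" for t M
    unfolding rep[OF t(1)] abs_minus_cancel
    by (rule volterra_kernel_bound[OF cont _ t]) (rule f_le, assumption+, rule M)
  have x: "\<bar>?x t - ?x' t\<bar> \<le> 2 * (N + 2 * pi * (param_const * D))" if t: "0 \<le> t" "t \<le> 2*pi" for t
  proof (rule self_bound[of "\<lambda>t. ?x t - ?x' t", OF _ _ t])
    show "continuous_on UNIV (\<lambda>t. ?x t - ?x' t)" by (intro continuous_intros)
    fix t M assume t: "0 \<le> t" "t \<le> 2*pi" and M: "\<And>s. \<lbrakk>0 \<le> s; s \<le> 2*pi\<rbrakk> \<Longrightarrow> \<bar>?x s - ?x' s\<bar> \<le> M"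
    have M0: "0 \<le> M" using M[of 0] by auto
    have "2 * pi * (\<bar>snd p\<bar> * lip_const) * M \<le> 1 / 2 * M"
      using b small_\<epsilon> M0 by (intro mult_right_mono) (auto simp: box_def)
    then show "\<bar>?x t - ?x' t\<bar> \<le> N + 2 * pi * (param_const * D) + M / 2"
      using bound[OF t M] abs_cos_sin_le[of "fst p - fst p'" t "snd y - snd y'"]
      unfolding N_def by (simp add: algebra_simps)
  qed
  have pos: "0 \<le> pi * lip_const" "0 \<le> pi * param_const" "0 \<le> pi * lip_const * (pi * param_const)" using lip_const_nonneg param_const_nonneg by auto
  have "flow_const = 2 + 8 * (pi * param_const) + 4 * (pi * lip_const) + 16 * (pi * lip_const * (pi * param_const))"
    by (simp add: flow_const_def algebra_simps)
  then have flow_const: "2 \<le> flow_const" "4 * pi * param_const \<le> flow_const" "4 * pi * lip_const \<le> flow_const" "8 * pi * lip_const * (pi * param_const) + 2 * pi * param_const \<le> flow_const"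
    using pos by linarith+
  have "\<bar>sol \<phi> p y t - sol \<phi> p' y' t\<bar> \<le> 2 * N + 4 * pi * param_const * D"
    using x[OF t] by (simp add: algebra_simps)
  also have "\<dots> \<le> flow_const * N + flow_const * D" using flow_const ND by (intro add_mono mult_right_mono)
  finally show "\<bar>sol \<phi> p y t - sol \<phi> p' y' t\<bar> \<le> flow_const * (\<bar>fst p - fst p'\<bar> + \<bar>snd y - snd y'\<bar>
      + \<bar>snd p - snd p'\<bar> + \<bar>snd p'\<bar> * \<bar>fst y - fst y'\<bar>)"
    by (simp add: N_def D_def distrib_left)
  have "\<bar>(sol \<phi> p y t - sol \<phi> p' y' t) - ((fst p - fst p') * cos t + (snd y - snd y') * sin t)\<bar>
      \<le> 2 * pi * (\<bar>snd p\<bar> * (lip_const * (2 * (N + 2 * pi * (param_const * D)))) + param_const * D)"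
    by (rule bound[OF t x])
  also have "\<dots> = 4 * pi * lip_const * (\<bar>snd p\<bar> * N) + \<bar>snd p\<bar> * (8 * pi * lip_const * (pi * param_const) * D) + 2 * pi * param_const * D"
    by (simp add: algebra_simps)
  also have "\<dots> \<le> flow_const * (\<bar>snd p\<bar> * N) + 8 * pi * lip_const * (pi * param_const) * D + 2 * pi * param_const * D"
  proof (intro add_mono order_refl)
    show "4 * pi * lip_const * (\<bar>snd p\<bar> * N) \<le> flow_const * (\<bar>snd p\<bar> * N)"
      using ND by (intro mult_right_mono flow_const) simp
    have "0 \<le> 8 * pi * lip_const * (pi * param_const) * D" using lip_const_nonneg param_const_nonneg ND by simp
    moreover have "\<bar>snd p\<bar> \<le> 1" using b(1) e(2) unfolding box_def by linarith
    ultimately show "\<bar>snd p\<bar> * (8 * pi * lip_const * (pi * param_const) * D) \<le> 8 * pi * lip_const * (pi * param_const) * D"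
      by (intro mult_left_le_one_le) auto
  qed
  also have "\<dots> \<le> flow_const * (\<bar>snd p\<bar> * N) + flow_const * D"
    using mult_right_mono[OF flow_const(4) ND(2)] by (simp add: distrib_right)
  finally show "\<bar>(sol \<phi> p y t - sol \<phi> p' y' t) - ((fst p - fst p') * cos t + (snd y - snd y') * sin t)\<bar>
      \<le> flow_const * (\<bar>snd p - snd p'\<bar> + \<bar>snd p'\<bar> * \<bar>fst y - fst y'\<bar>
          + \<bar>snd p\<bar> * (\<bar>fst p - fst p'\<bar> + \<bar>snd y - snd y'\<bar>))"
    by (simp add: N_def D_def distrib_left)
qed

definition F_const where "F_const = lip_const * flow_const + param_const"

lemma F_const_nonneg: "0 \<le> F_const"
  using lip_const_nonneg param_const_nonneg flow_const_nonneg by (simp add: F_const_def)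

lemma \<phi>_sol_diff:
  assumes b: "box p y" "box p' y'" and t: "0 \<le> t" "t \<le> 2*pi"
  shows "\<bar>\<phi> (sol \<phi> p y t) (fst y) (snd p) - \<phi> (sol \<phi> p' y' t) (fst y') (snd p')\<bar>
    \<le> F_const * (\<bar>fst p - fst p'\<bar> + \<bar>snd y - snd y'\<bar> + \<bar>snd p - snd p'\<bar> + \<bar>fst y - fst y'\<bar>)"
proof -
  let ?x = "sol \<phi> p y t" and ?x' = "sol \<phi> p' y' t"
  define N where "N = \<bar>fst p - fst p'\<bar> + \<bar>snd y - snd y'\<bar>"
  have N0: "0 \<le> N" by (simp add: N_def)
  have "\<bar>snd p'\<bar> \<le> 1" using b(2) e(2) unfolding box_def by linarith
  then have e1: "\<bar>snd p'\<bar> * \<bar>fst y - fst y'\<bar> \<le> \<bar>fst y - fst y'\<bar>" by (intro mult_left_le_one_le) auto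
  have "\<bar>\<phi> ?x (fst y) (snd p) - \<phi> ?x' (fst y) (snd p)\<bar> \<le> lip_const * \<bar>?x - ?x'\<bar>"
    by (rule \<phi>_lip_box[OF b(1)])
  also have "\<dots> \<le> lip_const * (flow_const * (N + \<bar>snd p - snd p'\<bar> + \<bar>fst y - fst y'\<bar>))"
  proof (rule mult_left_mono[OF _ lip_const_nonneg])
    have "\<bar>?x - ?x'\<bar> \<le> flow_const * (N + \<bar>snd p - snd p'\<bar> + \<bar>snd p'\<bar> * \<bar>fst y - fst y'\<bar>)"
      using sol_diff(1)[OF b t] by (simp only: N_def add.assoc)
    also have "\<dots> \<le> flow_const * (N + \<bar>snd p - snd p'\<bar> + \<bar>fst y - fst y'\<bar>)"
      using e1 by (intro mult_left_mono flow_const_nonneg) linarith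
    finally show "\<bar>?x - ?x'\<bar> \<le> flow_const * (N + \<bar>snd p - snd p'\<bar> + \<bar>fst y - fst y'\<bar>)" .
  qed
  finally have "\<bar>\<phi> ?x (fst y) (snd p) - \<phi> ?x' (fst y) (snd p)\<bar>
      \<le> lip_const * flow_const * (N + \<bar>snd p - snd p'\<bar> + \<bar>fst y - fst y'\<bar>)" by (simp only: mult.assoc)
  moreover have "\<bar>\<phi> ?x' (fst y) (snd p) - \<phi> ?x' (fst y') (snd p')\<bar>
      \<le> param_const * (\<bar>snd p - snd p'\<bar> + \<bar>fst y - fst y'\<bar>)"
    by (rule \<phi>_param_diff(2)[OF b sol_bounded[OF b(2) t]])
  moreover have "param_const * (\<bar>snd p - snd p'\<bar> + \<bar>fst y - fst y'\<bar>) \<le> param_const * (N + \<bar>snd p - snd p'\<bar> + \<bar>fst y - fst y'\<bar>)"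
    using N0 by (intro mult_left_mono param_const_nonneg) linarith
  ultimately have "\<bar>\<phi> ?x (fst y) (snd p) - \<phi> ?x' (fst y') (snd p')\<bar>
      \<le> lip_const * flow_const * (N + \<bar>snd p - snd p'\<bar> + \<bar>fst y - fst y'\<bar>) + param_const * (N + \<bar>snd p - snd p'\<bar> + \<bar>fst y - fst y'\<bar>)"
    by linarith
  then show ?thesis by (simp only: F_const_def N_def distrib_right)
qed

lemma F_diff:
  assumes b: "box p y" "box p' y'"
  shows "norm (F g p y - F g p' y')
    \<le> 4 * pi * (F_const * (\<bar>fst p - fst p'\<bar> + \<bar>snd y - snd y'\<bar> + \<bar>snd p - snd p'\<bar> + \<bar>fst y - fst y'\<bar>))"
proof -
  have "F g p y - F g p' y'
    = moments (\<lambda>t. \<phi> (sol \<phi> p y t) (fst y) (snd p) - \<phi> (sol \<phi> p' y' t) (fst y') (snd p'))"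
    unfolding F_eq_moments by (rule moments_diff) (intro continuous_intros)+
  then show ?thesis
    by (simp only:) (rule norm_moments_le, intro continuous_intros, rule \<phi>_sol_diff[OF b])
qed

lemma F_bound:
  assumes "box p y"
  shows "norm (F g p y) \<le> 4 * pi * param_const"
  unfolding F_eq_moments
  by (rule norm_moments_le, intro continuous_intros)
     (rule \<phi>_param_diff(1)[OF assms assms sol_bounded[OF assms]])

lemma sol_near_harmonic:
  assumes b: "box p y" and t: "0 \<le> t" "t \<le> 2*pi"
  shows "\<bar>sol \<phi> p y t - (fst p * cos t + snd y * sin t)\<bar> \<le> flow_const * (1 + 2 * A) * \<bar>snd p\<bar>"
proof -
  have z: "box (0, 0) (0, 0)" using A e by (simp add: box_def)
  have "sol \<phi> (0, 0) (0, 0) t = 0" using sol_eq_integral[OF t(1), of 0 0 0 0] by simp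
  then have "\<bar>sol \<phi> p y t - (fst p * cos t + snd y * sin t)\<bar>
      \<le> flow_const * (\<bar>snd p\<bar> + \<bar>snd p\<bar> * (\<bar>fst p\<bar> + \<bar>snd y\<bar>))"
    using sol_diff(2)[OF b z t] by simp
  also have "\<dots> \<le> flow_const * (\<bar>snd p\<bar> + \<bar>snd p\<bar> * (2 * A))"
    using b flow_const_nonneg by (intro mult_left_mono add_left_mono) (auto simp: box_def)
  finally show ?thesis by (simp add: algebra_simps)
qed

text \<open>
  The solution contains its remainder with the factor \<open>\<epsilon>\<close>, so replacing the remainder by the one at
  \<open>\<epsilon> = 0\<close> costs \<open>\<epsilon>\<close> times the distance of the parameters.
\<close>

lemma expansion_error:
  assumes b: "box (a, \<epsilon>) (\<eta>, b)" "box (a, 0) (\<eta>', 0)" and t: "0 \<le> t" "t \<le> 2*pi"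
  shows "\<bar>sol \<phi> (a, \<epsilon>) (\<eta>, b) t - a * cos t - b * sin t + \<epsilon> * rem \<phi> t (a, 0) (\<eta>', 0)\<bar>
    \<le> \<bar>\<epsilon>\<bar> * (2 * pi * (F_const * (\<bar>b\<bar> + \<bar>\<epsilon>\<bar> + \<bar>\<eta> - \<eta>'\<bar>)))"
proof -
  let ?f = "\<lambda>s. \<phi> (sol \<phi> (a, \<epsilon>) (\<eta>, b) s) \<eta> \<epsilon>" and ?f' = "\<lambda>s. \<phi> (sol \<phi> (a, 0) (\<eta>', 0) s) \<eta>' 0"
  have "rem \<phi> t (a, \<epsilon>) (\<eta>, b) = integral {0..t} (\<lambda>s. sin (t - s) * ?f s)"
    "rem \<phi> t (a, 0) (\<eta>', 0) = integral {0..t} (\<lambda>s. sin (t - s) * ?f' s)"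
    unfolding rem_def by (subst LBINT_eq_integral; auto intro!: continuous_intros t)+
  then have "rem \<phi> t (a, \<epsilon>) (\<eta>, b) - rem \<phi> t (a, 0) (\<eta>', 0) = integral {0..t} (\<lambda>s. sin (t - s) * (?f s - ?f' s))"
    unfolding right_diff_distrib
    by (subst integral_diff) (auto intro!: integrable_continuous_interval continuous_intros)
  moreover have "\<bar>integral {0..t} (\<lambda>s. sin (t - s) * (?f s - ?f' s))\<bar> \<le> 2 * pi * (F_const * (\<bar>b\<bar> + \<bar>\<epsilon>\<bar> + \<bar>\<eta> - \<eta>'\<bar>))"
  proof (rule volterra_kernel_bound[OF _ _ t])
    show "continuous_on UNIV (\<lambda>s. ?f s - ?f' s)" by (intro continuous_intros)
    show "\<bar>?f s - ?f' s\<bar> \<le> F_const * (\<bar>b\<bar> + \<bar>\<epsilon>\<bar> + \<bar>\<eta> - \<eta>'\<bar>)" if "0 \<le> s" "s \<le> 2*pi" for s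
      using \<phi>_sol_diff[OF b that] by simp
  qed
  ultimately have r: "\<bar>rem \<phi> t (a, \<epsilon>) (\<eta>, b) - rem \<phi> t (a, 0) (\<eta>', 0)\<bar> \<le> 2 * pi * (F_const * (\<bar>b\<bar> + \<bar>\<epsilon>\<bar> + \<bar>\<eta> - \<eta>'\<bar>))"
    by simp
  have "sol \<phi> (a, \<epsilon>) (\<eta>, b) t = a * cos t + b * sin t - \<epsilon> * rem \<phi> t (a, \<epsilon>) (\<eta>, b)"
    by (rule sol_representation[of a \<epsilon> \<eta> b]) simp
  then have "sol \<phi> (a, \<epsilon>) (\<eta>, b) t - a * cos t - b * sin t + \<epsilon> * rem \<phi> t (a, 0) (\<eta>', 0)
      = - \<epsilon> * (rem \<phi> t (a, \<epsilon>) (\<eta>, b) - rem \<phi> t (a, 0) (\<eta>', 0))" by (simp add: algebra_simps)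
  then show ?thesis
    using mult_left_mono[OF r abs_ge_zero[of \<epsilon>]] by (simp only: abs_mult abs_minus_cancel)
qed

abbreviation boxes where "boxes \<equiv> {q. box (fst q) (snd q)}"

lemma bounded_lipschitz_coords:
  "bounded_lipschitz boxes (\<lambda>q. fst (fst q))" "bounded_lipschitz boxes (\<lambda>q. snd (fst q))"
  "bounded_lipschitz boxes (\<lambda>q. snd (snd q))"
  by (rule bounded_lipschitzI[of _ _ A 1]; use dist_components_le A e in \<open>force simp: box_def\<close>)+

lemma bounded_lipschitz_F:
  "bounded_lipschitz boxes (\<lambda>q. fst (F g (fst q) (snd q)))"
  "bounded_lipschitz boxes (\<lambda>q. snd (F g (fst q) (snd q)))"
proof -
  have d: "norm (F g (fst q) (snd q) - F g (fst q') (snd q')) \<le> 16 * pi * F_const * dist q q'"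
    if "q \<in> boxes" "q' \<in> boxes" for q q'
  proof -
    have "norm (F g (fst q) (snd q) - F g (fst q') (snd q')) \<le> 4 * pi * (F_const * (4 * dist q q'))"
      using that dist_components_le[of q q'] F_const_nonneg
      by (intro order_trans[OF F_diff] mult_left_mono) auto
    then show ?thesis by simp
  qed
  have n: "norm (F g (fst q) (snd q)) \<le> 4 * pi * param_const" if "q \<in> boxes" for q
    using F_bound that by simp
  show "bounded_lipschitz boxes (\<lambda>q. fst (F g (fst q) (snd q)))"
  proof (rule bounded_lipschitzI)
    show "\<bar>fst (F g (fst q) (snd q))\<bar> \<le> 4 * pi * param_const" if "q \<in> boxes" for q
      using order_trans[OF abs_fst_le_norm n[OF that]] .
    show "\<bar>fst (F g (fst q) (snd q)) - fst (F g (fst q') (snd q'))\<bar> \<le> 16 * pi * F_const * dist q q'"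
      if "q \<in> boxes" "q' \<in> boxes" for q q'
      using order_trans[OF abs_fst_le_norm d[OF that]] by simp
  qed
  show "bounded_lipschitz boxes (\<lambda>q. snd (F g (fst q) (snd q)))"
  proof (rule bounded_lipschitzI)
    show "\<bar>snd (F g (fst q) (snd q))\<bar> \<le> 4 * pi * param_const" if "q \<in> boxes" for q
      using order_trans[OF abs_snd_le_norm n[OF that]] .
    show "\<bar>snd (F g (fst q) (snd q)) - snd (F g (fst q') (snd q'))\<bar> \<le> 16 * pi * F_const * dist q q'"
      if "q \<in> boxes" "q' \<in> boxes" for q q'
      using order_trans[OF abs_snd_le_norm d[OF that]] by simp
  qed
qed

definition meanF :: "(real \<times> real) \<times> (real \<times> real) \<Rightarrow> real" where
  "meanF q = mean_\<phi> (fst q) (fst (snd q)) (fst (F g (fst q) (snd q)))"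

text \<open>
  The segment from \<open>a\<close> to \<open>a + \<epsilon> F\<^sub>1\<close> joins the values of the solution at \<open>0\<close> and \<open>2\<pi>\<close>, so the
  bound for solutions applies to it.
\<close>

lemma segment_bounded:
  assumes b: "box p y" and t: "t \<in> {0..1}"
  shows "\<bar>fst p + t * (snd p * fst (F g p y))\<bar> \<le> sol_sup"
proof -
  obtain a \<epsilon> \<eta> b where p: "p = (a, \<epsilon>)" and y: "y = (\<eta>, b)" by (metis prod.exhaust)
  have "sol \<phi> p y (2*pi) = a + \<epsilon> * fst (F g p y)"
    unfolding p y by (rule sol_representation[of a \<epsilon> \<eta> b]) simp
  then have "fst p + t * (snd p * fst (F g p y)) = (1 - t) * sol \<phi> p y 0 + t * sol \<phi> p y (2*pi)"
    using ivp_sol[of p y] unfolding p y ivp_solution_def by (simp add: algebra_simps)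
  also have "\<bar>\<dots>\<bar> \<le> (1 - t) * \<bar>sol \<phi> p y 0\<bar> + t * \<bar>sol \<phi> p y (2*pi)\<bar>"
    using t abs_triangle_ineq[of "(1 - t) * sol \<phi> p y 0" "t * sol \<phi> p y (2*pi)"] by (simp add: abs_mult)
  also have "\<dots> \<le> (1 - t) * sol_sup + t * sol_sup"
    using t by (intro add_mono mult_left_mono sol_bounded[OF b]) auto
  finally show ?thesis by (simp add: algebra_simps)
qed

lemma meanF_bound: "q \<in> boxes \<Longrightarrow> \<bar>meanF q\<bar> \<le> param_const"
proof -
  assume q: "q \<in> boxes"
  let ?u = "\<lambda>t. \<phi> (fst (fst q) + t * (snd (fst q) * fst (F g (fst q) (snd q)))) (fst (snd q)) (snd (fst q))"
  have "norm (integral {0..1} ?u) \<le> param_const * (1 - 0)"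
  proof (rule integral_bound)
    show "continuous_on {0..1} ?u" by (intro continuous_intros)
    show "norm (?u t) \<le> param_const" if "t \<in> {0..1}" for t
      using \<phi>_param_diff(1)[OF _ _ segment_bounded[OF _ that]] q by simp
  qed simp
  then show ?thesis by (simp add: meanF_def mean_\<phi>_def)
qed

lemma bounded_lipschitz_meanF: "bounded_lipschitz boxes meanF"
proof -
  define Z where "Z q = snd (fst q) * fst (F g (fst q) (snd q))" for q
  have "bounded_lipschitz boxes Z"
    unfolding Z_def by (intro bounded_lipschitz_mult bounded_lipschitz_coords bounded_lipschitz_F)
  then obtain M where M: "0 \<le> M" "\<And>q q'. \<lbrakk>q \<in> boxes; q' \<in> boxes\<rbrakk> \<Longrightarrow> \<bar>Z q - Z q'\<bar> \<le> M * dist q q'"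
    by (rule bounded_lipschitzE) simp
  define u where "u q t = \<phi> (fst (fst q) + t * Z q) (fst (snd q)) (snd (fst q))" for q and t :: real
  have u_cont: "continuous_on S (u q)" for S q unfolding u_def by (intro continuous_intros)
  have u_diff: "\<bar>u q t - u q' t\<bar> \<le> (lip_const * (1 + M) + param_const * 2) * dist q q'"
    if q: "q \<in> boxes" "q' \<in> boxes" and t: "t \<in> {0..1}" for q q' t
  proof -
    have b: "box (fst q) (snd q)" "box (fst q') (snd q')" using q by auto
    let ?v = "fst (fst q) + t * Z q" and ?v' = "fst (fst q') + t * Z q'"
    have "?v - ?v' = (fst (fst q) - fst (fst q')) + t * (Z q - Z q')" by (simp add: algebra_simps)
    moreover have "\<bar>t * (Z q - Z q')\<bar> \<le> 1 * (M * dist q q')"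
      unfolding abs_mult using t M(2)[OF q] by (intro mult_mono) auto
    ultimately have "\<bar>?v - ?v'\<bar> \<le> (1 + M) * dist q q'"
      using dist_components_le(1)[of q q'] unfolding distrib_right by linarith
    then have "\<bar>\<phi> ?v (fst (snd q)) (snd (fst q)) - \<phi> ?v' (fst (snd q)) (snd (fst q))\<bar> \<le> lip_const * ((1 + M) * dist q q')"
      by (intro order_trans[OF \<phi>_lip_box[OF b(1)]] mult_left_mono lip_const_nonneg)
    moreover have "\<bar>\<phi> ?v' (fst (snd q)) (snd (fst q)) - \<phi> ?v' (fst (snd q')) (snd (fst q'))\<bar> \<le> param_const * (2 * dist q q')"
      using segment_bounded[OF b(2) t] dist_components_le[of q q'] param_const_nonneg
      by (intro order_trans[OF \<phi>_param_diff(2)[OF b]] mult_left_mono) (auto simp: Z_def)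
    ultimately show ?thesis unfolding u_def by (simp only: distrib_right mult.assoc)
  qed
  have mean: "meanF q = integral {0..1} (u q)" for q by (simp add: meanF_def mean_\<phi>_def u_def[abs_def] Z_def)
  show ?thesis
  proof (rule bounded_lipschitzI[OF meanF_bound])
    fix q q' assume q: "q \<in> boxes" "q' \<in> boxes"
    have "meanF q - meanF q' = integral {0..1} (\<lambda>t. u q t - u q' t)"
      unfolding mean by (subst integral_diff) (auto intro!: integrable_continuous_interval u_cont)
    also have "norm \<dots> \<le> ((lip_const * (1 + M) + param_const * 2) * dist q q') * (1 - 0)"
      by (rule integral_bound) (use u_diff[OF q] in \<open>auto intro!: continuous_intros u_cont\<close>)
    finally show "\<bar>meanF q - meanF q'\<bar> \<le> (lip_const * (1 + M) + param_const * 2) * dist q q'" by simp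
  qed simp
qed

text \<open>
  The quotient \<open>F\<^sub>1 / F\<^sub>2\<close> according to the energy identity, which remains meaningful where \<open>F\<^sub>2 = 0\<close>; at
  \<open>\<epsilon> = 0\<close> it is \<open>b / a\<close>.
\<close>

definition slope :: "(real \<times> real) \<times> (real \<times> real) \<Rightarrow> real" where
  "slope q = (snd (snd q) - snd (fst q) * snd (F g (fst q) (snd q)) / 2) /
     (fst (fst q) + snd (fst q) * (fst (F g (fst q) (snd q)) / 2 + meanF q))"

lemma slope_properties:
  assumes c: "0 < c"
  defines "S \<equiv> {q. q \<in> boxes \<and> c \<le> \<bar>fst (fst q)\<bar> \<and> \<bar>snd (fst q)\<bar> * (2 * pi * param_const + param_const) \<le> c / 2}"
  shows fst_F_eq: "q \<in> S \<Longrightarrow> fst (F g (fst q) (snd q)) = slope q * snd (F g (fst q) (snd q))"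
    and slope_bound: "q \<in> S \<Longrightarrow>
      \<bar>slope q\<bar> \<le> 2 / c * (1 + 2 * pi * param_const) * (\<bar>snd (snd q)\<bar> + \<bar>snd (fst q)\<bar>)"
    and bounded_lipschitz_slope: "bounded_lipschitz S slope"
proof -
  define D where "D q = fst (fst q) + snd (fst q) * (fst (F g (fst q) (snd q)) / 2 + meanF q)" for q
  define n where "n q = snd (snd q) - snd (fst q) * snd (F g (fst q) (snd q)) / 2" for q
  have slope: "slope q = n q / D q" for q by (simp add: slope_def D_def n_def)
  have D: "c / 2 \<le> \<bar>D q\<bar>" if q: "q \<in> S" for q
  proof -
    have "\<bar>fst (F g (fst q) (snd q)) / 2 + meanF q\<bar> \<le> 2 * pi * param_const + param_const"
      using q order_trans[OF abs_fst_le_norm F_bound, of "fst q" "snd q"] meanF_bound[of q]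
      unfolding S_def by simp
    then have "\<bar>snd (fst q)\<bar> * \<bar>fst (F g (fst q) (snd q)) / 2 + meanF q\<bar> \<le> \<bar>snd (fst q)\<bar> * (2 * pi * param_const + param_const)"
      by (intro mult_left_mono) auto
    then have "\<bar>snd (fst q) * (fst (F g (fst q) (snd q)) / 2 + meanF q)\<bar> \<le> c / 2"
      using q unfolding S_def abs_mult by simp
    moreover have "c \<le> \<bar>fst (fst q)\<bar>" using q by (simp add: S_def)
    ultimately show ?thesis unfolding D_def by linarith
  qed
  show "fst (F g (fst q) (snd q)) = slope q * snd (F g (fst q) (snd q))" if "q \<in> S" for q
  proof -
    have "D q \<noteq> 0" using D[OF that] c by auto
    moreover have "fst (F g (fst q) (snd q)) * D q = snd (F g (fst q) (snd q)) * n q"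
      using energy_identity[of "fst (fst q)" "snd (fst q)" "fst (snd q)" "snd (snd q)"]
      by (simp add: D_def n_def meanF_def)
    ultimately show ?thesis unfolding slope by (simp add: field_simps)
  qed
  show "\<bar>slope q\<bar> \<le> 2 / c * (1 + 2 * pi * param_const) * (\<bar>snd (snd q)\<bar> + \<bar>snd (fst q)\<bar>)" if q: "q \<in> S" for q
  proof -
    have "\<bar>snd (F g (fst q) (snd q))\<bar> \<le> 4 * pi * param_const"
      using q order_trans[OF abs_snd_le_norm F_bound, of "fst q" "snd q"] by (simp add: S_def)
    then have "\<bar>snd (fst q)\<bar> * \<bar>snd (F g (fst q) (snd q))\<bar> \<le> \<bar>snd (fst q)\<bar> * (4 * pi * param_const)"
      by (intro mult_left_mono) auto
    then have "\<bar>n q\<bar> \<le> \<bar>snd (snd q)\<bar> + \<bar>snd (fst q)\<bar> * (2 * pi * param_const)"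
      using abs_triangle_ineq4[of "snd (snd q)" "snd (fst q) * snd (F g (fst q) (snd q)) / 2"]
      by (simp add: n_def abs_mult)
    also have "\<dots> \<le> (1 + 2 * pi * param_const) * (\<bar>snd (snd q)\<bar> + \<bar>snd (fst q)\<bar>)"
    proof -
      have "0 \<le> 2 * pi * param_const * \<bar>snd (snd q)\<bar>" using param_const_nonneg by simp
      then show ?thesis by (simp add: algebra_simps)
    qed
    finally have "\<bar>n q\<bar> / \<bar>D q\<bar> \<le> (1 + 2 * pi * param_const) * (\<bar>snd (snd q)\<bar> + \<bar>snd (fst q)\<bar>) / (c / 2)"
      using D[OF q] c param_const_nonneg by (intro frac_le) auto
    then show ?thesis unfolding slope abs_divide by (simp add: field_simps)
  qed
  have sub: "S \<subseteq> boxes" by (auto simp: S_def)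
  have "bounded_lipschitz S n"
  proof -
    have "bounded_lipschitz boxes (\<lambda>q. snd (snd q) - (1/2) * (snd (fst q) * snd (F g (fst q) (snd q))))"
      by (intro bounded_lipschitz_diff bounded_lipschitz_mult bounded_lipschitz_const
          bounded_lipschitz_coords bounded_lipschitz_F)
    then show ?thesis using bounded_lipschitz_subset[OF _ sub] by (simp add: n_def[abs_def])
  qed
  moreover have "bounded_lipschitz S D"
  proof -
    have "bounded_lipschitz boxes (\<lambda>q. fst (fst q) + snd (fst q) * ((1/2) * fst (F g (fst q) (snd q)) + meanF q))"
      by (intro bounded_lipschitz_add bounded_lipschitz_mult bounded_lipschitz_const
          bounded_lipschitz_coords bounded_lipschitz_F bounded_lipschitz_meanF)
    then show ?thesis using bounded_lipschitz_subset[OF _ sub] by (simp add: D_def[abs_def])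
  qed
  ultimately have "bounded_lipschitz S (\<lambda>q. n q / D q)"
    using D c by (intro bounded_lipschitz_divide[where c = "c / 2"]) auto
  then show "bounded_lipschitz S slope" by (simp add: slope[abs_def])
qed

text \<open>
  The definition of \<open>eta0\<close> makes \<open>F\<^sub>2\<close> vanish on the harmonic oscillation \<open>a cos\<close>; the
  energy identity then forces \<open>F\<^sub>1 = 0\<close>.
\<close>

lemma F_at_eta0:
  assumes "a \<noteq> 0"
  shows "F g (a, 0) (eta0 g a, 0) = 0"
proof -
  let ?\<eta> = "eta0 g a"
  have g_cont: "continuous_on UNIV (\<lambda>s. g (a * cos s))"
    by (intro continuous_on_compose2[OF lipschitz_on_continuous_on[OF g]] continuous_intros) auto
  have sol: "sol \<phi> (a, 0) (?\<eta>, 0) s = a * cos s" for s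
    by (rule sol_representation[of a 0 ?\<eta> 0]) simp
  have "F g (a, 0) (?\<eta>, 0) = moments (\<lambda>s. g (a * cos s) - (?\<eta> * a * cos s + 0 * sin s))"
    unfolding F_eq_moments sol by (simp add: nonlin_def mult.assoc)
  also have "\<dots> = moments (\<lambda>s. g (a * cos s)) - (pi * 0, pi * (?\<eta> * a))"
    unfolding moments_trig[symmetric]
    by (rule moments_diff[symmetric]) (intro g_cont continuous_intros)+
  also have "snd \<dots> = integral {0..2*pi} (\<lambda>s. cos s * g (a * cos s)) - pi * (?\<eta> * a)"
    by (simp add: moments_def)
  also have "\<dots> = 0"
    unfolding eta0_def
    by (subst LBINT_eq_integral) (use assms g_cont in \<open>auto intro!: continuous_intros\<close>)
  finally have 2: "snd (F g (a, 0) (?\<eta>, 0)) = 0" .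
  then have "fst (F g (a, 0) (?\<eta>, 0)) = 0"
    using energy_identity[of a 0 ?\<eta> 0] assms by simp
  with 2 show ?thesis by (simp add: prod_eq_iff)
qed

lemma bounded_lipschitz_eta0:
  assumes "0 < c"
  shows "bounded_lipschitz {a. c \<le> \<bar>a\<bar> \<and> \<bar>a\<bar> \<le> A} (eta0 g)"
proof -
  let ?S = "{a. c \<le> \<bar>a\<bar> \<and> \<bar>a\<bar> \<le> A}"
  have g_cont: "continuous_on UNIV (\<lambda>s. g (a * cos s))" for a
    by (intro continuous_on_compose2[OF lipschitz_on_continuous_on[OF g]] continuous_intros) auto
  define I where "I a = snd (moments (\<lambda>s. g (a * cos s)))" for a
  have id: "bounded_lipschitz ?S (\<lambda>a. a)"
    by (rule bounded_lipschitzI[of _ _ A 1]) (auto simp: dist_real_def)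
  have I: "bounded_lipschitz ?S I"
  proof (rule bounded_lipschitzI)
    show "\<bar>I a\<bar> \<le> 4 * pi * (\<bar>g 0\<bar> + C * A)" if "a \<in> ?S" for a
    proof -
      have "\<bar>a * cos s\<bar> \<le> A" for s
        using that mult_mono[of "\<bar>a\<bar>" A "\<bar>cos s\<bar>" 1] A by (simp add: abs_mult)
      from g_bound[OF this] show ?thesis
        unfolding I_def by (intro order_trans[OF abs_snd_le_norm norm_moments_le[OF g_cont]])
    qed
    show "\<bar>I a - I a'\<bar> \<le> 4 * pi * C * dist a a'" for a a'
    proof -
      have "I a - I a' = snd (moments (\<lambda>s. g (a * cos s) - g (a' * cos s)))"
        unfolding I_def moments_diff[OF g_cont g_cont, symmetric] by simp
      also have "\<bar>\<dots>\<bar> \<le> 4 * pi * (C * \<bar>a - a'\<bar>)"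
      proof (rule order_trans[OF abs_snd_le_norm norm_moments_le])
        show "continuous_on UNIV (\<lambda>s. g (a * cos s) - g (a' * cos s))"
          by (intro continuous_intros g_cont)
        fix s
        have "\<bar>a * cos s - a' * cos s\<bar> \<le> \<bar>a - a'\<bar>"
          using mult_mono[of "\<bar>a - a'\<bar>" "\<bar>a - a'\<bar>" "\<bar>cos s\<bar>" 1]
          by (simp add: abs_mult left_diff_distrib[symmetric])
        then show "\<bar>g (a * cos s) - g (a' * cos s)\<bar> \<le> C * \<bar>a - a'\<bar>"
          using C_nonneg by (intro order_trans[OF g_lip] mult_left_mono)
      qed
      finally show ?thesis by (simp add: dist_real_def mult.assoc)
    qed
  qed
  have "eta0 g = (\<lambda>a. ((1 / pi) * I a) / a)"
    unfolding eta0_def I_def moments_def fun_eq_iff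
    by (subst LBINT_eq_integral) (auto intro!: continuous_intros g_cont)
  moreover have "bounded_lipschitz ?S (\<lambda>a. ((1 / pi) * I a) / a)"
    by (rule bounded_lipschitz_divide[OF bounded_lipschitz_mult[OF bounded_lipschitz_const I] id assms]) simp
  ultimately show ?thesis by simp
qed

end

section \<open>Comparison with the linear oscillator\<close>

text \<open>
  The comparison problem is an instance of the given one, so all estimates for \<open>F\<close> hold for \<open>H\<close> too.
\<close>

lemma H_eq_F: "H \<alpha> = F (\<lambda>x. \<alpha> * x)"
proof -
  have "lin \<alpha> = nonlin (\<lambda>x. \<alpha> * x)" by (intro ext) (simp add: lin_def nonlin_def)
  then show ?thesis by (simp add: H_def F_def)
qed

text \<open>
  With \<open>\<mu> = - \<pi> a0\<close> and \<open>\<nu> = \<pi> (\<alpha> - eta0 g a0)\<close> this is the inverse of the derivative of \<open>H\<close> at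
  \<open>\<epsilon> = 0\<close>, \<open>a = a0\<close>, \<open>y = (eta0 g a0, 0)\<close>. It exchanges the coordinates because \<open>H\<^sub>1\<close> responds to \<open>b\<close> and
  \<open>H\<^sub>2\<close> to \<open>\<eta>\<close>; it exists because \<open>a0 \<noteq> 0\<close> and \<open>\<alpha> \<noteq> eta0 g a0\<close>.
\<close>

definition swap_scale :: "real \<Rightarrow> real \<Rightarrow> real \<times> real \<Rightarrow> real \<times> real" where
  "swap_scale \<mu> \<nu> z = (snd z / \<mu>, fst z / \<nu>)"

lemma swap_scale_diff: "swap_scale \<mu> \<nu> z - swap_scale \<mu> \<nu> z' = swap_scale \<mu> \<nu> (z - z')"
  by (simp add: swap_scale_def diff_divide_distrib)

lemma swap_scale_eq_iff:
  "\<mu> \<noteq> 0 \<Longrightarrow> \<nu> \<noteq> 0 \<Longrightarrow> swap_scale \<mu> \<nu> z = swap_scale \<mu> \<nu> z' \<longleftrightarrow> z = z'"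
  by (auto simp: swap_scale_def prod_eq_iff)

lemma norm_swap_scale_le: "norm (swap_scale \<mu> \<nu> z) \<le> (1 / \<bar>\<mu>\<bar> + 1 / \<bar>\<nu>\<bar>) * norm z"
proof -
  have "\<bar>snd z\<bar> / \<bar>\<mu>\<bar> \<le> norm z / \<bar>\<mu>\<bar>" "\<bar>fst z\<bar> / \<bar>\<nu>\<bar> \<le> norm z / \<bar>\<nu>\<bar>"
    by (intro divide_right_mono abs_fst_le_norm abs_snd_le_norm; simp)+
  then show ?thesis
    using norm_pair_le[of "swap_scale \<mu> \<nu> z"] by (simp add: swap_scale_def distrib_right abs_divide)
qed

lemma abs_le_sum4:
  assumes "x = t1 - t2 + t3 - t4" "\<bar>t1\<bar> \<le> b1" "\<bar>t2\<bar> \<le> b2" "\<bar>t3\<bar> \<le> b3" "\<bar>t4\<bar> \<le> b4"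
  shows "\<bar>x\<bar> \<le> b1 + b2 + b3 + (b4 :: real)"
  using assms by linarith

lemma abs_le_sum6:
  assumes "x = t1 + t2 + t3 + t4 - t5 - t6"
    "\<bar>t1\<bar> \<le> b1" "\<bar>t2\<bar> \<le> b2" "\<bar>t3\<bar> \<le> b3" "\<bar>t4\<bar> \<le> b4" "\<bar>t5\<bar> \<le> b5" "\<bar>t6\<bar> \<le> b6"
  shows "\<bar>x\<bar> \<le> b1 + b2 + b3 + b4 + b5 + (b6 :: real)"
  using assms by linarith

text \<open>
  The nonlinear problem and its linear comparison problem on a common box of parameters.
\<close>

locale oscillator_pair = oscillator_box g C A e + lin: oscillator_box "\<lambda>x. \<alpha> * x" C A e
  for g C A e \<alpha> +
  assumes \<alpha>: "0 < \<alpha>" "\<alpha> < 1"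
begin

definition E_const where
  "E_const = (A + (1 + A) * C) * flow_const + (A + 1 + A) * lin.flow_const + (flow_const + lin.flow_const) * (1 + 2 * A) + (A + 1) * (g_sup + lin.sol_sup)"

lemma E_const_nonneg: "0 \<le> E_const"
  using A C_nonneg flow_const_nonneg lin.flow_const_nonneg g_sup_nonneg lin.sol_sup_nonneg by (simp add: E_const_def)

text \<open>
  The integrand of \<open>F\<close> minus that of \<open>H\<close> no longer contains \<open>- \<eta> x\<close> to leading order: what remains of it is
  \<open>- \<eta> (x - \<xi>)\<close>, and \<open>x - \<xi> = O(\<epsilon>)\<close> since both solutions are close to the same harmonic oscillation.
  All other occurrences of \<open>\<eta>\<close> carry a factor \<open>\<epsilon>\<close> anyway.
\<close>

lemma E_diff:
  assumes b: "box p y" "box p' y'"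
  shows "norm ((F g p y - H \<alpha> p y) - (F g p' y' - H \<alpha> p' y'))
    \<le> 4 * pi * (E_const * (\<bar>fst p - fst p'\<bar> + \<bar>snd y - snd y'\<bar> + \<bar>snd p - snd p'\<bar> + \<bar>snd p'\<bar> * \<bar>fst y - fst y'\<bar>))"
proof -
  define D where "D = \<bar>fst p - fst p'\<bar> + \<bar>snd y - snd y'\<bar> + \<bar>snd p - snd p'\<bar> + \<bar>snd p'\<bar> * \<bar>fst y - fst y'\<bar>"
  let ?x = "sol \<phi> p y" and ?x' = "sol \<phi> p' y'" and ?z = "sol lin.\<phi> p y" and ?z' = "sol lin.\<phi> p' y'"
  have D: "0 \<le> D" "\<bar>snd p'\<bar> * \<bar>fst y - fst y'\<bar> \<le> D" "\<bar>snd p - snd p'\<bar> + \<bar>snd p'\<bar> * \<bar>fst y - fst y'\<bar> \<le> D"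
    by (auto simp: D_def)
  have lb: "lin.box p y" "lin.box p' y'" using b by (auto simp: box_def lin.box_def)
  define u where "u s = (\<phi> (?x s) (fst y) (snd p) - lin.\<phi> (?z s) (fst y) (snd p))
    - (\<phi> (?x' s) (fst y') (snd p') - lin.\<phi> (?z' s) (fst y') (snd p'))" for s
  have eq: "(F g p y - H \<alpha> p y) - (F g p' y' - H \<alpha> p' y') = moments u"
    unfolding H_eq_F F_eq_moments lin.F_eq_moments u_def
    by (subst moments_diff, (intro continuous_intros)+)+ (rule refl)
  show ?thesis
    unfolding eq D_def[symmetric]
  proof (rule norm_moments_le)
    show "continuous_on UNIV u" unfolding u_def by (intro continuous_intros)
    fix s assume s: "0 \<le> s" "s \<le> 2*pi"
    have dx: "\<bar>?x s - ?x' s\<bar> \<le> flow_const * D" using sol_diff(1)[OF b s] by (simp only: D_def)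
    have dz: "\<bar>?z s - ?z' s\<bar> \<le> lin.flow_const * D" using lin.sol_diff(1)[OF lb s] by (simp only: D_def)
    have xz: "\<bar>?x' s - ?z' s\<bar> \<le> (flow_const + lin.flow_const) * (1 + 2 * A) * \<bar>snd p'\<bar>"
      using sol_near_harmonic[OF b(2) s] lin.sol_near_harmonic[OF lb(2) s]
      unfolding distrib_right by linarith
    have g_sup: "\<bar>g (?x' s) - \<alpha> * ?z' s\<bar> \<le> g_sup + lin.sol_sup"
    proof -
      have "\<bar>\<alpha> * ?z' s\<bar> \<le> 1 * lin.sol_sup"
        unfolding abs_mult using \<alpha> lin.sol_bounded[OF lb(2) s] by (intro mult_mono) auto
      then show ?thesis using g_bound[OF sol_bounded[OF b(2) s]] unfolding g_sup_def by linarith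
    qed
    have "u s = - fst y * ((?x s - ?x' s) - (?z s - ?z' s)) - (fst y - fst y') * (?x' s - ?z' s)
        + (1 - snd p * fst y) * ((g (?x s) - g (?x' s)) - \<alpha> * (?z s - ?z' s))
        - (snd p * fst y - snd p' * fst y') * (g (?x' s) - \<alpha> * ?z' s)"
      unfolding u_def nonlin_def by algebra
    moreover have "\<bar>- fst y * ((?x s - ?x' s) - (?z s - ?z' s))\<bar> \<le> A * (flow_const * D + lin.flow_const * D)"
    proof -
      have "\<bar>(?x s - ?x' s) - (?z s - ?z' s)\<bar> \<le> flow_const * D + lin.flow_const * D" using dx dz by linarith
      then show ?thesis
        unfolding abs_mult abs_minus_cancel using b A by (intro mult_mono) (auto simp: box_def)
    qed
    moreover have "\<bar>(fst y - fst y') * (?x' s - ?z' s)\<bar> \<le> (flow_const + lin.flow_const) * (1 + 2 * A) * D"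
    proof -
      have "\<bar>fst y - fst y'\<bar> * \<bar>?x' s - ?z' s\<bar> \<le> \<bar>fst y - fst y'\<bar> * ((flow_const + lin.flow_const) * (1 + 2 * A) * \<bar>snd p'\<bar>)"
        by (intro mult_left_mono xz) simp
      also have "\<dots> = (flow_const + lin.flow_const) * (1 + 2 * A) * (\<bar>snd p'\<bar> * \<bar>fst y - fst y'\<bar>)" by simp
      also have "\<dots> \<le> (flow_const + lin.flow_const) * (1 + 2 * A) * D"
        using flow_const_nonneg lin.flow_const_nonneg A by (intro mult_left_mono D) simp
      finally show ?thesis by (simp only: abs_mult)
    qed
    moreover have "\<bar>(1 - snd p * fst y) * ((g (?x s) - g (?x' s)) - \<alpha> * (?z s - ?z' s))\<bar>
        \<le> (1 + A) * (C * (flow_const * D) + 1 * (lin.flow_const * D))"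
    proof -
      have "\<bar>g (?x s) - g (?x' s)\<bar> \<le> C * (flow_const * D)"
        using dx C_nonneg by (intro order_trans[OF g_lip] mult_left_mono)
      moreover have "\<bar>\<alpha> * (?z s - ?z' s)\<bar> \<le> 1 * (lin.flow_const * D)"
        unfolding abs_mult using \<alpha> dz by (intro mult_mono) auto
      ultimately have "\<bar>(g (?x s) - g (?x' s)) - \<alpha> * (?z s - ?z' s)\<bar> \<le> C * (flow_const * D) + 1 * (lin.flow_const * D)"
        by linarith
      then show ?thesis
        unfolding abs_mult using abs_one_minus_le[OF b(1)] A by (intro mult_mono) auto
    qed
    moreover have "\<bar>(snd p * fst y - snd p' * fst y') * (g (?x' s) - \<alpha> * ?z' s)\<bar> \<le> ((A + 1) * D) * (g_sup + lin.sol_sup)"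
    proof -
      have "A * \<bar>snd p - snd p'\<bar> \<le> A * D" using A by (intro mult_left_mono) (auto simp: D_def)
      then have "\<bar>snd p * fst y - snd p' * fst y'\<bar> \<le> (A + 1) * D"
        using abs_\<epsilon>\<eta>_diff_le[OF b(1), of p' y'] D(2) unfolding distrib_right by linarith
      then show ?thesis unfolding abs_mult using g_sup A D by (intro mult_mono) auto
    qed
    ultimately have "\<bar>u s\<bar> \<le> A * (flow_const * D + lin.flow_const * D) + (flow_const + lin.flow_const) * (1 + 2 * A) * D
        + (1 + A) * (C * (flow_const * D) + 1 * (lin.flow_const * D)) + ((A + 1) * D) * (g_sup + lin.sol_sup)"
      by (rule abs_le_sum4)
    also have "\<dots> = E_const * D" unfolding E_const_def by algebra
    finally show "\<bar>u s\<bar> \<le> E_const * D" .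
  qed
qed

definition H_const where
  "H_const = (1 + 2 * A) * lin.flow_const + (1 + 2 * A) + A + (A + 1) * lin.sol_sup + lin.flow_const * (1 + 2 * A) + 1"

lemma H_const_nonneg: "0 \<le> H_const"
  using A lin.flow_const_nonneg lin.sol_sup_nonneg by (simp add: H_const_def)

text \<open>
  At \<open>\<epsilon> = 0\<close> one has \<open>H = \<pi> ((\<alpha> - \<eta>) b, (\<alpha> - \<eta>) a)\<close>. The linear part subtracted here is the
  derivative in \<open>(\<eta>, b)\<close> at \<open>a = a0\<close>, \<open>\<eta> = \<eta>0\<close>, \<open>b = 0\<close>. The error splits into a contribution of
  the parameters and one of the unknowns with a factor that is small near this point.
\<close>

lemma H_near_linear:
  assumes b: "box p y" "box p' y'"
  shows "norm ((H \<alpha> p y - H \<alpha> p' y') - (pi * ((\<alpha> - \<eta>0) * (snd y - snd y')), pi * (- a0 * (fst y - fst y'))))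
    \<le> 4 * pi * (H_const * ((\<bar>fst p - fst p'\<bar> + \<bar>snd p - snd p'\<bar>)
        + (\<bar>snd p\<bar> + \<bar>snd p'\<bar> + \<bar>fst y - \<eta>0\<bar> + \<bar>fst p' - a0\<bar> + \<bar>snd y'\<bar>) * (\<bar>fst y - fst y'\<bar> + \<bar>snd y - snd y'\<bar>)))"
proof -
  define R where "R = \<bar>fst p - fst p'\<bar> + \<bar>snd p - snd p'\<bar>"
  define w where "w = \<bar>snd p\<bar> + \<bar>snd p'\<bar> + \<bar>fst y - \<eta>0\<bar> + \<bar>fst p' - a0\<bar> + \<bar>snd y'\<bar>"
  define d\<eta> where "d\<eta> = \<bar>fst y - fst y'\<bar>"
  define db where "db = \<bar>snd y - snd y'\<bar>"
  define Q where "Q = w * (d\<eta> + db)"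
  have nn: "0 \<le> R" "0 \<le> w" "0 \<le> d\<eta>" "0 \<le> db" by (auto simp: R_def w_def d\<eta>_def db_def)
  have Q: "w * d\<eta> + w * db = Q" "0 \<le> Q" "0 \<le> w * d\<eta>" "0 \<le> w * db" using nn by (auto simp: Q_def distrib_left)
  have lb: "lin.box p y" "lin.box p' y'" using b by (auto simp: box_def lin.box_def)
  let ?z = "sol lin.\<phi> p y" and ?z' = "sol lin.\<phi> p' y'"
  define k where "k = - fst y + (1 - snd p * fst y) * \<alpha>"
  define k' where "k' = - fst y' + (1 - snd p' * fst y') * \<alpha>"
  define u where "u s = lin.\<phi> (?z s) (fst y) (snd p) - lin.\<phi> (?z' s) (fst y') (snd p')
    - (- a0 * (fst y - fst y') * cos s + (\<alpha> - \<eta>0) * (snd y - snd y') * sin s)" for s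
  have eq: "(H \<alpha> p y - H \<alpha> p' y') - (pi * ((\<alpha> - \<eta>0) * (snd y - snd y')), pi * (- a0 * (fst y - fst y')))
      = moments u"
    unfolding H_eq_F lin.F_eq_moments u_def moments_trig[symmetric]
    by (subst moments_diff, (intro continuous_intros)+)+ (rule refl)
  show ?thesis
    unfolding eq R_def[symmetric] w_def[symmetric] d\<eta>_def[symmetric] db_def[symmetric] Q_def[symmetric]
  proof (rule norm_moments_le)
    show "continuous_on UNIV u" unfolding u_def by (intro continuous_intros)
    fix s assume s: "0 \<le> s" "s \<le> 2*pi"
    have cs: "\<bar>cos s\<bar> \<le> 1" "\<bar>sin s\<bar> \<le> 1" by auto
    have e1: "\<bar>snd p\<bar> \<le> 1" "\<bar>snd p'\<bar> \<le> 1" using b e(2) unfolding box_def by linarith+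
    have \<eta>1: "\<bar>fst y\<bar> \<le> A" using b by (simp add: box_def)
    have k: "\<bar>k\<bar> \<le> 1 + 2 * A"
    proof -
      have "\<bar>(1 - snd p * fst y) * \<alpha>\<bar> \<le> (1 + A) * 1"
        unfolding abs_mult using abs_one_minus_le[OF b(1)] \<alpha> A by (intro mult_mono) auto
      then have "\<bar>- fst y\<bar> + \<bar>(1 - snd p * fst y) * \<alpha>\<bar> \<le> A + (1 + A) * 1"
        using \<eta>1 by (intro add_mono) auto
      then show ?thesis
        unfolding k_def by (intro order_trans[OF abs_triangle_ineq]) simp
    qed
    have k0: "\<bar>k - (\<alpha> - \<eta>0)\<bar> \<le> A * w"
    proof -
      have "k - (\<alpha> - \<eta>0) = - (fst y - \<eta>0) - snd p * fst y * \<alpha>" by (simp add: k_def algebra_simps)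
      then have "\<bar>k - (\<alpha> - \<eta>0)\<bar> \<le> \<bar>- (fst y - \<eta>0)\<bar> + \<bar>snd p * fst y * \<alpha>\<bar>"
        by (simp only: abs_triangle_ineq4)
      also have "\<dots> \<le> A * \<bar>fst y - \<eta>0\<bar> + \<bar>snd p\<bar> * A * 1"
      proof (rule add_mono)
        show "\<bar>- (fst y - \<eta>0)\<bar> \<le> A * \<bar>fst y - \<eta>0\<bar>"
          using mult_right_mono[OF A abs_ge_zero] by (simp add: abs_minus_commute)
        show "\<bar>snd p * fst y * \<alpha>\<bar> \<le> \<bar>snd p\<bar> * A * 1"
          unfolding abs_mult using \<eta>1 \<alpha> A by (intro mult_mono) auto
      qed
      also have "\<dots> = A * (\<bar>fst y - \<eta>0\<bar> + \<bar>snd p\<bar>)" by (simp add: algebra_simps)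
      also have "\<dots> \<le> A * w" using A by (intro mult_left_mono) (auto simp: w_def)
      finally show ?thesis .
    qed
    have kk': "\<bar>k - k' + (fst y - fst y')\<bar> \<le> (A + 1) * (R + Q)"
    proof -
      have "k - k' + (fst y - fst y') = - \<alpha> * (snd p * fst y - snd p' * fst y')"
        by (simp add: k_def k'_def algebra_simps)
      then have "\<bar>k - k' + (fst y - fst y')\<bar> = \<alpha> * \<bar>snd p * fst y - snd p' * fst y'\<bar>"
        using \<alpha> by (simp add: abs_mult)
      also have "\<dots> \<le> 1 * \<bar>snd p * fst y - snd p' * fst y'\<bar>" using \<alpha> by (intro mult_right_mono) auto
      also have "\<dots> \<le> A * \<bar>snd p - snd p'\<bar> + \<bar>snd p'\<bar> * d\<eta>"
        using abs_\<epsilon>\<eta>_diff_le[OF b(1), of p' y'] by (simp add: d\<eta>_def)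
      also have "\<dots> \<le> A * R + w * d\<eta>"
        using A nn by (intro add_mono mult_left_mono mult_right_mono) (auto simp: R_def w_def)
      also have "\<dots> \<le> (A + 1) * (R + Q)"
      proof -
        have "0 \<le> A * Q" using A Q by simp
        then show ?thesis using Q nn unfolding distrib_left distrib_right by linarith
      qed
      finally show ?thesis .
    qed
    have t1: "\<bar>k * ((?z s - ?z' s) - ((fst p - fst p') * cos s + (snd y - snd y') * sin s))\<bar>
        \<le> (1 + 2 * A) * (lin.flow_const * (R + Q))"
    proof -
      have a1: "\<bar>snd p'\<bar> * d\<eta> \<le> w * d\<eta>" "\<bar>snd p\<bar> * db \<le> w * db"
        using nn by (auto intro!: mult_right_mono simp: w_def)
      have a2: "\<bar>snd p\<bar> * \<bar>fst p - fst p'\<bar> \<le> \<bar>fst p - fst p'\<bar>" using e1 by (intro mult_left_le_one_le) auto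
      have "\<bar>(?z s - ?z' s) - ((fst p - fst p') * cos s + (snd y - snd y') * sin s)\<bar>
        \<le> lin.flow_const * (\<bar>snd p - snd p'\<bar> + \<bar>snd p'\<bar> * d\<eta> + \<bar>snd p\<bar> * (\<bar>fst p - fst p'\<bar> + db))"
        using lin.sol_diff(2)[OF lb s] by (simp only: d\<eta>_def db_def)
      also have "\<dots> \<le> lin.flow_const * (R + Q)"
        using a1 a2 Q unfolding distrib_left[of "\<bar>snd p\<bar>"] R_def
        by (intro mult_left_mono lin.flow_const_nonneg) linarith
      finally show ?thesis unfolding abs_mult using k A by (intro mult_mono) auto
    qed
    have t2: "\<bar>k * ((fst p - fst p') * cos s)\<bar> \<le> (1 + 2 * A) * (R * 1)"
      unfolding abs_mult using k A cs nn by (intro mult_mono) (auto simp: R_def)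
    have t3: "\<bar>(k - (\<alpha> - \<eta>0)) * ((snd y - snd y') * sin s)\<bar> \<le> (A * w) * (db * 1)"
      unfolding abs_mult using k0 A cs nn by (intro mult_mono) (auto simp: db_def)
    have t4: "\<bar>(k - k' + (fst y - fst y')) * ?z' s\<bar> \<le> ((A + 1) * (R + Q)) * lin.sol_sup"
      unfolding abs_mult using kk' lin.sol_bounded[OF lb(2) s] A nn Q by (intro mult_mono) auto
    have t5: "\<bar>(fst y - fst y') * (?z' s - (fst p' * cos s + snd y' * sin s))\<bar> \<le> d\<eta> * (lin.flow_const * (1 + 2 * A) * w)"
    proof -
      have "lin.flow_const * (1 + 2 * A) * \<bar>snd p'\<bar> \<le> lin.flow_const * (1 + 2 * A) * w"
        using lin.flow_const_nonneg A by (intro mult_left_mono) (auto simp: w_def)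
      with lin.sol_near_harmonic[OF lb(2) s]
      have "\<bar>?z' s - (fst p' * cos s + snd y' * sin s)\<bar> \<le> lin.flow_const * (1 + 2 * A) * w"
        by (rule order_trans)
      then show ?thesis unfolding abs_mult d\<eta>_def by (rule mult_left_mono) simp
    qed
    have t6: "\<bar>(fst y - fst y') * ((fst p' - a0) * cos s + snd y' * sin s)\<bar> \<le> d\<eta> * w"
      unfolding abs_mult d\<eta>_def
      by (intro mult_left_mono order_trans[OF abs_cos_sin_le]) (auto simp: w_def)
    have "u s = k * ((?z s - ?z' s) - ((fst p - fst p') * cos s + (snd y - snd y') * sin s))
        + k * ((fst p - fst p') * cos s) + (k - (\<alpha> - \<eta>0)) * ((snd y - snd y') * sin s)
        + (k - k' + (fst y - fst y')) * ?z' s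
        - (fst y - fst y') * (?z' s - (fst p' * cos s + snd y' * sin s))
        - (fst y - fst y') * ((fst p' - a0) * cos s + snd y' * sin s)"
      unfolding u_def nonlin_def k_def k'_def by algebra
    then have "\<bar>u s\<bar> \<le> (1 + 2 * A) * (lin.flow_const * (R + Q)) + (1 + 2 * A) * (R * 1) + (A * w) * (db * 1)
        + ((A + 1) * (R + Q)) * lin.sol_sup + d\<eta> * (lin.flow_const * (1 + 2 * A) * w) + d\<eta> * w"
      using t1 t2 t3 t4 t5 t6 by (rule abs_le_sum6)
    also have "\<dots> = ((1 + 2 * A) * lin.flow_const) * (R + Q) + (1 + 2 * A) * R + A * (w * db)
        + ((A + 1) * lin.sol_sup) * (R + Q) + (lin.flow_const * (1 + 2 * A)) * (w * d\<eta>) + w * d\<eta>"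
      by (simp add: algebra_simps)
    also have "\<dots> \<le> ((1 + 2 * A) * lin.flow_const) * (R + Q) + (1 + 2 * A) * (R + Q) + A * (R + Q)
        + ((A + 1) * lin.sol_sup) * (R + Q) + (lin.flow_const * (1 + 2 * A)) * (R + Q) + (R + Q)"
    proof (intro add_mono order_refl mult_left_mono)
      show "R \<le> R + Q" "w * db \<le> R + Q" "w * d\<eta> \<le> R + Q" "w * d\<eta> \<le> R + Q" using Q nn by linarith+
    qed (use A lin.flow_const_nonneg in auto)
    also have "\<dots> = H_const * (R + Q)" unfolding H_const_def distrib_right by simp
    finally show "\<bar>u s\<bar> \<le> H_const * (R + Q)" .
  qed
qed

text \<open>
  The choice of the constants. First \<open>L\<close> collects all Lipschitz constants on the box, which determines \<open>w\<close>. Then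
  \<open>\<rho>\<close> is chosen so small that everything of order \<open>\<rho>\<close> is below \<open>w\<close>, and finally \<open>d\<close> and \<open>\<epsilon>0\<close>
  are chosen small compared with \<open>\<rho>\<close>.
\<close>

lemma degenerate_iteration_near:
  fixes a0 :: real
  defines "\<mu> \<equiv> - (pi * a0)" and "\<nu> \<equiv> pi * (\<alpha> - eta0 g a0)"
  assumes a0: "a0 \<noteq> 0" and A_large: "\<bar>a0\<bar> + 1 \<le> A" "\<bar>eta0 g a0\<bar> + 1 \<le> A" and ne: "\<alpha> \<noteq> eta0 g a0"
  shows "\<exists>d \<epsilon>0 \<rho> L w \<sigma> m. 0 < d \<and> d \<le> \<bar>a0\<bar> / 2 \<and> 0 < \<epsilon>0 \<and>
    (\<forall>p\<in>cball a0 d \<times> {-\<epsilon>0..\<epsilon>0}. \<forall>y\<in>cball (eta0 g a0, 0) (2 * \<rho>). box p y) \<and>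
    degenerate_iteration (cball a0 d \<times> {-\<epsilon>0..\<epsilon>0}) (cball (eta0 g a0, 0) (2 * \<rho>))
      (\<lambda>p. (eta0 g (fst p), 0)) (\<lambda>p y. swap_scale \<mu> \<nu> (F g p y)) (\<lambda>p y. swap_scale \<mu> \<nu> (H \<alpha> p y))
      m L w \<sigma> \<rho>"
proof -
  define \<eta>0 where "\<eta>0 = eta0 g a0"
  have \<mu>\<nu>: "\<mu> \<noteq> 0" "\<nu> \<noteq> 0" using a0 ne by (auto simp: \<mu>_def \<nu>_def)
  define T where "T = swap_scale \<mu> \<nu>"
  define tc where "tc = 1 / \<bar>\<mu>\<bar> + 1 / \<bar>\<nu>\<bar>"
  have tc: "0 \<le> tc" and T_le: "norm (T z) \<le> tc * norm z" for z
    unfolding tc_def T_def using norm_swap_scale_le by auto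
  define c where "c = \<bar>a0\<bar> / 2"
  have c: "0 < c" using a0 by (simp add: c_def)

  define S where "S = {q. q \<in> boxes \<and> c \<le> \<bar>fst (fst q)\<bar> \<and> \<bar>snd (fst q)\<bar> * (2 * pi * param_const + param_const) \<le> c / 2}"
  define m where "m p y = slope (p, y) * (\<mu> / \<nu>)" for p y
  obtain M1 where M1: "0 \<le> M1" "\<And>q q'. \<lbrakk>q \<in> S; q' \<in> S\<rbrakk> \<Longrightarrow> \<bar>slope q - slope q'\<bar> \<le> M1 * dist q q'"
    using bounded_lipschitz_slope[OF c] unfolding S_def by (rule bounded_lipschitzE) simp
  define Lm where "Lm = M1 * \<bar>\<mu> / \<nu>\<bar>"
  define Cm where "Cm = 2 / c * (1 + 2 * pi * param_const) * \<bar>\<mu> / \<nu>\<bar>"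
  have Lm: "0 \<le> Lm" and Cm: "0 \<le> Cm" using M1 c param_const_nonneg by (auto simp: Lm_def Cm_def)
  obtain Ke where Ke: "0 \<le> Ke" "\<And>a a'. \<lbrakk>c \<le> \<bar>a\<bar> \<and> \<bar>a\<bar> \<le> A; c \<le> \<bar>a'\<bar> \<and> \<bar>a'\<bar> \<le> A\<rbrakk>
      \<Longrightarrow> \<bar>eta0 g a - eta0 g a'\<bar> \<le> Ke * dist a a'"
    using bounded_lipschitz_eta0[OF c] by (rule bounded_lipschitzE) simp

  define LH where "LH = 8 * pi * (tc * H_const)"
  define LE where "LE = 8 * pi * (tc * E_const)"
  define LF where "LF = 4 * pi * (tc * F_const)"
  have nn: "0 \<le> LH" "0 \<le> LE" "0 \<le> LF"
    using tc H_const_nonneg E_const_nonneg F_const_nonneg by (auto simp: LH_def LE_def LF_def)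
  define L where "L = 1 + LH + LE + Lm + Ke"
  have L: "1 \<le> L" "LH \<le> L" "LE \<le> L" "Lm \<le> L" "Ke \<le> L" using nn Lm Ke by (auto simp: L_def)
  define w where "w = 1 / (150 * L\<^sup>2)"
  have w: "0 < w" "150 * L\<^sup>2 * w \<le> 1" using L by (auto simp: w_def)
  define Q where "Q = LH + LE + LF + Cm + \<bar>2 * pi * param_const + param_const\<bar> + Ke + 1"
  have Q: "1 \<le> Q" "LH \<le> Q" "LE \<le> Q" "LF \<le> Q" "Cm \<le> Q" "2 * pi * param_const + param_const \<le> Q" "Ke \<le> Q"
    using nn Cm Ke by (auto simp: Q_def)
  \<comment> \<open>The bound \<open>1/2\<close> keeps \<open>U\<close>, of radius \<open>2 * \<rho>\<close>, inside the box.\<close>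
  define \<rho> where "\<rho> = min (1/2) (w / (10 * Q))"
  have \<rho>: "0 < \<rho>" "\<rho> \<le> 1/2" using w Q by (auto simp: \<rho>_def)
  have Q\<rho>: "10 * (Q * \<rho>) \<le> w"
  proof -
    have "\<rho> \<le> w / (10 * Q)" by (simp add: \<rho>_def)
    then have "\<rho> * (10 * Q) \<le> w" using Q by (subst (asm) pos_le_divide_eq) auto
    then show ?thesis by (simp add: mult.commute mult.left_commute)
  qed
  define d where "d = min 1 (min c (\<rho> / Q))"
  define \<epsilon>0 where "\<epsilon>0 = min e (min (c / (2 * Q)) (\<rho> / (8 * Q)))"
  have d: "0 < d" "d \<le> 1" "d \<le> c" using c \<rho> Q by (auto simp: d_def)
  have Qd: "Q * d \<le> \<rho>"
  proof -
    have "d \<le> \<rho> / Q" by (simp add: d_def)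
    then show ?thesis using Q by (simp add: pos_le_divide_eq mult.commute)
  qed
  have \<epsilon>0: "0 < \<epsilon>0" "\<epsilon>0 \<le> e" using c \<rho> Q e by (auto simp: \<epsilon>0_def)
  have Q\<epsilon>: "8 * (Q * \<epsilon>0) \<le> \<rho>" "2 * (Q * \<epsilon>0) \<le> c"
  proof -
    have "\<epsilon>0 \<le> \<rho> / (8 * Q)" "\<epsilon>0 \<le> c / (2 * Q)" by (auto simp: \<epsilon>0_def)
    then show "8 * (Q * \<epsilon>0) \<le> \<rho>" "2 * (Q * \<epsilon>0) \<le> c"
      using Q by (simp_all add: pos_le_divide_eq mult.commute mult.left_commute)
  qed
  have le_Q: "x \<le> Q * x" if "0 \<le> x" for x using Q that mult_right_mono[of 1 Q x] by simp
  have d\<rho>: "d \<le> \<rho>" and \<epsilon>\<rho>: "8 * \<epsilon>0 \<le> \<rho>"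
    using le_Q[of d] le_Q[of \<epsilon>0] d \<epsilon>0 Qd Q\<epsilon> by linarith+

  define P where "P = cball a0 d \<times> {-\<epsilon>0..\<epsilon>0}"
  define U where "U = cball (\<eta>0, 0::real) (2 * \<rho>)"
  have P: "\<bar>fst p - a0\<bar> \<le> d" "\<bar>snd p\<bar> \<le> \<epsilon>0" if "p \<in> P" for p
    using that by (auto simp: P_def dist_real_def abs_minus_commute)
  have P_a: "c \<le> \<bar>fst p\<bar>" "\<bar>fst p\<bar> \<le> A" if "p \<in> P" for p
    using P(1)[OF that] d c_def A_large by linarith+
  have U: "\<bar>fst y - \<eta>0\<bar> \<le> 2 * \<rho>" "\<bar>snd y\<bar> \<le> 2 * \<rho>" if "y \<in> U" for y
    using that abs_fst_le_norm[of "y - (\<eta>0, 0)"] abs_snd_le_norm[of "y - (\<eta>0, 0)"]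
    by (auto simp: U_def dist_norm norm_minus_commute)
  have box: "box p y" if "p \<in> P" "y \<in> U" for p y
    using P[OF that(1)] P_a[OF that(1)] U[OF that(2)] \<epsilon>0 \<rho> A_large unfolding box_def \<eta>0_def by linarith
  have inS: "(p, y) \<in> S" if "p \<in> P" "y \<in> U" for p y
  proof -
    have "\<bar>snd p\<bar> * (2 * pi * param_const + param_const) \<le> \<epsilon>0 * Q"
      using P[OF that(1)] Q \<epsilon>0 param_const_nonneg by (intro mult_mono) auto
    then show ?thesis using Q\<epsilon> P_a[OF that(1)] box[OF that] by (simp add: S_def mult.commute)
  qed
  have ctr: "\<bar>eta0 g (fst p) - eta0 g (fst p')\<bar> \<le> Ke * \<bar>fst p - fst p'\<bar>" if "p \<in> P" "p' \<in> P" for p p'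
    using Ke(2)[of "fst p" "fst p'"] P_a[OF that(1)] P_a[OF that(2)] by (simp add: dist_real_def)
  have a0P: "(a0, 0) \<in> P" using d \<epsilon>0 by (simp add: P_def)
  have P0: "(fst p, 0) \<in> P" if "p \<in> P" for p using that \<epsilon>0 by (auto simp: P_def)
  have ctr\<rho>: "\<bar>eta0 g (fst p) - \<eta>0\<bar> \<le> \<rho>" if "p \<in> P" for p
  proof -
    have "\<bar>eta0 g (fst p) - \<eta>0\<bar> \<le> Ke * \<bar>fst p - a0\<bar>" using ctr[OF that a0P] by (simp add: \<eta>0_def)
    also have "\<dots> \<le> Q * d" using P(1)[OF that] Q Ke by (intro mult_mono) auto
    finally show ?thesis using Qd by linarith
  qed
  have ball: "cball (eta0 g (fst p), 0) \<rho> \<subseteq> U" if "p \<in> P" for p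
  proof -
    have "dist (eta0 g (fst p), 0::real) (\<eta>0, 0) \<le> \<rho>"
      using ctr\<rho>[OF that] by (simp add: dist_Pair_Pair dist_real_def)
    then show ?thesis unfolding U_def by (auto simp: cball_subset_cball_iff)
  qed
  have pdist: "\<bar>fst p - fst p'\<bar> + \<bar>snd p - snd p'\<bar> \<le> 2 * dist p p'" for p p' :: "real \<times> real"
    using abs_diff_le_dist[of p p'] by linarith

  have "degenerate_iteration P U (\<lambda>p. (eta0 g (fst p), 0)) (\<lambda>p y. T (F g p y)) (\<lambda>p y. T (H \<alpha> p y)) m L w (LF * \<epsilon>0) \<rho>"
  proof
    fix p p' y y' assume p: "p \<in> P" "p' \<in> P" and y: "y \<in> U" "y' \<in> U"
    note b = box[OF p(1) y(1)] box[OF p(2) y(2)]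
    have small: "\<bar>snd p\<bar> + \<bar>snd p'\<bar> + \<bar>fst y - \<eta>0\<bar> + \<bar>fst p' - a0\<bar> + \<bar>snd y'\<bar> \<le> 6 * \<rho>"
      using P[OF p(1)] P[OF p(2)] U[OF y(1)] U[OF y(2)] \<epsilon>\<rho> d\<rho> \<rho> by linarith
    define V where "V = (pi * ((\<alpha> - \<eta>0) * (snd y - snd y')), pi * (- a0 * (fst y - fst y')))"
    have "T V = y - y'"
    proof -
      have 1: "pi * (\<alpha> - \<eta>0) \<noteq> 0" "pi * a0 \<noteq> 0" using \<mu>\<nu> by (auto simp: \<mu>_def \<nu>_def \<eta>0_def)
      have "pi * (- a0 * (fst y - fst y')) / \<mu> = fst y - fst y'"
        using 1 by (simp add: \<mu>_def)
      moreover have "pi * ((\<alpha> - \<eta>0) * (snd y - snd y')) / \<nu> = snd y - snd y'"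
        using 1 by (simp add: \<nu>_def \<eta>0_def[symmetric])
      ultimately show ?thesis by (simp add: T_def swap_scale_def V_def prod_eq_iff)
    qed
    then have "(T (H \<alpha> p y) - T (H \<alpha> p' y')) - (y - y') = T ((H \<alpha> p y - H \<alpha> p' y') - V)"
      by (metis T_def swap_scale_diff)
    then have "norm ((T (H \<alpha> p y) - T (H \<alpha> p' y')) - (y - y')) \<le> tc * norm ((H \<alpha> p y - H \<alpha> p' y') - V)"
      using T_le by simp
    also have "\<dots> \<le> tc * (4 * pi * (H_const * (2 * dist p p' + 6 * \<rho> * (2 * norm (y - y')))))"
    proof (rule mult_left_mono[OF _ tc])
      have "(\<bar>snd p\<bar> + \<bar>snd p'\<bar> + \<bar>fst y - \<eta>0\<bar> + \<bar>fst p' - a0\<bar> + \<bar>snd y'\<bar>) * (\<bar>fst y - fst y'\<bar> + \<bar>snd y - snd y'\<bar>)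
          \<le> 6 * \<rho> * (2 * norm (y - y'))"
        using small abs_fst_le_norm[of "y - y'"] abs_snd_le_norm[of "y - y'"] \<rho>
        by (intro mult_mono) auto
      then show "norm ((H \<alpha> p y - H \<alpha> p' y') - V) \<le> 4 * pi * (H_const * (2 * dist p p' + 6 * \<rho> * (2 * norm (y - y'))))"
        unfolding V_def using H_const_nonneg
        by (intro order_trans[OF H_near_linear[OF b]] mult_left_mono add_mono pdist) auto
    qed
    also have "\<dots> = LH * dist p p' + 6 * (LH * \<rho>) * norm (y - y')" by (simp add: LH_def algebra_simps)
    also have "\<dots> \<le> L * dist p p' + w * norm (y - y')"
    proof (intro add_mono mult_right_mono L)
      have "LH * \<rho> \<le> Q * \<rho>" using Q \<rho> by (intro mult_right_mono) auto
      moreover have "0 \<le> Q * \<rho>" using Q \<rho> by simp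
      ultimately show "6 * (LH * \<rho>) \<le> w" using Q\<rho> by linarith
    qed auto
    finally show "norm ((T (H \<alpha> p y) - T (H \<alpha> p' y')) - (y - y')) \<le> L * dist p p' + w * norm (y - y')" .

    have "(T (F g p y) - T (H \<alpha> p y)) - (T (F g p' y') - T (H \<alpha> p' y'))
        = T ((F g p y - H \<alpha> p y) - (F g p' y' - H \<alpha> p' y'))"
      by (simp only: T_def swap_scale_diff)
    then have "norm ((T (F g p y) - T (H \<alpha> p y)) - (T (F g p' y') - T (H \<alpha> p' y')))
        \<le> tc * norm ((F g p y - H \<alpha> p y) - (F g p' y' - H \<alpha> p' y'))"
      using T_le by simp
    also have "\<dots> \<le> tc * (4 * pi * (E_const * (2 * dist p p' + \<epsilon>0 * \<bar>fst (y - y')\<bar> + \<bar>snd (y - y')\<bar>)))"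
    proof (rule mult_left_mono[OF _ tc])
      have "\<bar>snd p'\<bar> * \<bar>fst y - fst y'\<bar> \<le> \<epsilon>0 * \<bar>fst (y - y')\<bar>"
        using P(2)[OF p(2)] by (simp add: mult_right_mono)
      then have "\<bar>fst p - fst p'\<bar> + \<bar>snd y - snd y'\<bar> + \<bar>snd p - snd p'\<bar> + \<bar>snd p'\<bar> * \<bar>fst y - fst y'\<bar>
          \<le> 2 * dist p p' + \<epsilon>0 * \<bar>fst (y - y')\<bar> + \<bar>snd (y - y')\<bar>"
        using pdist[of p p'] by simp
      then show "norm ((F g p y - H \<alpha> p y) - (F g p' y' - H \<alpha> p' y'))
          \<le> 4 * pi * (E_const * (2 * dist p p' + \<epsilon>0 * \<bar>fst (y - y')\<bar> + \<bar>snd (y - y')\<bar>))"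
        using E_const_nonneg by (intro order_trans[OF E_diff[OF b]] mult_left_mono) auto
    qed
    also have "\<dots> = LE * dist p p' + LE * \<epsilon>0 / 2 * \<bar>fst (y - y')\<bar> + LE / 2 * \<bar>snd (y - y')\<bar>"
      by (simp add: LE_def algebra_simps)
    also have "\<dots> \<le> L * dist p p' + w * \<bar>fst (y - y')\<bar> + L * \<bar>snd (y - y')\<bar>"
    proof (intro add_mono mult_right_mono L)
      have "LE * \<epsilon>0 \<le> Q * \<epsilon>0" using Q \<epsilon>0 by (intro mult_right_mono) auto
      moreover have "0 \<le> Q * \<epsilon>0" using Q \<epsilon>0 by simp
      moreover have "\<rho> \<le> Q * \<rho>" using le_Q \<rho> by simp
      ultimately show "LE * \<epsilon>0 / 2 \<le> w" using Q\<epsilon> Q\<rho> \<rho> by linarith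
      show "LE / 2 \<le> L" using L nn by linarith
    qed auto
    finally show "norm ((T (F g p y) - T (H \<alpha> p y)) - (T (F g p' y') - T (H \<alpha> p' y')))
        \<le> L * dist p p' + w * \<bar>fst (y - y')\<bar> + L * \<bar>snd (y - y')\<bar>" .

    have dist_le: "dist (p, y) (p', y') \<le> dist p p' + norm (y - y')"
      unfolding dist_Pair_Pair dist_norm[of y y', symmetric] by (rule sqrt_sum_squares_le_sum) auto
    have "\<bar>m p y - m p' y'\<bar> = \<bar>slope (p, y) - slope (p', y')\<bar> * \<bar>\<mu> / \<nu>\<bar>"
      unfolding m_def abs_mult[symmetric] left_diff_distrib ..
    also have "\<dots> \<le> (M1 * (dist p p' + norm (y - y'))) * \<bar>\<mu> / \<nu>\<bar>"
    proof (rule mult_right_mono)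
      show "\<bar>slope (p, y) - slope (p', y')\<bar> \<le> M1 * (dist p p' + norm (y - y'))"
        using M1(1) dist_le by (intro order_trans[OF M1(2)] inS p y mult_left_mono)
    qed simp
    also have "\<dots> = Lm * dist p p' + Lm * norm (y - y')" by (simp add: Lm_def algebra_simps)
    also have "\<dots> \<le> L * dist p p' + L * norm (y - y')" by (intro add_mono mult_right_mono L) auto
    finally show "\<bar>m p y - m p' y'\<bar> \<le> L * dist p p' + L * norm (y - y')" .
  next
    fix p y assume p: "p \<in> P" and y: "y \<in> U"
    have S: "(p, y) \<in> {q. q \<in> boxes \<and> c \<le> \<bar>fst (fst q)\<bar> \<and> \<bar>snd (fst q)\<bar> * (2 * pi * param_const + param_const) \<le> c / 2}"
      using inS[OF p y] by (simp add: S_def)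
    have "fst (F g p y) = slope (p, y) * snd (F g p y)"
      using fst_F_eq[OF c S] by simp
    then show "snd (T (F g p y)) = m p y * fst (T (F g p y))"
      using \<mu>\<nu> by (simp add: T_def swap_scale_def m_def)
    have "\<bar>m p y\<bar> \<le> (2 / c * (1 + 2 * pi * param_const) * (\<bar>snd y\<bar> + \<bar>snd p\<bar>)) * \<bar>\<mu> / \<nu>\<bar>"
      unfolding m_def abs_mult using slope_bound[OF c S] by (intro mult_right_mono) auto
    also have "\<dots> = Cm * (\<bar>snd y\<bar> + \<bar>snd p\<bar>)" by (simp add: Cm_def mult_ac)
    also have "\<dots> \<le> Q * (3 * \<rho>)"
      using Q Cm \<rho> U[OF y] P[OF p] \<epsilon>\<rho> \<epsilon>0 by (intro mult_mono) auto
    also have "\<dots> \<le> w" using Q\<rho> mult_nonneg_nonneg[of Q \<rho>] Q \<rho> by linarith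
    finally show "\<bar>m p y\<bar> \<le> w" .
  next
    fix p p' assume p: "p \<in> P" "p' \<in> P"
    have "norm ((eta0 g (fst p), 0::real) - (eta0 g (fst p'), 0)) = \<bar>eta0 g (fst p) - eta0 g (fst p')\<bar>"
      by (simp add: norm_Pair)
    also have "\<dots> \<le> Ke * dist p p'"
      using Ke(1) abs_diff_le_dist(1)[of p p'] by (intro order_trans[OF ctr[OF p]] mult_left_mono)
    also have "\<dots> \<le> L * dist p p'" by (intro mult_right_mono L) simp
    finally show "norm ((eta0 g (fst p), 0) - (eta0 g (fst p'), 0::real)) \<le> L * dist p p'" .
  next
    fix p assume p: "p \<in> P"
    have y: "(eta0 g (fst p), 0) \<in> U" using ball[OF p] \<rho> by auto
    have "fst p \<noteq> 0" using P_a(1)[OF p] c by auto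
    then have "norm (F g p (eta0 g (fst p), 0)) \<le> 4 * pi * (F_const * \<bar>snd p\<bar>)"
      using F_diff[OF box[OF p y] box[OF P0[OF p] y]] F_at_eta0[of "fst p"] by simp
    also have "\<dots> \<le> 4 * pi * (F_const * \<epsilon>0)" using P(2)[OF p] F_const_nonneg by (intro mult_left_mono) auto
    finally have "tc * norm (F g p (eta0 g (fst p), 0)) \<le> tc * (4 * pi * (F_const * \<epsilon>0))"
      using tc by (rule mult_left_mono)
    then show "norm (T (F g p (eta0 g (fst p), 0))) \<le> LF * \<epsilon>0"
      using T_le[of "F g p (eta0 g (fst p), 0)"] by (simp add: LF_def mult_ac)
  next
    have "LF * \<epsilon>0 \<le> Q * \<epsilon>0" using Q \<epsilon>0 by (intro mult_right_mono) auto
    moreover have "\<rho> \<le> Q * \<rho>" using le_Q \<rho> by simp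
    ultimately show "8 * (LF * \<epsilon>0) \<le> \<rho>" "LF * \<epsilon>0 \<le> w" using Q\<epsilon> Q\<rho> \<rho> by linarith+
  qed (use ball L w \<rho> in auto)
  moreover have "d \<le> \<bar>a0\<bar> / 2" using d c_def by simp
  ultimately show ?thesis
    unfolding T_def P_def U_def \<eta>0_def
    using d(1) \<epsilon>0(1) box[unfolded P_def U_def \<eta>0_def] by blast
qed

end

section \<open>Periodic solutions\<close>

lemma neg_part_lipschitz: "1-lipschitz_on UNIV neg_part"
  by (rule lipschitz_onI) (auto simp: neg_part_def dist_real_def abs_if field_simps)

lemma periodic_bound:
  fixes f :: "real \<Rightarrow> real"
  assumes f: "\<And>t. f (t + 2*pi) = f t" and K: "\<And>t. \<lbrakk>0 \<le> t; t \<le> 2*pi\<rbrakk> \<Longrightarrow> f t \<le> K"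
  shows "f t \<le> K"
proof -
  interpret periodic_fun_simple f "2*pi" by standard (rule f)
  define n where "n = \<lfloor>t / (2*pi)\<rfloor>"
  have "of_int n \<le> t / (2*pi)" "t / (2*pi) < of_int n + 1" unfolding n_def by linarith+
  then have "of_int n * (2*pi) \<le> t" "t < (of_int n + 1) * (2*pi)"
    by (simp_all add: pos_le_divide_eq pos_divide_less_eq)
  then have "f (t - of_int n * (2*pi)) \<le> K" by (intro K) (auto simp: algebra_simps)
  then show ?thesis using minus_of_int[of t n] by simp
qed

text \<open>
  The box can be taken of any size in \<open>a\<close>, \<open>\<eta>\<close> and \<open>b\<close>; only \<open>\<epsilon>\<close> has to be small.
\<close>

lemma ex_oscillator_box_size:
  assumes "0 \<le> C" "1 \<le> (A::real)"
  shows "\<exists>e. 0 < e \<and> e \<le> 1 \<and> 4 * pi * e * (A + (1 + A) * C) \<le> 1"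
proof (intro exI conjI)
  let ?k = "4 * pi * (A + (1 + A) * C)"
  have k: "0 \<le> ?k" using assms by simp
  then show "0 < 1 / (1 + ?k)" "1 / (1 + ?k) \<le> 1" by (auto simp: divide_simps)
  have "4 * pi * (1 / (1 + ?k)) * (A + (1 + A) * C) = ?k / (1 + ?k)" by simp
  also have "\<dots> \<le> 1" using k by (simp add: divide_simps)
  finally show "4 * pi * (1 / (1 + ?k)) * (A + (1 + A) * C) \<le> 1" .
qed

theorem proposition4p2:
  fixes g :: "real \<Rightarrow> real" and \<alpha> a0 :: real
  assumes g: "g = neg_part \<or> (\<exists>C. C-lipschitz_on UNIV g)"
    and alpha: "0 < \<alpha>" "\<alpha> < 1" "\<alpha> \<noteq> eta0 g a0"
    and a0: "a0 \<noteq> 0"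
  shows "\<exists>d>0. \<exists>\<epsilon>0>0. \<exists>\<delta>>0. \<exists>\<rho>>0. \<exists>(\<eta> :: real \<times> real \<Rightarrow> real) (b :: real \<times> real \<Rightarrow> real) L \<kappa>.
     L-lipschitz_on (cball a0 d \<times> {-\<epsilon>0..\<epsilon>0}) \<eta> \<and>
     L-lipschitz_on (cball a0 d \<times> {-\<epsilon>0..\<epsilon>0}) b \<and>
     (\<forall>a\<in>cball a0 d. \<forall>\<epsilon>\<in>{-\<epsilon>0..\<epsilon>0}.
        (let p = (a, \<epsilon>); y = (\<eta> p, b p); x = sol (nonlin g) p y;
             W = cball (eta0 g a, 0) \<rho>
         in ivp_solution (nonlin g) p y x \<and>
            (\<forall>\<theta>. x (\<theta> + 2 * pi) = x \<theta>) \<and>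
            F g p y = 0 \<and>
            (\<forall>y0\<in>cball (eta0 g a, 0) \<delta>. \<exists>!Y. Y 0 = y0 \<and> iteration g \<alpha> p W Y) \<and>
            (\<forall>Y. Y 0 \<in> cball (eta0 g a, 0) \<delta> \<and> iteration g \<alpha> p W Y \<longrightarrow>
               (\<exists>z. Y \<longlonglongrightarrow> z \<and> F g p z = 0 \<and>
                    ivp_solution (nonlin g) p z (sol (nonlin g) p z) \<and>
                    (\<forall>\<theta>. sol (nonlin g) p z (\<theta> + 2 * pi) = sol (nonlin g) p z \<theta>))) \<and>
            (\<forall>Y. Y 0 = (eta0 g a, 0) \<and> iteration g \<alpha> p W Y \<longrightarrow> Y \<longlonglongrightarrow> y) \<and>
            (\<forall>\<theta>. \<bar>x \<theta> - a * cos \<theta> - b p * sin \<theta> + \<epsilon> * r g \<theta> a 0 (eta0 g a) 0\<bar>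
                  \<le> \<kappa> * \<epsilon>\<^sup>2)))"
proof -
  obtain C0 where "C0-lipschitz_on UNIV g" using g neg_part_lipschitz by blast
  then have C: "(max C0 1)-lipschitz_on UNIV g" by (rule lipschitz_on_mono) auto
  \<comment> \<open>A common Lipschitz constant for \<open>g\<close> and \<open>x \<mapsto> \<alpha> x\<close>; hence the maximum with \<open>1\<close>.\<close>
  have lin: "(max C0 1)-lipschitz_on UNIV (\<lambda>x. \<alpha> * x)"
  proof (rule lipschitz_onI)
    fix u v :: real
    have "dist (\<alpha> * u) (\<alpha> * v) = \<alpha> * dist u v"
      using alpha by (simp add: dist_real_def abs_mult right_diff_distrib[symmetric])
    also have "\<dots> \<le> max C0 1 * dist u v" using alpha by (intro mult_right_mono) auto
    finally show "dist (\<alpha> * u) (\<alpha> * v) \<le> max C0 1 * dist u v" .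
  qed auto
  \<comment> \<open>Room for \<open>\<bar>a - a0\<bar> \<le> 1\<close>, \<open>\<bar>\<eta> - eta0 g a0\<bar> \<le> 1\<close> and \<open>\<bar>b\<bar> \<le> 1\<close>.\<close>
  define A where "A = \<bar>a0\<bar> + \<bar>eta0 g a0\<bar> + 1"
  have A1: "1 \<le> A" by (simp add: A_def)
  have "0 \<le> max C0 1" by simp
  from ex_oscillator_box_size[OF this A1]
  obtain e where e: "0 < e" "e \<le> 1" "4 * pi * e * (A + (1 + A) * max C0 1) \<le> 1" by auto
  interpret oscillator_pair g "max C0 1" A e \<alpha>
    by unfold_locales (use C lin e alpha A1 in auto)
  define \<mu> where "\<mu> = - (pi * a0)"
  define \<nu> where "\<nu> = pi * (\<alpha> - eta0 g a0)"
  have \<mu>\<nu>: "\<mu> \<noteq> 0" "\<nu> \<noteq> 0" using a0 alpha by (auto simp: \<mu>_def \<nu>_def)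
  obtain d \<epsilon>0 \<rho> L w \<sigma> m where d: "0 < d" "d \<le> \<bar>a0\<bar> / 2" "0 < \<epsilon>0"
    and box: "\<forall>p\<in>cball a0 d \<times> {-\<epsilon>0..\<epsilon>0}. \<forall>y\<in>cball (eta0 g a0, 0) (2 * \<rho>). box p y"
    and deg: "degenerate_iteration (cball a0 d \<times> {-\<epsilon>0..\<epsilon>0}) (cball (eta0 g a0, 0) (2 * \<rho>))
      (\<lambda>p. (eta0 g (fst p), 0)) (\<lambda>p y. swap_scale \<mu> \<nu> (F g p y)) (\<lambda>p y. swap_scale \<mu> \<nu> (H \<alpha> p y))
      m L w \<sigma> \<rho>"
    using degenerate_iteration_near[OF a0 _ _ alpha(3)] unfolding \<mu>_def \<nu>_def A_def by auto
  define P where "P = cball a0 d \<times> {-\<epsilon>0..\<epsilon>0}"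
  interpret D: degenerate_iteration P "cball (eta0 g a0, 0) (2 * \<rho>)" "\<lambda>p. (eta0 g (fst p), 0)"
    "\<lambda>p y. swap_scale \<mu> \<nu> (F g p y)" "\<lambda>p y. swap_scale \<mu> \<nu> (H \<alpha> p y)" m L w \<sigma> \<rho>
    using deg by (simp add: P_def)
  have F_zero: "swap_scale \<mu> \<nu> (F g p y) = 0 \<longleftrightarrow> F g p y = 0" for p y
    using swap_scale_eq_iff[OF \<mu>\<nu>, of _ 0] by (simp add: swap_scale_def zero_prod_def)
  have iterates: "D.iterates p Y \<longleftrightarrow> iteration g \<alpha> p (cball (eta0 g (fst p), 0) \<rho>) Y" for p Y
    unfolding D.iterates_def iteration_def E_def swap_scale_diff swap_scale_eq_iff[OF \<mu>\<nu>]
    by (simp add: algebra_simps)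
  obtain l where l: "\<And>p Y. \<lbrakk>p \<in> P; D.iterates p Y; Y 0 = (eta0 g (fst p), 0)\<rbrakk> \<Longrightarrow> Y \<longlonglongrightarrow> l p"
    and F_l: "\<And>p. p \<in> P \<Longrightarrow> swap_scale \<mu> \<nu> (F g p (l p)) = 0"
    and l_in: "\<And>p. p \<in> P \<Longrightarrow> l p \<in> cball (eta0 g a0, 0) (2 * \<rho>)"
    and l_ctr: "\<And>p. \<lbrakk>p \<in> P; swap_scale \<mu> \<nu> (F g p (eta0 g (fst p), 0)) = 0\<rbrakk> \<Longrightarrow> l p = (eta0 g (fst p), 0)"
    and l_lip: "\<And>p p'. \<lbrakk>p \<in> P; p' \<in> P\<rbrakk> \<Longrightarrow> norm (l p - l p') \<le> 129 * L ^ 3 * dist p p'"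
    using D.limit_of_iterates by auto
  define M where "M = 129 * L ^ 3"
  have M: "0 \<le> M" using D.L_nonneg by (simp add: M_def)
  define \<kappa> where "\<kappa> = 2 * pi * (F_const * (1 + 2 * M))"
  have lip: "M-lipschitz_on P (\<lambda>p. fst (l p))" "M-lipschitz_on P (\<lambda>p. snd (l p))"
  proof (rule_tac [!] lipschitz_onI)
    fix p p' assume p: "p \<in> P" "p' \<in> P"
    show "dist (fst (l p)) (fst (l p')) \<le> M * dist p p'" "dist (snd (l p)) (snd (l p')) \<le> M * dist p p'"
      using l_lip[OF p] abs_fst_le_norm[of "l p - l p'"] abs_snd_le_norm[of "l p - l p'"]
      by (simp_all add: dist_real_def M_def)
  qed (use M in auto)
  have periodic: "sol (nonlin g) p y (t + 2*pi) = sol (nonlin g) p y t" if "F g p y = 0" for p y t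
    using sol_periodic[of "fst p" "snd p" "fst y" "snd y"] that by simp
  \<comment> \<open>All terms are periodic, so it suffices to consider one period.\<close>
  have expansion: "\<bar>sol (nonlin g) (a, \<epsilon>) (l (a, \<epsilon>)) t - a * cos t - snd (l (a, \<epsilon>)) * sin t
      + \<epsilon> * r g t a 0 (eta0 g a) 0\<bar> \<le> \<kappa> * \<epsilon>\<^sup>2" if a: "a \<in> cball a0 d" and \<epsilon>: "\<epsilon> \<in> {-\<epsilon>0..\<epsilon>0}" for a \<epsilon> t
  proof (rule periodic_bound[where t = t])
    have p: "(a, \<epsilon>) \<in> P" "(a, 0) \<in> P" using a \<epsilon> d by (auto simp: P_def)
    have a_nz: "a \<noteq> 0" using a d a0 by (auto simp: dist_real_def)
    have F0: "F g (a, 0) (eta0 g a, 0) = 0" by (rule F_at_eta0[OF a_nz])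
    then have "swap_scale \<mu> \<nu> (F g (a, 0) (eta0 g a, 0)) = 0" using F_zero by blast
    then have l0: "l (a, 0) = (eta0 g a, 0)" using l_ctr[OF p(2), unfolded fst_conv] by blast
    have b: "box (a, \<epsilon>) (fst (l (a, \<epsilon>)), snd (l (a, \<epsilon>)))" "box (a, 0) (eta0 g a, 0)"
      using box p l_in[OF p(1)] l_in[OF p(2)] l0 unfolding P_def by auto
    have "norm (l (a, \<epsilon>) - l (a, 0)) \<le> M * \<bar>\<epsilon>\<bar>"
      using l_lip[OF p] by (simp add: dist_Pair_Pair dist_real_def M_def)
    then have "\<bar>snd (l (a, \<epsilon>))\<bar> \<le> M * \<bar>\<epsilon>\<bar>" "\<bar>fst (l (a, \<epsilon>)) - eta0 g a\<bar> \<le> M * \<bar>\<epsilon>\<bar>"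
      using abs_fst_le_norm[of "l (a, \<epsilon>) - l (a, 0)"] abs_snd_le_norm[of "l (a, \<epsilon>) - l (a, 0)"]
      by (auto simp: l0)
    then have "\<bar>snd (l (a, \<epsilon>))\<bar> + \<bar>\<epsilon>\<bar> + \<bar>fst (l (a, \<epsilon>)) - eta0 g a\<bar> \<le> (1 + 2 * M) * \<bar>\<epsilon>\<bar>"
      by (simp add: algebra_simps)
    then have le: "\<bar>\<epsilon>\<bar> * (2 * pi * (F_const * (\<bar>snd (l (a, \<epsilon>))\<bar> + \<bar>\<epsilon>\<bar> + \<bar>fst (l (a, \<epsilon>)) - eta0 g a\<bar>)))
        \<le> \<bar>\<epsilon>\<bar> * (2 * pi * (F_const * ((1 + 2 * M) * \<bar>\<epsilon>\<bar>)))"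
      using F_const_nonneg by (intro mult_left_mono) auto
    show "\<bar>sol (nonlin g) (a, \<epsilon>) (l (a, \<epsilon>)) t - a * cos t - snd (l (a, \<epsilon>)) * sin t
        + \<epsilon> * r g t a 0 (eta0 g a) 0\<bar> \<le> \<kappa> * \<epsilon>\<^sup>2" if "0 \<le> t" "t \<le> 2*pi" for t
    proof -
      have "\<bar>\<epsilon>\<bar> * (2 * pi * (F_const * ((1 + 2 * M) * \<bar>\<epsilon>\<bar>))) = \<kappa> * \<epsilon>\<^sup>2"
        by (simp add: \<kappa>_def power2_eq_square abs_mult_self_eq[of \<epsilon>, symmetric] del: abs_mult_self_eq)
      then show ?thesis using expansion_error[OF b that] le unfolding r_def by simp
    qed
    have "F g (a, \<epsilon>) (l (a, \<epsilon>)) = 0" using F_l[OF p(1)] F_zero by simp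
    then show "\<bar>sol (nonlin g) (a, \<epsilon>) (l (a, \<epsilon>)) (t + 2*pi) - a * cos (t + 2*pi) - snd (l (a, \<epsilon>)) * sin (t + 2*pi)
        + \<epsilon> * r g (t + 2*pi) a 0 (eta0 g a) 0\<bar>
      = \<bar>sol (nonlin g) (a, \<epsilon>) (l (a, \<epsilon>)) t - a * cos t - snd (l (a, \<epsilon>)) * sin t
        + \<epsilon> * r g t a 0 (eta0 g a) 0\<bar>" for t
      by (simp add: periodic r_def rem_periodic[OF F0])
  qed
  have main: "ivp_solution (nonlin g) (a, \<epsilon>) (l (a, \<epsilon>)) (sol (nonlin g) (a, \<epsilon>) (l (a, \<epsilon>))) \<and>
      (\<forall>\<theta>. sol (nonlin g) (a, \<epsilon>) (l (a, \<epsilon>)) (\<theta> + 2 * pi) = sol (nonlin g) (a, \<epsilon>) (l (a, \<epsilon>)) \<theta>) \<and>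
      F g (a, \<epsilon>) (l (a, \<epsilon>)) = 0 \<and>
      (\<forall>y0\<in>cball (eta0 g a, 0) (\<rho> / (34 * L)).
         \<exists>!Y. Y 0 = y0 \<and> iteration g \<alpha> (a, \<epsilon>) (cball (eta0 g a, 0) \<rho>) Y) \<and>
      (\<forall>Y. Y 0 \<in> cball (eta0 g a, 0) (\<rho> / (34 * L)) \<and> iteration g \<alpha> (a, \<epsilon>) (cball (eta0 g a, 0) \<rho>) Y \<longrightarrow>
         (\<exists>z. Y \<longlonglongrightarrow> z \<and> F g (a, \<epsilon>) z = 0 \<and>
              ivp_solution (nonlin g) (a, \<epsilon>) z (sol (nonlin g) (a, \<epsilon>) z) \<and>
              (\<forall>\<theta>. sol (nonlin g) (a, \<epsilon>) z (\<theta> + 2 * pi) = sol (nonlin g) (a, \<epsilon>) z \<theta>))) \<and>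
      (\<forall>Y. Y 0 = (eta0 g a, 0) \<and> iteration g \<alpha> (a, \<epsilon>) (cball (eta0 g a, 0) \<rho>) Y \<longrightarrow> Y \<longlonglongrightarrow> l (a, \<epsilon>)) \<and>
      (\<forall>\<theta>. \<bar>sol (nonlin g) (a, \<epsilon>) (l (a, \<epsilon>)) \<theta> - a * cos \<theta> - snd (l (a, \<epsilon>)) * sin \<theta>
         + \<epsilon> * r g \<theta> a 0 (eta0 g a) 0\<bar> \<le> \<kappa> * \<epsilon>\<^sup>2)"
    if a: "a \<in> cball a0 d" and \<epsilon>: "\<epsilon> \<in> {-\<epsilon>0..\<epsilon>0}" for a \<epsilon>
  proof (intro conjI allI ballI impI)
    have p: "(a, \<epsilon>) \<in> P" using a \<epsilon> by (simp add: P_def)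
    note it = iterates[of "(a, \<epsilon>)", unfolded fst_conv]
    show F: "F g (a, \<epsilon>) (l (a, \<epsilon>)) = 0" using F_l[OF p] F_zero by simp
    show "ivp_solution (nonlin g) (a, \<epsilon>) (l (a, \<epsilon>)) (sol (nonlin g) (a, \<epsilon>) (l (a, \<epsilon>)))" by (rule ivp_sol)
    show "sol (nonlin g) (a, \<epsilon>) (l (a, \<epsilon>)) (\<theta> + 2 * pi) = sol (nonlin g) (a, \<epsilon>) (l (a, \<epsilon>)) \<theta>" for \<theta>
      by (rule periodic[OF F])
    show "\<exists>!Y. Y 0 = y0 \<and> iteration g \<alpha> (a, \<epsilon>) (cball (eta0 g a, 0) \<rho>) Y"
      if "y0 \<in> cball (eta0 g a, 0) (\<rho> / (34 * L))" for y0
      using D.iterates_exist[OF p, of y0] that unfolding it by simp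
    show "\<exists>z. Y \<longlonglongrightarrow> z \<and> F g (a, \<epsilon>) z = 0 \<and>
              ivp_solution (nonlin g) (a, \<epsilon>) z (sol (nonlin g) (a, \<epsilon>) z) \<and>
              (\<forall>\<theta>. sol (nonlin g) (a, \<epsilon>) z (\<theta> + 2 * pi) = sol (nonlin g) (a, \<epsilon>) z \<theta>)"
      if Y: "Y 0 \<in> cball (eta0 g a, 0) (\<rho> / (34 * L)) \<and> iteration g \<alpha> (a, \<epsilon>) (cball (eta0 g a, 0) \<rho>) Y" for Y
    proof -
      obtain z where "Y \<longlonglongrightarrow> z" "F g (a, \<epsilon>) z = 0"
        using D.iterates_converge[OF p, of Y] Y F_zero unfolding it by blast
      then show ?thesis using ivp_sol periodic by blast
    qed
    show "Y \<longlonglongrightarrow> l (a, \<epsilon>)"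
      if "Y 0 = (eta0 g a, 0) \<and> iteration g \<alpha> (a, \<epsilon>) (cball (eta0 g a, 0) \<rho>) Y" for Y
      using l[OF p, of Y] that unfolding it by simp
    show "\<bar>sol (nonlin g) (a, \<epsilon>) (l (a, \<epsilon>)) \<theta> - a * cos \<theta> - snd (l (a, \<epsilon>)) * sin \<theta>
        + \<epsilon> * r g \<theta> a 0 (eta0 g a) 0\<bar> \<le> \<kappa> * \<epsilon>\<^sup>2" for \<theta>
      by (rule expansion[OF a \<epsilon>])
  qed
  have \<delta>: "0 < \<rho> / (34 * L)" using D.\<rho>_pos D.L_ge_1 by simp
  show ?thesis
    unfolding Let_def
    by (rule exI[of _ d], rule conjI[OF d(1)], rule exI[of _ \<epsilon>0], rule conjI[OF d(3)],
        rule exI[of _ "\<rho> / (34 * L)"], rule conjI[OF \<delta>], rule exI[of _ \<rho>], rule conjI[OF D.\<rho>_pos],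
        rule exI[of _ "\<lambda>p. fst (l p)"], rule exI[of _ "\<lambda>p. snd (l p)"], rule exI[of _ M], rule exI[of _ \<kappa>],
        rule conjI[OF lip(1)[unfolded P_def]], rule conjI[OF lip(2)[unfolded P_def]], intro ballI,
        unfold prod.collapse, rule main)
qed

end
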